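(* Let $(X_i)_{i\in\mathbb{Z}}$ be a stationary sequence (in the setting described in the context) of centered random variables in $\mathbb{L}^3$ such that $\mathbb{E}(X_0X_k\mid\mathcal{I})=\mathbb{E}(X_0X_k)$ a.s. for any integer $k$. Suppose furthermore that the sequence $(X_0E_0(S_n))_{n\ge1}$ converges in $\mathbb{L}^1$. Then the series $\mathbb{E}(X_0^2)+2\sum_{k=1}^\infty\mathbb{E}(X_0X_k)$ is convergent to some nonnegative real $\sigma^2$. Let $$Z_0=X_0^2-\sigma^2+2\lim_{n}X_0E_0(S_n)\ \ (\text{limit in }\mathbb{L}^1),\qquad Z_l=Z_0\circ T^l,\qquad W_m=E_0(Z_1+Z_2+\cdots+Z_m).$$ Suppose that $\sigma^2>0$ (with $\sigma>0$) and let $\Lambda=\sigma^{-2}\mathbb{E}|X_0|^3$. Then, for every integer $n\ge1$, $$d_1(S_n,\sigma\sqrt{n}\,Y)\le\frac{13\sigma}{6}+\frac{\Lambda}{6}\log(1+2n)+\sum_{m=1}^{[\sqrt{2n}]}\frac{\|X_0W_m\|_1+2\sigma\|W_m\|_1}{m\sigma^2}+D',$$ where $$D'=\sum_{m=1}^n\frac{1}{\sigma\sqrt{m}}\Big\|\sum_{l\ge m}X_0E_0(X_l)\Big\|_1+\sum_{m=1}^n\frac{1}{2m}\big\|(1+\sigma^{-2}X_0^2)E_0(S_m)\big\|_1$$ and the series $\sum_{l\ge m}X_0E_0(X_l)$ is understood as an $\mathbb{L}^1$-limit.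
   Context: Let $(\Omega,\mathcal{A},\mathbb{P})$ be a probability space and $T:\Omega\to\Omega$ a bijective bimeasurable transformation preserving $\mathbb{P}$. $\mathcal{I}$ is the $\sigma$-algebra of invariant sets, i.e. of the $A\in\mathcal{A}$ with $T(A)=A$. $\mathcal{M}_0\subseteq\mathcal{A}$ is a sub-$\sigma$-algebra with $\mathcal{M}_0\subseteq T^{-1}(\mathcal{M}_0)$, and $\mathcal{M}_i=T^{-i}(\mathcal{M}_0)$ for $i\in\mathbb{Z}$ (a nondecreasing filtration). $E_i$ denotes conditional expectation with respect to $\mathcal{M}_i$. $X_0$ is an $\mathcal{M}_0$-measurable centered real random variable and $X_i=X_0\circ T^i$ for $i\in\mathbb{Z}$; $S_n=X_1+\cdots+X_n$. $Y$ is a $\mathcal{N}(0,1)$-distributed random variable. For integrable real random variables $U,V$, $d_1(U,V)=\sup_f \mathbb{E}(f(U)-f(V))$, the supremum being over all 1-Lipschitz functions $f:\mathbb{R}\to\mathbb{R}$. $\|\cdot\|_p$ is the $\mathbb{L}^p(\mathbb{P})$-norm (with value $+\infty$ allowed) and $[x]$ is the integer part of $x$. *)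

theory Defs
  imports "HOL-Probability.Probability"
begin

definition invertible_mpt :: "'a measure \<Rightarrow> ('a \<Rightarrow> 'a) \<Rightarrow> bool" where
  "invertible_mpt M T \<longleftrightarrow>
     bij_betw T (space M) (space M) \<and>
     T \<in> M \<rightarrow>\<^sub>M M \<and> inv_into (space M) T \<in> M \<rightarrow>\<^sub>M M \<and>
     distr M M T = M"

definition int_iterate :: "'a measure \<Rightarrow> ('a \<Rightarrow> 'a) \<Rightarrow> int \<Rightarrow> 'a \<Rightarrow> 'a" where
  "int_iterate M T i =
     (if 0 \<le> i then T ^^ nat i else inv_into (space M) T ^^ nat (- i))"

(* For an invertible T the generating family is itself a sigma-algebra, so these are exactly
   the invariant sets. *)
definition invariant_algebra :: "'a measure \<Rightarrow> ('a \<Rightarrow> 'a) \<Rightarrow> 'a measure" where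
  "invariant_algebra M T = sigma (space M) {A \<in> sets M. T ` A = A}"

definition L1_norm :: "'a measure \<Rightarrow> ('a \<Rightarrow> real) \<Rightarrow> ereal" where
  "L1_norm M f = enn2ereal (\<integral>\<^sup>+\<omega>. ennreal \<bar>f \<omega>\<bar> \<partial>M)"

definition L1_tendsto :: "'a measure \<Rightarrow> (nat \<Rightarrow> 'a \<Rightarrow> real) \<Rightarrow> ('a \<Rightarrow> real) \<Rightarrow> bool" where
  "L1_tendsto M f g \<longleftrightarrow>
     (\<forall>n. integrable M (f n)) \<and> integrable M g \<and>
     (\<lambda>n. L1_norm M (\<lambda>\<omega>. f n \<omega> - g \<omega>)) \<longlonglongrightarrow> 0"

definition L1_convergent :: "'a measure \<Rightarrow> (nat \<Rightarrow> 'a \<Rightarrow> real) \<Rightarrow> bool" where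
  "L1_convergent M f \<longleftrightarrow> (\<exists>g. L1_tendsto M f g)"

(* An arbitrary representative of the limit, which is unique only up to almost everywhere
   equality; unspecified if f does not converge. *)
definition L1_lim :: "'a measure \<Rightarrow> (nat \<Rightarrow> 'a \<Rightarrow> real) \<Rightarrow> 'a \<Rightarrow> real" where
  "L1_lim M f = (SOME g. L1_tendsto M f g)"

(* The distance depends only on the laws of U and V, which may therefore live on different
   probability spaces; on a common space the difference below is E(f(U) - f(V)). *)
definition d1 :: "'a measure \<Rightarrow> ('a \<Rightarrow> real) \<Rightarrow> 'b measure \<Rightarrow> ('b \<Rightarrow> real) \<Rightarrow> ereal" where
  "d1 M U N V =
     (SUP f \<in> {f :: real \<Rightarrow> real. 1-lipschitz_on UNIV f}.
        ereal ((\<integral>\<omega>. f (U \<omega>) \<partial>M) - (\<integral>\<omega>. f (V \<omega>) \<partial>N)))"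

end

theory Submission
  imports Defs
begin

text \<open>
Write \<open>\<phi>\<close> for the standard normal density and \<open>\<phi>\<^sub>t\<close> for that of \<open>N(0, t\<^sup>2)\<close>.

The proof is a Lindeberg argument in which the terms are replaced one after the other by Gaussian
variables of variance \<open>\<sigma>\<^sup>2\<close>, with one additional Gaussian variable that keeps every
intermediate function smooth. Fix a 1-Lipschitz \<open>f\<close> and let \<open>F\<^sub>m\<close> be the convolution of \<open>f\<close> with
\<open>N(0, m\<sigma>\<^sup>2)\<close>. Since \<open>f\<close> is only Lipschitz, its derivatives are taken from the kernel: the
\<open>j\<close>-th derivative of \<open>F\<^sub>m\<close> is a convolution with the Hermite function \<open>H\<^sub>j \<phi>\<close>, so it is
Lipschitz with constant \<open>c\<^sub>j / (\<sigma> sqrt m)^j\<close>, where \<open>c\<^sub>j\<close> is the integral of \<open>\<bar>H\<^sub>j\<bar> \<phi>\<close>. The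
constants in the theorem come from \<open>c\<^sub>1, c\<^sub>2 \<le> 1\<close>,
\<open>2 c\<^sub>1 + (c\<^sub>3/8) \<Sum> m^(-3/2) \<le> 13/6\<close> and \<open>2 sqrt 2 c\<^sub>1 + c\<^sub>3 \<le> 4\<close>.

Dependence enters as follows. With \<open>m = n - k + 1\<close> Gaussian variables in place, those for the times
\<open>k + 1, ..., n\<close> and the additional one, the quantity that is telescoped over \<open>k\<close> is not \<open>E F\<^sub>m(S\<^sub>k)\<close> but
\<open>E F\<^sub>m(S\<^sub>k) + E F\<^sub>m'(S\<^sub>k) (S\<^sub>n - S\<^sub>k)\<close>,
which equals \<open>E F\<^sub>1(S\<^sub>n)\<close> at \<open>k = n\<close> and \<open>F\<^bsub>n+1\<^esub>(0)\<close> at \<open>k = 0\<close>. Its increment consists of a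
Taylor remainder of third order, the error in the heat equation for \<open>F\<close>, two terms in which a
remainder of \<open>F\<^sub>m'\<close> of order \<open>1/m\<close> multiplies the predicted future sum (these give the norms of
\<open>E\<^sub>0(S\<^sub>m)\<close>), and
\<open>E F\<^sub>m''(S\<^bsub>k-1\<^esub>)\<close> times \<open>(X\<^sub>k\<^sup>2 - \<sigma>\<^sup>2)/2 + X\<^sub>k (S\<^sub>n - S\<^sub>k)\<close>. Replacing \<open>S\<^sub>n - S\<^sub>k\<close> by the
projection of the whole future turns the last factor into \<open>Z\<^sub>k / 2\<close>, at the price of the tails
\<open>\<Sum>l\<ge>m. X\<^sub>0 E\<^sub>0(X\<^sub>l)\<close>.

What is left is \<open>\<Sum>k. E F\<^sub>m''(S\<^bsub>k-1\<^esub>) Z\<^sub>k\<close>. Here \<open>F\<^sub>m''(S\<^bsub>k-1\<^esub>)\<close> varies little over times much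
shorter than \<open>m\<close>, so the sum is cut, from the end \<open>k = n\<close> backwards, into blocks of lengths
\<open>1, 2, 3, ...\<close>. The block of length \<open>p\<close> then sits at \<open>m\<close> near \<open>p\<^sup>2/2\<close>. Summation by parts in
each block produces \<open>W\<^sub>j\<close> with weights that sum over the blocks to order \<open>1/j\<close>, and only
\<open>j \<le> sqrt (2n)\<close> occurs.

All conditional expectations are reduced to \<open>E\<^sub>0\<close> by transporting the expectations with the
measure preserving map: after a shift by \<open>-k\<close> the sum \<open>S\<^sub>k\<close> becomes a sum over the past, which is
measurable for \<open>M\<^sub>0\<close>.
\<close>

section \<open>Hermite functions and Gaussian smoothing of Lipschitz functions\<close>

text \<open>
The probabilists' normalisation, orthogonal with respect to \<open>\<phi>\<close>; it is the one for which
\<open>H\<^sub>n \<phi>\<close> is the \<open>n\<close>-th derivative of \<open>\<phi>\<close> up to the sign \<open>(-1)^n\<close>.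
\<close>

fun hermite :: "nat \<Rightarrow> real \<Rightarrow> real" where
  "hermite 0 y = 1"
| "hermite (Suc 0) y = y"
| "hermite (Suc (Suc n)) y = y * hermite (Suc n) y - real (Suc n) * hermite n y"

lemma hermite_deriv: "(hermite (Suc n) has_real_derivative real (Suc n) * hermite n y) (at y)"
proof (induction n arbitrary: y rule: less_induct)
  case (less n)
  show ?case
  proof (cases n)
    case 0
    have "hermite (Suc 0) = (\<lambda>y. y)" by auto
    then show ?thesis using 0 by simp
  next
    case (Suc k)
    have d1: "(hermite n has_real_derivative real n * hermite k y) (at y)"
      using less.IH[of k y] Suc by simp
    have d2: "(hermite k has_real_derivative real k * hermite (k - 1) y) (at y)"
    proof (cases k)
      case 0
      have "hermite 0 = (\<lambda>y. 1)" by auto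
      then show ?thesis using 0 by simp
    next
      case (Suc l)
      then show ?thesis using less.IH[of l y] \<open>n = Suc k\<close> by simp
    qed
    have eq: "hermite (Suc n) = (\<lambda>y. y * hermite n y - real (Suc k) * hermite k y)"
      using Suc by auto
    have r: "hermite n y = y * hermite k y - real k * hermite (k - 1) y"
      using Suc by (cases k) auto
    have "((\<lambda>y. y * hermite n y - real (Suc k) * hermite k y) has_real_derivative
       (1 * hermite n y + (real n * hermite k y) * y - real (Suc k) * (real k * hermite (k - 1) y))) (at y)"
      by (intro DERIV_diff DERIV_mult DERIV_cmult d1 d2 DERIV_ident)
    also have "1 * hermite n y + (real n * hermite k y) * y - real (Suc k) * (real k * hermite (k - 1) y)
       = hermite n y + real n * (y * hermite k y - real k * hermite (k - 1) y)"
      using Suc by (simp add: algebra_simps)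
    also have "\<dots> = real (Suc n) * hermite n y"
      unfolding r[symmetric] by (simp add: algebra_simps)
    finally show ?thesis unfolding eq .
  qed
qed

lemma hermite_measurable [measurable]: "hermite n \<in> borel_measurable borel"
proof (cases n)
  case 0
  have "hermite 0 = (\<lambda>y. 1)" by auto
  then show ?thesis using 0 by simp
next
  case (Suc k)
  have "continuous_on UNIV (hermite n)" unfolding Suc
    using hermite_deriv by (meson DERIV_isCont continuous_at_imp_continuous_on)
  then show ?thesis by (rule borel_measurable_continuous_onI)
qed

lemma abs_le_exp_abs: "\<bar>y\<bar> \<le> exp \<bar>y::real\<bar>" "1 + \<bar>y\<bar> \<le> exp \<bar>y::real\<bar>"
  using exp_ge_add_one_self[of "\<bar>y\<bar>"] by linarith+

text \<open>
Exponential growth is all that integrability against \<open>\<phi>\<close> requires, and unlike polynomial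
degrees it is easy to carry through products, shifts and compositions.
\<close>

lemma hermite_exp_bound: "\<exists>C\<ge>0. \<forall>y. \<bar>hermite n y\<bar> \<le> C * exp (real n * \<bar>y\<bar>)"
proof (induction n rule: less_induct)
  case (less n)
  consider "n = 0" | "n = 1" | k where "n = Suc (Suc k)"
    by (metis One_nat_def not0_implies_Suc)
  then show ?case
  proof cases
    case 1
    then show ?thesis by (intro exI[of _ 1]) auto
  next
    case 2
    then show ?thesis using abs_le_exp_abs by (intro exI[of _ 1]) auto
  next
    case 3
    obtain C where C: "C \<ge> 0" "\<And>y. \<bar>hermite (Suc k) y\<bar> \<le> C * exp (real (Suc k) * \<bar>y\<bar>)"
      using less.IH[of "Suc k"] 3 by auto
    obtain D where D: "D \<ge> 0" "\<And>y. \<bar>hermite k y\<bar> \<le> D * exp (real k * \<bar>y\<bar>)"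
      using less.IH[of "k"] 3 by auto
    have "\<bar>hermite n y\<bar> \<le> (C + real (Suc k) * D) * exp (real n * \<bar>y\<bar>)" for y
    proof -
      have "\<bar>hermite n y\<bar> \<le> \<bar>y\<bar> * \<bar>hermite (Suc k) y\<bar> + real (Suc k) * \<bar>hermite k y\<bar>"
        unfolding 3 hermite.simps by (rule order_trans[OF abs_triangle_ineq4]) (simp add: abs_mult)
      also have "\<dots> \<le> exp \<bar>y\<bar> * (C * exp (real (Suc k) * \<bar>y\<bar>)) + real (Suc k) * (D * exp (real k * \<bar>y\<bar>))"
        using C D abs_le_exp_abs by (intro add_mono mult_mono) auto
      also have "exp \<bar>y\<bar> * (C * exp (real (Suc k) * \<bar>y\<bar>)) = C * exp (real n * \<bar>y\<bar>)"
        using 3 by (simp add: exp_add[symmetric] algebra_simps)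
      also have "real (Suc k) * (D * exp (real k * \<bar>y\<bar>)) \<le> real (Suc k) * (D * exp (real n * \<bar>y\<bar>))"
        using D 3 by (intro mult_left_mono) (auto intro!: mult_right_mono)
      finally show ?thesis by (simp add: algebra_simps)
    qed
    then show ?thesis using C D by (intro exI[of _ "C + real (Suc k) * D"]) auto
  qed
qed

definition hermite_fun :: "nat \<Rightarrow> real \<Rightarrow> real" where
  "hermite_fun n y = hermite n y * std_normal_density y"

lemma hermite_fun_measurable [measurable]: "hermite_fun n \<in> borel_measurable borel"
  unfolding hermite_fun_def by measurable

lemma std_normal_density_deriv:
  "(std_normal_density has_real_derivative - (y * std_normal_density y)) (at y)"
  unfolding std_normal_density_def
  by (rule derivative_eq_intros refl | simp)+

lemma hermite_fun_deriv: "(hermite_fun n has_real_derivative - hermite_fun (Suc n) y) (at y)"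
proof (cases n)
  case 0
  have "hermite_fun n = std_normal_density" using 0 by (auto simp: hermite_fun_def)
  then show ?thesis using std_normal_density_deriv 0 by (simp add: hermite_fun_def)
next
  case (Suc k)
  have eq: "hermite_fun n = (\<lambda>y. hermite n y * std_normal_density y)"
    by (auto simp: hermite_fun_def)
  have d: "(hermite n has_real_derivative real n * hermite k y) (at y)"
    using hermite_deriv Suc by simp
  show ?thesis unfolding eq
    by (rule derivative_eq_intros d std_normal_density_deriv refl | simp)+
       (use Suc in \<open>simp add: hermite_fun_def algebra_simps\<close>)
qed

lemma integrable_exp_std_normal:
  "integrable lborel (\<lambda>y. exp (a * y) * std_normal_density y)"
proof -
  have "exp (a * y) * std_normal_density y = exp (a\<^sup>2 / 2) * normal_density a 1 y" for y
    unfolding normal_density_def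
    by (simp add: exp_add[symmetric] power2_eq_square field_simps)
  then show ?thesis by (simp add: integrable_normal_density)
qed

lemma integrable_exp_abs_std_normal:
  "integrable lborel (\<lambda>y. exp (a * \<bar>y\<bar>) * std_normal_density y)"
proof (rule Bochner_Integration.integrable_bound)
  show "integrable lborel (\<lambda>y. exp (a * y) * std_normal_density y + exp ((-a) * y) * std_normal_density y)"
    by (intro Bochner_Integration.integrable_add integrable_exp_std_normal)
  show "AE x in lborel. norm (exp (a * \<bar>x\<bar>) * std_normal_density x)
         \<le> norm (exp (a * x) * std_normal_density x + exp (- a * x) * std_normal_density x)"
  proof (intro AE_I2)
    fix x
    have "exp (a * \<bar>x\<bar>) \<le> exp (a * x) + exp (- a * x)" by (cases "0 \<le> x") auto
    then have "exp (a * \<bar>x\<bar>) * std_normal_density x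
        \<le> (exp (a * x) + exp (- a * x)) * std_normal_density x"
      by (intro mult_right_mono normal_density_nonneg)
    then show "norm (exp (a * \<bar>x\<bar>) * std_normal_density x)
         \<le> norm (exp (a * x) * std_normal_density x + exp (- a * x) * std_normal_density x)"
      by (simp add: abs_mult normal_density_nonneg algebra_simps)
  qed
qed auto

lemma integrable_exp_bounded_std_normal:
  assumes [measurable]: "h \<in> borel_measurable borel"
    and "\<And>y. \<bar>h y\<bar> \<le> C * exp (a * \<bar>y\<bar>)"
  shows "integrable lborel (\<lambda>y. h y * std_normal_density y)"
proof (rule Bochner_Integration.integrable_bound)
  show "integrable lborel (\<lambda>y. C * (exp (a * \<bar>y\<bar>) * std_normal_density y))"
    by (intro integrable_mult_right integrable_exp_abs_std_normal)
  show "AE x in lborel. norm (h x * std_normal_density x)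
         \<le> norm (C * (exp (a * \<bar>x\<bar>) * std_normal_density x))"
  proof (intro AE_I2)
    fix x
    have "norm (h x * std_normal_density x) = \<bar>h x\<bar> * std_normal_density x"
      by (simp add: abs_mult normal_density_nonneg)
    also have "\<dots> \<le> C * exp (a * \<bar>x\<bar>) * std_normal_density x"
      by (intro mult_right_mono assms normal_density_nonneg)
    also have "\<dots> \<le> \<bar>C * exp (a * \<bar>x\<bar>) * std_normal_density x\<bar>" by (rule abs_ge_self)
    finally show "norm (h x * std_normal_density x)
         \<le> norm (C * (exp (a * \<bar>x\<bar>) * std_normal_density x))" by (simp add: mult.assoc)
  qed
qed measurable

lemma lipschitz_real_bound:
  fixes f :: "real \<Rightarrow> real"
  assumes "L-lipschitz_on UNIV f"
  shows "\<bar>f x - f y\<bar> \<le> L * \<bar>x - y\<bar>"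
  using lipschitz_onD[OF assms, of x y] by (simp add: dist_real_def)

lemma lipschitz_realI:
  fixes f :: "real \<Rightarrow> real"
  assumes "\<And>x y. \<bar>f x - f y\<bar> \<le> L * \<bar>x - y\<bar>" "0 \<le> L"
  shows "L-lipschitz_on UNIV f"
  using assms by (auto intro!: lipschitz_onI simp: dist_real_def)

lemma lipschitz_borel_measurable:
  fixes f :: "real \<Rightarrow> real"
  assumes "L-lipschitz_on UNIV f"
  shows "f \<in> borel_measurable borel"
  using lipschitz_on_continuous_on[OF assms] by (rule borel_measurable_continuous_onI)

lemma lipschitz_exp_bound:
  fixes f :: "real \<Rightarrow> real"
  assumes "L-lipschitz_on UNIV f"
  shows "\<bar>f (x + t * y)\<bar> \<le> (\<bar>f 0\<bar> + L * (\<bar>x\<bar> + \<bar>t\<bar>)) * exp \<bar>y\<bar>"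
proof -
  have L: "0 \<le> L" using assms by (rule lipschitz_on_nonneg)
  have "\<bar>f (x + t * y)\<bar> \<le> \<bar>f 0\<bar> + L * \<bar>x + t * y\<bar>"
    using lipschitz_real_bound[OF assms, of "x + t * y" 0] by simp
  also have "\<dots> \<le> \<bar>f 0\<bar> + L * (\<bar>x\<bar> + \<bar>t\<bar> * \<bar>y\<bar>)"
    using L by (intro add_left_mono mult_left_mono) (auto simp: abs_mult[symmetric])
  also have "\<dots> \<le> (\<bar>f 0\<bar> + L * (\<bar>x\<bar> + \<bar>t\<bar>)) * (1 + \<bar>y\<bar>)"
    using L by (simp add: algebra_simps)
  also have "\<dots> \<le> (\<bar>f 0\<bar> + L * (\<bar>x\<bar> + \<bar>t\<bar>)) * exp \<bar>y\<bar>"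
    using L abs_le_exp_abs by (intro mult_left_mono) auto
  finally show ?thesis .
qed

lemma integrable_lipschitz_hermite:
  assumes "L-lipschitz_on UNIV f"
  shows "integrable lborel (\<lambda>y. f (x + t * y) * hermite_fun j y)"
proof -
  note [measurable] = lipschitz_borel_measurable[OF assms]
  obtain C where C: "C \<ge> 0" "\<And>y. \<bar>hermite j y\<bar> \<le> C * exp (real j * \<bar>y\<bar>)"
    using hermite_exp_bound by blast
  have L: "0 \<le> L" using assms by (rule lipschitz_on_nonneg)
  have "integrable lborel (\<lambda>y. (f (x + t * y) * hermite j y) * std_normal_density y)"
  proof (rule integrable_exp_bounded_std_normal)
    fix y
    have "\<bar>f (x + t * y) * hermite j y\<bar>
        \<le> ((\<bar>f 0\<bar> + L * (\<bar>x\<bar> + \<bar>t\<bar>)) * exp \<bar>y\<bar>) * (C * exp (real j * \<bar>y\<bar>))"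
      unfolding abs_mult using C L by (intro mult_mono lipschitz_exp_bound[OF assms]) auto
    also have "\<dots> = ((\<bar>f 0\<bar> + L * (\<bar>x\<bar> + \<bar>t\<bar>)) * C) * exp ((1 + real j) * \<bar>y\<bar>)"
      by (simp add: exp_add algebra_simps)
    finally show "\<bar>f (x + t * y) * hermite j y\<bar>
      \<le> ((\<bar>f 0\<bar> + L * (\<bar>x\<bar> + \<bar>t\<bar>)) * C) * exp ((1 + real j) * \<bar>y\<bar>)" .
  qed measurable
  then show ?thesis by (simp add: hermite_fun_def mult.assoc)
qed

lemma hermite_fun_integrable: "integrable lborel (\<lambda>y. \<bar>hermite_fun j y\<bar>)"
  using integrable_lipschitz_hermite[of 0 "\<lambda>_. 1" 0 0 j] lipschitz_on_constant
  by (intro integrable_abs) auto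

text \<open>
For \<open>t > 0\<close>, the substitution \<open>u = x + t y\<close> turns this into the convolution of \<open>f\<close> with the
\<open>j\<close>-th derivative of the density \<open>\<phi>\<^sub>t\<close>; in particular \<open>j = 0\<close> is the convolution of \<open>f\<close> with
\<open>N(0, t\<^sup>2)\<close>. Keeping \<open>f(x + t y)\<close> in the integrand makes Lipschitz bounds immediate and gives the
value \<open>f x\<close> at \<open>t = 0\<close>, \<open>j = 0\<close>.
\<close>

definition smoothing :: "nat \<Rightarrow> real \<Rightarrow> (real \<Rightarrow> real) \<Rightarrow> real \<Rightarrow> real" where
  "smoothing j t f x = (\<integral>y. f (x + t * y) * hermite_fun j y \<partial>lborel) / t ^ j"

definition hermite_norm :: "nat \<Rightarrow> real" where
  "hermite_norm j = (\<integral>y. \<bar>hermite_fun j y\<bar> \<partial>lborel)"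

lemma hermite_norm_nonneg: "0 \<le> hermite_norm j"
  unfolding hermite_norm_def by (rule integral_nonneg_AE) auto

lemma smoothing_lipschitz:
  assumes f: "1-lipschitz_on UNIV f" and t: "0 < t"
  shows "(hermite_norm j / t ^ j)-lipschitz_on UNIV (smoothing j t f)"
proof (rule lipschitz_realI)
  fix x z
  have "(\<integral>y. f (x + t * y) * hermite_fun j y \<partial>lborel) - (\<integral>y. f (z + t * y) * hermite_fun j y \<partial>lborel)
      = (\<integral>y. f (x + t * y) * hermite_fun j y - f (z + t * y) * hermite_fun j y \<partial>lborel)"
    by (intro Bochner_Integration.integral_diff[symmetric] integrable_lipschitz_hermite[OF f])
  also have "\<bar>\<dots>\<bar> \<le> (\<integral>y. \<bar>x - z\<bar> * \<bar>hermite_fun j y\<bar> \<partial>lborel)"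
  proof (rule integral_abs_bound_integral)
    fix y
    have "\<bar>f (x + t * y) * hermite_fun j y - f (z + t * y) * hermite_fun j y\<bar>
        = \<bar>f (x + t * y) - f (z + t * y)\<bar> * \<bar>hermite_fun j y\<bar>"
      by (simp add: abs_mult[symmetric] algebra_simps)
    also have "\<dots> \<le> \<bar>x - z\<bar> * \<bar>hermite_fun j y\<bar>"
      using lipschitz_real_bound[OF f, of "x + t * y" "z + t * y"] by (intro mult_right_mono) auto
    finally show "\<bar>f (x + t * y) * hermite_fun j y - f (z + t * y) * hermite_fun j y\<bar>
        \<le> \<bar>x - z\<bar> * \<bar>hermite_fun j y\<bar>" .
  qed (intro Bochner_Integration.integrable_diff integrable_lipschitz_hermite[OF f] integrable_mult_right hermite_fun_integrable)+
  finally have "\<bar>(\<integral>y. f (x + t * y) * hermite_fun j y \<partial>lborel) - (\<integral>y. f (z + t * y) * hermite_fun j y \<partial>lborel)\<bar>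
     \<le> \<bar>x - z\<bar> * hermite_norm j" unfolding hermite_norm_def by simp
  then show "\<bar>smoothing j t f x - smoothing j t f z\<bar> \<le> hermite_norm j / t ^ j * \<bar>x - z\<bar>"
    unfolding smoothing_def diff_divide_distrib[symmetric] abs_divide using t
    by (simp add: field_simps)
qed (use t hermite_norm_nonneg in auto)

text \<open>
Differentiation under the integral sign reduces to this criterion, because a second order Taylor
bound can be integrated directly.
\<close>

lemma has_derivative_of_quadratic_error:
  fixes F :: "real \<Rightarrow> real"
  assumes "\<And>h. \<bar>h\<bar> \<le> d \<Longrightarrow> \<bar>F (x + h) - F x - h * D\<bar> \<le> K * h\<^sup>2" "0 < d"
  shows "(F has_real_derivative D) (at x)"
proof -
  have "((\<lambda>h. (F (x + h) - F x) / h - D) \<longlongrightarrow> 0) (at 0)"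
  proof (rule Lim_null_comparison)
    show "((\<lambda>h. K * \<bar>h\<bar>) \<longlongrightarrow> 0) (at (0::real))"
      by (auto intro!: tendsto_eq_intros)
    have "eventually (\<lambda>h. h \<in> {-d<..<d} \<and> h \<noteq> 0) (at (0::real))"
      using assms(2) by (intro eventually_conj eventually_at_in_open' eventually_neq_at_within) auto
    then show "\<forall>\<^sub>F h in at 0. norm ((F (x + h) - F x) / h - D) \<le> K * \<bar>h\<bar>"
    proof eventually_elim
      case (elim h)
      then have "\<bar>F (x + h) - F x - h * D\<bar> \<le> K * h\<^sup>2" by (intro assms) auto
      moreover have "(F (x + h) - F x) / h - D = (F (x + h) - F x - h * D) / h"
        using elim by (simp add: field_simps)
      ultimately show ?case using elim
        by (simp add: field_simps power2_eq_square abs_mult[symmetric])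
    qed
  qed
  then show ?thesis unfolding DERIV_def by (subst LIM_zero_iff[symmetric])
qed

text \<open>
The common core of the Taylor estimates below: a remainder is parametrised by \<open>s \<in> [0, 1]\<close> along the
segment from \<open>x\<close> to \<open>x + h\<close>, which treats positive and negative \<open>h\<close> alike.
\<close>

lemma integrate_bound:
  fixes r r' :: "real \<Rightarrow> real"
  assumes "\<And>s. 0 \<le> s \<Longrightarrow> s \<le> 1 \<Longrightarrow> (r has_real_derivative r' s) (at s)"
    and "\<And>s. 0 \<le> s \<Longrightarrow> s \<le> 1 \<Longrightarrow> \<bar>r' s\<bar> \<le> C * s ^ n" and "r 0 = 0"
  shows "\<bar>r 1\<bar> \<le> C / real (Suc n)"
proof -
  have d: "((\<lambda>s. C * s ^ Suc n / real (Suc n)) has_real_derivative C * s ^ n) (at s)" for s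
    by (rule derivative_eq_intros refl | simp)+
  have "r 1 - C * 1 ^ Suc n / real (Suc n) \<le> r 0 - C * 0 ^ Suc n / real (Suc n)"
  proof (rule DERIV_nonpos_imp_nonincreasing[of 0 1])
    fix s :: real assume s: "0 \<le> s" "s \<le> 1"
    show "\<exists>y. ((\<lambda>s. r s - C * s ^ Suc n / real (Suc n)) has_real_derivative y) (at s) \<and> y \<le> 0"
      using assms(2)[OF s] by (intro exI[of _ "r' s - C * s ^ n"] conjI DERIV_diff assms(1) d s) linarith
  qed simp
  moreover have "- r 1 - C * 1 ^ Suc n / real (Suc n) \<le> - r 0 - C * 0 ^ Suc n / real (Suc n)"
  proof (rule DERIV_nonpos_imp_nonincreasing[of 0 1])
    fix s :: real assume s: "0 \<le> s" "s \<le> 1"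
    show "\<exists>y. ((\<lambda>s. - r s - C * s ^ Suc n / real (Suc n)) has_real_derivative y) (at s) \<and> y \<le> 0"
      using assms(2)[OF s] by (intro exI[of _ "- r' s - C * s ^ n"] conjI DERIV_diff DERIV_minus assms(1) d s) linarith
  qed simp
  ultimately show ?thesis using assms(3) by (simp add: abs_le_iff)
qed

text \<open>
In these Taylor estimates a Lipschitz constant takes the place of a bound for the next derivative; for
smoothings of Lipschitz functions it is read off from the kernel.
\<close>

lemma taylor_lipschitz_1:
  assumes "\<And>x. (g has_real_derivative g1 x) (at x)" and L: "L-lipschitz_on UNIV g1"
  shows "\<bar>g (x + h) - g x - h * g1 x\<bar> \<le> L * h\<^sup>2 / 2"
proof -
  let ?r = "\<lambda>s. g (x + s * h) - g x - s * h * g1 x"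
  have "\<bar>?r 1\<bar> \<le> (L * h\<^sup>2) / real (Suc 1)"
  proof (rule integrate_bound[where r = ?r and r' = "\<lambda>s. h * (g1 (x + s * h) - g1 x)"])
    fix s :: real assume s: "0 \<le> s" "s \<le> 1"
    have "((\<lambda>s. g (x + s * h)) has_real_derivative g1 (x + s * h) * h) (at s)"
      by (rule DERIV_chain'[OF _ assms(1), where f = "\<lambda>s. x + s * h"]) (auto intro!: derivative_eq_intros)
    then show "(?r has_real_derivative h * (g1 (x + s * h) - g1 x)) (at s)"
      by (auto intro!: derivative_eq_intros simp: algebra_simps)
    have "\<bar>g1 (x + s * h) - g1 x\<bar> \<le> L * (s * \<bar>h\<bar>)"
      using lipschitz_real_bound[OF L, of "x + s * h" x] s by (simp add: abs_mult)
    then have "\<bar>h\<bar> * \<bar>g1 (x + s * h) - g1 x\<bar> \<le> \<bar>h\<bar> * (L * (s * \<bar>h\<bar>))"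
      by (rule mult_left_mono) auto
    also have "\<bar>h\<bar> * (L * (s * \<bar>h\<bar>)) = L * h\<^sup>2 * s ^ 1"
      using abs_mult_self_eq[of h] by (simp add: power2_eq_square algebra_simps)
    finally show "\<bar>h * (g1 (x + s * h) - g1 x)\<bar> \<le> L * h\<^sup>2 * s ^ 1"
      by (simp only: abs_mult)
  qed simp
  then show ?thesis by simp
qed

lemma taylor_lipschitz_2:
  assumes "\<And>x. (g has_real_derivative g1 x) (at x)" and "\<And>x. (g1 has_real_derivative g2 x) (at x)"
    and L: "L-lipschitz_on UNIV g2"
  shows "\<bar>g (x + h) - g x - h * g1 x - h\<^sup>2 / 2 * g2 x\<bar> \<le> L * \<bar>h\<bar> ^ 3 / 6"
proof -
  let ?r = "\<lambda>s. g (x + s * h) - g x - s * h * g1 x - (s * h)\<^sup>2 / 2 * g2 x"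
  have "\<bar>?r 1\<bar> \<le> (L * \<bar>h\<bar> ^ 3 / 2) / real (Suc 2)"
  proof (rule integrate_bound[where r = ?r and r' = "\<lambda>s. h * (g1 (x + s * h) - g1 x - s * h * g2 x)"])
    fix s :: real assume s: "0 \<le> s" "s \<le> 1"
    have "((\<lambda>s. g (x + s * h)) has_real_derivative g1 (x + s * h) * h) (at s)"
      by (rule DERIV_chain'[OF _ assms(1), where f = "\<lambda>s. x + s * h"]) (auto intro!: derivative_eq_intros)
    then show "(?r has_real_derivative h * (g1 (x + s * h) - g1 x - s * h * g2 x)) (at s)"
      by (auto intro!: derivative_eq_intros simp: algebra_simps power2_eq_square)
    have "\<bar>h\<bar> * \<bar>g1 (x + s * h) - g1 x - s * h * g2 x\<bar> \<le> \<bar>h\<bar> * (L * (s * h)\<^sup>2 / 2)"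
      by (intro mult_left_mono taylor_lipschitz_1[OF assms(2) L]) auto
    also have "\<dots> = L * \<bar>h\<bar> ^ 3 / 2 * s ^ 2"
      by (simp add: power3_eq_cube power2_eq_square abs_mult_self_eq[of h, symmetric] del: abs_mult_self_eq)
    finally show "\<bar>h * (g1 (x + s * h) - g1 x - s * h * g2 x)\<bar> \<le> L * \<bar>h\<bar> ^ 3 / 2 * s ^ 2"
      by (simp add: abs_mult)
  qed simp
  then show ?thesis by simp
qed

lemma taylor_lipschitz_3:
  assumes "\<And>x. (g has_real_derivative g1 x) (at x)" and "\<And>x. (g1 has_real_derivative g2 x) (at x)"
    and "\<And>x. (g2 has_real_derivative g3 x) (at x)" and L: "L-lipschitz_on UNIV g3"
  shows "\<bar>g (x + h) - g x - h * g1 x - h\<^sup>2 / 2 * g2 x - h ^ 3 / 6 * g3 x\<bar> \<le> L * h ^ 4 / 24"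
proof -
  let ?r = "\<lambda>s. g (x + s * h) - g x - s * h * g1 x - (s * h)\<^sup>2 / 2 * g2 x - (s * h) ^ 3 / 6 * g3 x"
  let ?r' = "\<lambda>s. h * (g1 (x + s * h) - g1 x - s * h * g2 x - (s * h)\<^sup>2 / 2 * g3 x)"
  have "\<bar>?r 1\<bar> \<le> (L * h ^ 4 / 6) / real (Suc 3)"
  proof (rule integrate_bound[where r = ?r and r' = ?r'])
    fix s :: real assume s: "0 \<le> s" "s \<le> 1"
    have "((\<lambda>s. g (x + s * h)) has_real_derivative g1 (x + s * h) * h) (at s)"
      by (rule DERIV_chain'[OF _ assms(1), where f = "\<lambda>s. x + s * h"]) (auto intro!: derivative_eq_intros)
    then show "(?r has_real_derivative ?r' s) (at s)"
      by (auto intro!: derivative_eq_intros simp: algebra_simps power2_eq_square power3_eq_cube)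
    have "\<bar>h\<bar> * \<bar>g1 (x + s * h) - g1 x - s * h * g2 x - (s * h)\<^sup>2 / 2 * g3 x\<bar> \<le> \<bar>h\<bar> * (L * \<bar>s * h\<bar> ^ 3 / 6)"
      by (intro mult_left_mono taylor_lipschitz_2[OF assms(2,3) L]) auto
    also have "\<dots> = L * h ^ 4 / 6 * s ^ 3"
      using s by (simp add: abs_mult power_mult_distrib power4_eq_xxxx power3_eq_cube abs_mult_self_eq)
    finally show "\<bar>?r' s\<bar> \<le> L * h ^ 4 / 6 * s ^ 3"
      by (simp add: abs_mult)
  qed simp
  then show ?thesis by simp
qed

text \<open>
An envelope, uniform in small shifts, for dominating the Taylor remainder of the kernel. It holds
since \<open>\<phi>(y - s) = \<phi>(y) exp (y s - s\<^sup>2/2) \<le> \<phi>(y) exp \<bar>y\<bar>\<close> for \<open>\<bar>s\<bar> \<le> 1\<close>.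
\<close>

lemma hermite_fun_shift_bound:
  "\<exists>C\<ge>0. \<exists>k. \<forall>y s. \<bar>s\<bar> \<le> 1 \<longrightarrow> \<bar>hermite_fun n (y - s)\<bar> \<le> C * exp (k * \<bar>y\<bar>) * std_normal_density y"
proof -
  obtain C where C: "C \<ge> 0" "\<And>y. \<bar>hermite n y\<bar> \<le> C * exp (real n * \<bar>y\<bar>)"
    using hermite_exp_bound by blast
  have "\<bar>hermite_fun n (y - s)\<bar> \<le> (C * exp (real n)) * exp ((real n + 1) * \<bar>y\<bar>) * std_normal_density y"
    if s: "\<bar>s\<bar> \<le> 1" for y s
  proof -
    have "\<bar>hermite n (y - s)\<bar> \<le> C * exp (real n * (1 + \<bar>y\<bar>))"
      using C s by (intro order_trans[OF C(2)] mult_left_mono) (auto intro!: mult_left_mono)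
    moreover have "std_normal_density (y - s) \<le> exp \<bar>y\<bar> * std_normal_density y"
    proof -
      have "- (y - s)\<^sup>2 / 2 \<le> \<bar>y\<bar> - y\<^sup>2 / 2"
      proof -
        have "y * s \<le> \<bar>y\<bar> * 1" 
          using mult_left_mono[OF s, of "\<bar>y\<bar>"] abs_ge_self[of "y * s"] by (simp add: abs_mult)
        moreover have "- (y - s)\<^sup>2 / 2 = y * s - y\<^sup>2 / 2 - s\<^sup>2 / 2" 
          by (simp add: power2_diff field_simps)
        ultimately show ?thesis using zero_le_power2[of s] by linarith
      qed
      then have "exp (- (y - s)\<^sup>2 / 2) \<le> exp \<bar>y\<bar> * exp (- y\<^sup>2 / 2)"
        by (simp add: exp_add[symmetric])
      then show ?thesis unfolding std_normal_density_def by (simp add: field_simps)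
    qed
    ultimately have "\<bar>hermite n (y - s)\<bar> * std_normal_density (y - s)
        \<le> (C * exp (real n * (1 + \<bar>y\<bar>))) * (exp \<bar>y\<bar> * std_normal_density y)"
      using C by (intro mult_mono) (auto simp: normal_density_nonneg)
    then show ?thesis
      by (simp add: hermite_fun_def abs_mult normal_density_nonneg exp_add algebra_simps)
  qed
  then show ?thesis using C(1) by (intro exI[of _ "C * exp (real n)"] conjI exI[of _ "real n + 1"]) auto
qed

lemma integral_smoothing_shift:
  fixes f g :: "real \<Rightarrow> real"
  assumes "t \<noteq> 0"
  shows "(\<integral>y. f (x + h + t * y) * g y \<partial>lborel) = (\<integral>y. f (x + t * y) * g (y - h / t) \<partial>lborel)"
  using lborel_integral_real_affine[of 1 "\<lambda>y. f (x + t * y) * g (y - h / t)" "h / t"] assms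
  by (simp add: algebra_simps)

text \<open>
A translation of the integration variable moves the increment \<open>h\<close> from the Lipschitz function \<open>f\<close> to
the smooth kernel, where \<open>(H\<^sub>j \<phi>)' = - H\<^bsub>j+1\<^esub> \<phi>\<close>; the second order remainder is dominated by the
envelope of the preceding lemma.
\<close>

lemma smoothing_deriv:
  assumes f: "1-lipschitz_on UNIV f" and t: "0 < t"
  shows "(smoothing j t f has_real_derivative smoothing (Suc j) t f x) (at x)"
proof -
  note [measurable] = lipschitz_borel_measurable[OF f]
  obtain C k where C: "C \<ge> 0"
     and Ck: "\<And>y s. \<bar>s\<bar> \<le> 1 \<Longrightarrow> \<bar>hermite_fun (Suc (Suc j)) (y - s)\<bar> \<le> C * exp (k * \<bar>y\<bar>) * std_normal_density y"
    using hermite_fun_shift_bound[of "Suc (Suc j)"] by blast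
  \<comment> \<open>Dominates \<open>f (x + t y)\<close> times the second derivative of the kernel at all points within distance 1 of \<open>y\<close>.\<close>
  define env where "env y = \<bar>f (x + t * y)\<bar> * (C * exp (k * \<bar>y\<bar>)) * std_normal_density y" for y
  have env: "integrable lborel env" unfolding env_def
  proof (rule integrable_exp_bounded_std_normal)
    fix y
    show "\<bar>\<bar>f (x + t * y)\<bar> * (C * exp (k * \<bar>y\<bar>))\<bar> \<le> ((\<bar>f 0\<bar> + 1 * (\<bar>x\<bar> + \<bar>t\<bar>)) * C) * exp ((1 + k) * \<bar>y\<bar>)"
      using C mult_right_mono[OF lipschitz_exp_bound[OF f, of x t y], of "C * exp (k * \<bar>y\<bar>)"]
      by (simp add: abs_mult exp_add algebra_simps)
  qed measurable
  define G where "G i x = (\<integral>y. f (x + t * y) * hermite_fun i y \<partial>lborel)" for i x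
  define K where "K = (\<integral>y. env y \<partial>lborel)"
  have taylor: "\<bar>hermite_fun j (y - s) - hermite_fun j y - s * hermite_fun (Suc j) y\<bar>
     \<le> s\<^sup>2 * (C * exp (k * \<bar>y\<bar>) * std_normal_density y)" if s: "\<bar>s\<bar> \<le> 1" for y s
  proof -
    let ?B = "s\<^sup>2 * (C * exp (k * \<bar>y\<bar>) * std_normal_density y)"
    let ?h = "hermite_fun j" and ?h1 = "hermite_fun (Suc j)" and ?h2 = "hermite_fun (Suc (Suc j))"
    have chain: "((\<lambda>u. hermite_fun i (y - u * s)) has_real_derivative s * hermite_fun (Suc i) (y - u * s)) (at u)" for i u
    proof -
      have "((\<lambda>u. hermite_fun i (y - u * s)) has_real_derivative - hermite_fun (Suc i) (y - u * s) * (- s)) (at u)"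
        by (rule DERIV_chain'[OF _ hermite_fun_deriv, where f = "\<lambda>u. y - u * s"]) (auto intro!: derivative_eq_intros)
      then show ?thesis by (simp add: mult.commute)
    qed
    have first: "\<bar>?h1 (y - u * s) - ?h1 y\<bar> * \<bar>s\<bar> \<le> ?B" if u: "0 \<le> u" "u \<le> 1" for u
    proof -
      let ?r = "\<lambda>v. s * (?h1 (y - v * (u * s)) - ?h1 y)"
      have "\<bar>?r 1\<bar> \<le> ?B / real (Suc 0)"
      proof (rule integrate_bound[where r = ?r and r' = "\<lambda>v. s * (s * u * ?h2 (y - v * (u * s)))"])
        fix v :: real assume v: "0 \<le> v" "v \<le> 1"
        have "((\<lambda>v. ?h1 (y - v * (u * s))) has_real_derivative - ?h2 (y - v * (u * s)) * (- (u * s))) (at v)"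
          by (rule DERIV_chain'[OF _ hermite_fun_deriv, where f = "\<lambda>v. y - v * (u * s)"]) (auto intro!: derivative_eq_intros)
        then show "(?r has_real_derivative s * (s * u * ?h2 (y - v * (u * s)))) (at v)"
          by (auto intro!: derivative_eq_intros)
        have vus: "\<bar>v * (u * s)\<bar> \<le> 1" using v u s by (simp add: abs_mult mult_le_one)
        have "\<bar>s * (s * u * ?h2 (y - v * (u * s)))\<bar> = s\<^sup>2 * (u * \<bar>?h2 (y - v * (u * s))\<bar>)"
          using u by (simp add: abs_mult power2_eq_square abs_mult_self_eq[of s, symmetric] del: abs_mult_self_eq)
        also have "\<dots> \<le> s\<^sup>2 * (1 * (C * exp (k * \<bar>y\<bar>) * std_normal_density y))"
          using u by (intro mult_left_mono mult_mono Ck vus) auto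
        finally show "\<bar>s * (s * u * ?h2 (y - v * (u * s)))\<bar> \<le> ?B * v ^ 0" by simp
      qed simp
      then show ?thesis by (simp add: abs_mult mult.commute)
    qed
    let ?r = "\<lambda>u. ?h (y - u * s) - ?h y - u * s * ?h1 y"
    have "\<bar>?r 1\<bar> \<le> ?B / real (Suc 0)"
    proof (rule integrate_bound[where r = ?r and r' = "\<lambda>u. s * (?h1 (y - u * s) - ?h1 y)"])
      fix u :: real assume u: "0 \<le> u" "u \<le> 1"
      show "(?r has_real_derivative s * (?h1 (y - u * s) - ?h1 y)) (at u)"
        using chain[of j u] by (auto intro!: derivative_eq_intros simp: algebra_simps)
      show "\<bar>s * (?h1 (y - u * s) - ?h1 y)\<bar> \<le> ?B * u ^ 0"
        using first[OF u] by (simp add: abs_mult mult.commute)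
    qed simp
    then show ?thesis by simp
  qed
  have "(G j has_real_derivative G (Suc j) x / t) (at x)"
  proof (rule has_derivative_of_quadratic_error[where d = t and K = "K / t\<^sup>2"])
    fix h assume h: "\<bar>h\<bar> \<le> t"
    define s where "s = h / t"
    have s: "\<bar>s\<bar> \<le> 1" using h t by (simp add: s_def)
    have int: "integrable lborel (\<lambda>y. f (x + t * y) * hermite_fun j (y - s))"
      using integrable_lipschitz_hermite[OF f, of "x + h" t j]
      using lborel_integrable_real_affine_iff[of 1 "\<lambda>y. f (x + t * y) * hermite_fun j (y - s)" s] t
      by (simp add: s_def algebra_simps)
    have shift: "G j (x + h) = (\<integral>y. f (x + t * y) * hermite_fun j (y - s) \<partial>lborel)"
      unfolding G_def s_def using t by (intro integral_smoothing_shift) auto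
    have hG: "h * (G (Suc j) x / t) = s * G (Suc j) x" by (simp add: s_def)
    have eq: "G j (x + h) - G j x - h * (G (Suc j) x / t) = (\<integral>y. f (x + t * y) * hermite_fun j (y - s) - f (x + t * y) * hermite_fun j y
             - s * (f (x + t * y) * hermite_fun (Suc j) y) \<partial>lborel)"
      unfolding hG shift unfolding G_def
      by (simp add: int integrable_lipschitz_hermite[OF f])
    have "\<bar>G j (x + h) - G j x - h * (G (Suc j) x / t)\<bar> \<le> (\<integral>y. s\<^sup>2 * env y \<partial>lborel)"
      unfolding eq
    proof (rule integral_abs_bound_integral)
      fix y
      have "\<bar>f (x + t * y) * hermite_fun j (y - s) - f (x + t * y) * hermite_fun j y
             - s * (f (x + t * y) * hermite_fun (Suc j) y)\<bar>
           = \<bar>f (x + t * y)\<bar> * \<bar>hermite_fun j (y - s) - hermite_fun j y - s * hermite_fun (Suc j) y\<bar>"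
        by (simp add: abs_mult[symmetric] algebra_simps)
      also have "\<dots> \<le> \<bar>f (x + t * y)\<bar> * (s\<^sup>2 * (C * exp (k * \<bar>y\<bar>) * std_normal_density y))"
        by (intro mult_left_mono taylor s) auto
      finally show "\<bar>f (x + t * y) * hermite_fun j (y - s) - f (x + t * y) * hermite_fun j y
             - s * (f (x + t * y) * hermite_fun (Suc j) y)\<bar> \<le> s\<^sup>2 * env y"
        by (simp add: env_def algebra_simps)
    qed (intro Bochner_Integration.integrable_diff integrable_mult_right int integrable_lipschitz_hermite[OF f] env)+
    also have "(\<integral>y. s\<^sup>2 * env y \<partial>lborel) = K / t\<^sup>2 * h\<^sup>2"
      by (simp add: K_def s_def power_divide)
    finally show "\<bar>G j (x + h) - G j x - h * (G (Suc j) x / t)\<bar> \<le> K / t\<^sup>2 * h\<^sup>2" .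
  qed (use t in auto)
  from DERIV_cdivide[OF this, of "t ^ j"] show ?thesis
    unfolding smoothing_def G_def by (simp add: field_simps)
qed

section \<open>Gaussian constants, smoothing errors and the semigroup property\<close>

lemma hermite_fun_0: "hermite_fun 0 = std_normal_density"
  by (auto simp: hermite_fun_def)

lemma hermite_fun_1: "hermite_fun (Suc 0) y = y * std_normal_density y"
  by (simp add: hermite_fun_def)

lemma hermite_fun_2: "hermite_fun 2 y = (y\<^sup>2 - 1) * std_normal_density y"
  by (simp add: hermite_fun_def numeral_2_eq_2)

lemma hermite_fun_3: "hermite_fun 3 y = (y ^ 3 - 3 * y) * std_normal_density y"
  by (simp add: hermite_fun_def numeral_3_eq_3 power2_eq_square power3_eq_cube algebra_simps)

lemma std_normal_moments:
  "integrable lborel (\<lambda>y. y ^ k * std_normal_density y)"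
  "(\<integral>y. std_normal_density y \<partial>lborel) = 1"
  "(\<integral>y. y * std_normal_density y \<partial>lborel) = 0"
  "(\<integral>y. y\<^sup>2 * std_normal_density y \<partial>lborel) = 1"
  "(\<integral>y. y ^ 3 * std_normal_density y \<partial>lborel) = 0"
  "(\<integral>y. y ^ 4 * std_normal_density y \<partial>lborel) = 3"
  "(\<integral>y. \<bar>y\<bar> * std_normal_density y \<partial>lborel) = sqrt (2 / pi)"
  "(\<integral>y. \<bar>y\<bar> ^ 3 * std_normal_density y \<partial>lborel) = 2 * sqrt (2 / pi)"
  using integrable_std_normal_moment[of k] integral_std_normal_moment_even[of 0]
    integral_std_normal_moment_odd[of 0] integral_std_normal_moment_even[of 1]
    integral_std_normal_moment_odd[of 1] integral_std_normal_moment_even[of 2]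
    integral_std_normal_moment_abs_odd[of 0] integral_std_normal_moment_abs_odd[of 1]
  by (simp_all add: mult.commute fact_numeral numeral_eq_Suc fact_Suc)

lemma integrable_std_normal_abs: "integrable lborel (\<lambda>y. \<bar>y\<bar> ^ k * std_normal_density y)"
  using integrable_std_normal_moment_abs[of k] by (simp add: mult.commute)

text \<open>
From \<open>1/2 = sin (pi/6) \<le> pi/6\<close>.
\<close>

lemma pi_ge_3: "3 \<le> pi"
  using sin_x_le_x[of "pi / 6"] by (simp add: sin_30 field_simps)

lemma hermite_norm_1: "hermite_norm (Suc 0) = sqrt (2 / pi)"
proof -
  have "\<bar>hermite_fun (Suc 0) y\<bar> = \<bar>y\<bar> * std_normal_density y" for y
    by (simp add: hermite_fun_1 abs_mult normal_density_nonneg)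
  then show ?thesis unfolding hermite_norm_def by (simp add: std_normal_moments)
qed

lemma hermite_norm_1_le: "hermite_norm (Suc 0) \<le> 817 / 1000"
proof -
  have "2 / pi \<le> 2 / 3" using pi_ge_3 by (intro divide_left_mono) auto
  also have "\<dots> \<le> (817 / 1000)\<^sup>2" by (simp add: power2_eq_square)
  finally show ?thesis unfolding hermite_norm_1 by (intro real_le_lsqrt) auto
qed

lemma std_normal_density_eq: "std_normal_density y = sqrt (2 / pi) / 2 * exp (- y\<^sup>2 / 2)"
proof -
  have eq: "1 / sqrt (2 * pi) = sqrt (2 / pi) / 2"
    by (simp add: real_sqrt_mult real_sqrt_divide field_simps)
  show ?thesis unfolding std_normal_density_def eq ..
qed

lemma exp_bounds: "exp (- (1 / 2 :: real)) \<le> 610 / 1000" "exp (- (3 / 2 :: real)) \<le> 227 / 1000"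
proof -
  \<comment> \<open>The quadratic lower bound for \<open>exp\<close> is sharp enough at \<open>1/4\<close>, but not at \<open>1/2\<close>.\<close>
  have "41 / 32 \<le> exp (1 / 4 :: real)"
    using exp_lower_Taylor_quadratic[of "1 / 4"] by (simp add: power2_eq_square)
  then have q: "exp (- (1 / 4 :: real)) \<le> 32 / 41"
    by (simp add: exp_minus field_simps)
  have "exp (- (1 / 2 :: real)) = exp (- (1 / 4)) ^ 2" "exp (- (3 / 2 :: real)) = exp (- (1 / 4)) ^ 6"
    by (simp_all add: exp_of_nat_mult[symmetric])
  moreover have "exp (- (1 / 4 :: real)) ^ k \<le> (32 / 41) ^ k" for k
    by (rule power_mono[OF q]) simp
  ultimately have "exp (- (1 / 2 :: real)) \<le> (32 / 41) ^ 2" "exp (- (3 / 2 :: real)) \<le> (32 / 41) ^ 6"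
    by simp_all
  then show "exp (- (1 / 2 :: real)) \<le> 610 / 1000" "exp (- (3 / 2 :: real)) \<le> 227 / 1000"
    by (simp_all add: power_divide)
qed

text \<open>
\<open>- H\<^sub>j \<phi>\<close> is an antiderivative of \<open>H\<^bsub>j+1\<^esub> \<phi>\<close>.
\<close>

lemma integral_hermite_fun_interval:
  assumes "a \<le> b"
  shows "(\<integral>y. indicator {a..b} y * hermite_fun (Suc j) y \<partial>lborel) = hermite_fun j a - hermite_fun j b"
    and "integrable lborel (\<lambda>y. indicator {a..b} y * hermite_fun (Suc j) y)"
proof -
  have d: "((\<lambda>y. - hermite_fun j y) has_real_derivative hermite_fun (Suc j) y) (at y)" for y
    using DERIV_minus[OF hermite_fun_deriv, of j y] by simp
  have c: "continuous_on {a..b} (hermite_fun (Suc j))"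
    using hermite_fun_deriv by (meson DERIV_isCont continuous_at_imp_continuous_on)
  have "integral\<^sup>L lborel (\<lambda>y. indicator {a..b} y *\<^sub>R hermite_fun (Suc j) y)
      = (- hermite_fun j b) - (- hermite_fun j a)"
    using d by (intro integral_FTC_atLeastAtMost assms c)
      (auto intro: has_field_derivative_at_within simp: has_real_derivative_iff_has_vector_derivative[symmetric])
  then show "(\<integral>y. indicator {a..b} y * hermite_fun (Suc j) y \<partial>lborel) = hermite_fun j a - hermite_fun j b"
    by simp
  show "integrable lborel (\<lambda>y. indicator {a..b} y * hermite_fun (Suc j) y)"
    using borel_integrable_atLeastAtMost'[OF c] by (simp add: set_integrable_def)
qed

text \<open>
The exact value is \<open>4 \<phi>(1)\<close>, about 0.968. To integrate over bounded intervals only, one writes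
\<open>\<bar>y\<^sup>2 - 1\<bar> = (y\<^sup>2 - 1) + 2 (1 - y\<^sup>2)\<^sup>+\<close>, where the first summand has mean zero.
\<close>

lemma hermite_norm_2_le: "hermite_norm 2 \<le> 1"
proof -
  let ?I = "\<lambda>y. indicator {- 1..1} y * hermite_fun (Suc (Suc 0)) y :: real"
  have eq: "\<bar>hermite_fun 2 y\<bar> = hermite_fun 2 y - 2 * ?I y" for y
  proof -
    have "y\<^sup>2 \<le> 1 \<longleftrightarrow> y \<in> {- 1..1}" by (auto simp: abs_square_le_1 abs_le_iff)
    moreover have "\<bar>hermite_fun 2 y\<bar> = \<bar>y\<^sup>2 - 1\<bar> * std_normal_density y"
      by (simp add: hermite_fun_2 abs_mult normal_density_nonneg)
    ultimately show ?thesis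
      by (auto simp: hermite_fun_2 numeral_2_eq_2[symmetric] indicator_def abs_if algebra_simps simp del: atLeastAtMost_iff)
  qed
  have int2: "integrable lborel (hermite_fun 2)"
    unfolding hermite_fun_2[abs_def] left_diff_distrib
    using std_normal_moments(1)[of 2] std_normal_moments(1)[of 0] by auto
  have "(\<integral>y. hermite_fun 2 y \<partial>lborel) = 0"
    unfolding hermite_fun_2 left_diff_distrib
    using std_normal_moments(1)[of 2] std_normal_moments(1)[of 0] by (simp add: std_normal_moments)
  then have "hermite_norm 2 = - 2 * (hermite_fun (Suc 0) (- 1) - hermite_fun (Suc 0) 1)"
    unfolding hermite_norm_def eq
    using int2 integral_hermite_fun_interval[of "-1" 1 "Suc 0"] by simp
  also have "\<dots> = 2 * sqrt (2 / pi) * exp (- (1 / 2))"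
    by (simp add: hermite_fun_1 std_normal_density_eq)
  also have "\<dots> \<le> 2 * (817 / 1000) * (610 / 1000)"
    using hermite_norm_1_le by (intro mult_mono exp_bounds) (auto simp: hermite_norm_1)
  finally show ?thesis by simp
qed

text \<open>
The exact value is \<open>2 \<phi>(0) + 8 \<phi>(sqrt 3)\<close>, about 1.51. As for \<open>H\<^sub>2\<close>, the modulus is written as
\<open>\<bar>y\<bar> (y\<^sup>2 - 3)\<close>, with known absolute moments, plus twice the part that lives on \<open>[- sqrt 3, sqrt 3]\<close>.
\<close>

lemma hermite_norm_3_le: "hermite_norm 3 \<le> 1559 / 1000"
proof -
  let ?I = "\<lambda>y. indicator {0..sqrt 3} y * hermite_fun (Suc 2) y :: real"
  let ?J = "\<lambda>y. indicator {- sqrt 3..0} y * hermite_fun (Suc 2) y :: real"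
  let ?P = "\<lambda>y. \<bar>y\<bar> ^ 3 * std_normal_density y - 3 * (\<bar>y\<bar> * std_normal_density y)"
  have le: "\<bar>hermite_fun 3 y\<bar> = ?P y - 2 * ?I y + 2 * ?J y" for y
  proof -
    have P: "?P y = \<bar>y\<bar> * (y\<^sup>2 - 3) * std_normal_density y"
      by (simp add: power2_eq_square power3_eq_cube algebra_simps)
    have abs: "\<bar>hermite_fun 3 y\<bar> = \<bar>y\<bar> * \<bar>y\<^sup>2 - 3\<bar> * std_normal_density y"
    proof -
      have "hermite_fun 3 y = y * (y\<^sup>2 - 3) * std_normal_density y"
        by (simp add: hermite_fun_3 power2_eq_square power3_eq_cube algebra_simps)
      then show ?thesis by (simp add: abs_mult normal_density_nonneg)
    qed
    have h: "hermite_fun (Suc 2) y = y * (y\<^sup>2 - 3) * std_normal_density y"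
      using hermite_fun_3[of y] by (simp add: power2_eq_square power3_eq_cube algebra_simps numeral_3_eq_3 numeral_2_eq_2)
    have sq: "y\<^sup>2 \<le> 3 \<longleftrightarrow> \<bar>y\<bar> \<le> sqrt 3"
      by (metis abs_ge_zero power2_abs real_sqrt_abs real_sqrt_le_iff)
    consider "y = 0" | "sqrt 3 < \<bar>y\<bar>" | "0 < y" "y \<le> sqrt 3" | "y < 0" "- sqrt 3 \<le> y" by linarith
    then show ?thesis
    proof cases
      case 1 then show ?thesis by (simp add: h hermite_fun_3)
    next
      case 2
      then have "y \<notin> {0..sqrt 3}" "y \<notin> {- sqrt 3..0}" by auto
      then show ?thesis unfolding P abs using 2 sq by simp
    next
      case 3
      then have "y \<in> {0..sqrt 3}" "y \<notin> {- sqrt 3..0}" "\<bar>y\<^sup>2 - 3\<bar> = 3 - y\<^sup>2" using sq by auto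
      then show ?thesis unfolding P abs h using 3 by (simp add: algebra_simps)
    next
      case 4
      then have "y \<notin> {0..sqrt 3}" "y \<in> {- sqrt 3..0}" "\<bar>y\<^sup>2 - 3\<bar> = 3 - y\<^sup>2" using sq by auto
      then show ?thesis unfolding P abs h using 4 by (simp add: algebra_simps)
    qed
  qed
  have "hermite_norm 3 = (2 * sqrt (2 / pi) - 3 * sqrt (2 / pi)) - 2 * (hermite_fun 2 0 - hermite_fun 2 (sqrt 3))
      + 2 * (hermite_fun 2 (- sqrt 3) - hermite_fun 2 0)"
    unfolding hermite_norm_def le
    using integrable_std_normal_abs[of 3] integrable_std_normal_abs[of 1]
      integral_hermite_fun_interval[of "0" "sqrt 3" 2] integral_hermite_fun_interval[of "- sqrt 3" "0" 2]
    by (simp add: std_normal_moments)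
  also have "\<dots> = sqrt (2 / pi) * (1 + 4 * exp (- (3 / 2)))"
    by (simp add: hermite_fun_2 std_normal_density_eq algebra_simps)
  also have "\<dots> \<le> (817 / 1000) * (1 + 4 * (227 / 1000))"
    using hermite_norm_1_le exp_bounds by (intro mult_mono) (auto simp: hermite_norm_1)
  finally show ?thesis by simp
qed

lemma integrable_lipschitz_std_normal:
  assumes "L-lipschitz_on UNIV g"
  shows "integrable lborel (\<lambda>y. g (x + s * y) * std_normal_density y)"
  using integrable_lipschitz_hermite[OF assms, of x s 0] by (simp add: hermite_fun_0)

lemma smoothing_0: "smoothing 0 s g x = (\<integral>y. g (x + s * y) * std_normal_density y \<partial>lborel)"
  by (simp add: smoothing_def hermite_fun_0)

text \<open>
Smoothing a cubic polynomial in the increment is exact: under \<open>N(0, 1)\<close> the odd moments vanish and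
the second moment is 1, so only \<open>a0 + a2\<close> survives. The three error lemmas below are Taylor expansions
of orders 0, 1 and 3 fed into this one.
\<close>

lemma smoothing_cubic_error:
  fixes g :: "real \<Rightarrow> real"
  assumes g: "K-lipschitz_on UNIV g"
    and B: "\<And>y. \<bar>g (x + s * y) - (a0 + a1 * y + a2 * y\<^sup>2 + a3 * y ^ 3)\<bar> \<le> B y"
    and "integrable lborel (\<lambda>y. B y * std_normal_density y)"
  shows "\<bar>smoothing 0 s g x - (a0 + a2)\<bar> \<le> (\<integral>y. B y * std_normal_density y \<partial>lborel)"
proof -
  let ?p = "\<lambda>y::real. a0 * (y ^ 0 * std_normal_density y) + a1 * (y ^ 1 * std_normal_density y)
     + a2 * (y\<^sup>2 * std_normal_density y) + a3 * (y ^ 3 * std_normal_density y)"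
  have p: "integrable lborel ?p" "integral\<^sup>L lborel ?p = a0 + a2"
    using std_normal_moments(1) std_normal_moments(1)[of 0] std_normal_moments(1)[of 1]
    by (simp_all add: std_normal_moments)
  have eq: "smoothing 0 s g x - (a0 + a2)
     = (\<integral>y. g (x + s * y) * std_normal_density y - ?p y \<partial>lborel)"
    using p integrable_lipschitz_std_normal[OF g] by (simp add: smoothing_0)
  show ?thesis unfolding eq
  proof (rule integral_abs_bound_integral)
    fix y
    have "\<bar>g (x + s * y) * std_normal_density y - ?p y\<bar>
       = \<bar>g (x + s * y) - (a0 + a1 * y + a2 * y\<^sup>2 + a3 * y ^ 3)\<bar> * std_normal_density y"
      by (subst (2) abs_of_nonneg[OF normal_density_nonneg, symmetric], subst abs_mult[symmetric])
         (simp add: algebra_simps)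
    also have "\<dots> \<le> B y * std_normal_density y"
      by (intro mult_right_mono B normal_density_nonneg)
    finally show "\<bar>g (x + s * y) * std_normal_density y - ?p y\<bar> \<le> B y * std_normal_density y" .
  qed (intro assms p Bochner_Integration.integrable_diff integrable_lipschitz_std_normal[OF g])+
qed

lemma smoothing_error_0:
  assumes f: "1-lipschitz_on UNIV f" and s: "0 \<le> s"
  shows "\<bar>smoothing 0 s f x - f x\<bar> \<le> s * hermite_norm (Suc 0)"
proof -
  have "\<bar>smoothing 0 s f x - (f x + 0)\<bar> \<le> (\<integral>y. (s * \<bar>y\<bar>) * std_normal_density y \<partial>lborel)"
  proof (rule smoothing_cubic_error[OF f, where ?a1.0 = 0 and ?a3.0 = 0])
    show "\<bar>f (x + s * y) - (f x + 0 * y + 0 * y\<^sup>2 + 0 * y ^ 3)\<bar> \<le> s * \<bar>y\<bar>" for y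
      using lipschitz_real_bound[OF f, of "x + s * y" x] s by (simp add: abs_mult)
    show "integrable lborel (\<lambda>y. s * \<bar>y\<bar> * std_normal_density y)"
      using integrable_std_normal_abs[of 1] by (simp add: mult.assoc)
  qed
  then show ?thesis using integrable_std_normal_abs[of 1]
    by (simp add: mult.assoc std_normal_moments hermite_norm_1)
qed

lemma smoothing_error_1:
  assumes g: "K-lipschitz_on UNIV g"
    and g1: "\<And>x. (g has_real_derivative g1 x) (at x)" and L: "L-lipschitz_on UNIV g1"
  shows "\<bar>smoothing 0 s g x - g x\<bar> \<le> L * s\<^sup>2 / 2"
proof -
  have "\<bar>smoothing 0 s g x - (g x + 0)\<bar> \<le> (\<integral>y. (L * s\<^sup>2 / 2 * y\<^sup>2) * std_normal_density y \<partial>lborel)"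
  proof (rule smoothing_cubic_error[OF g, where ?a1.0 = "s * g1 x" and ?a3.0 = 0])
    show "\<bar>g (x + s * y) - (g x + s * g1 x * y + 0 * y\<^sup>2 + 0 * y ^ 3)\<bar> \<le> L * s\<^sup>2 / 2 * y\<^sup>2" for y
      using taylor_lipschitz_1[OF g1 L, of x "s * y"] by (simp add: power_mult_distrib algebra_simps)
    show "integrable lborel (\<lambda>y. L * s\<^sup>2 / 2 * y\<^sup>2 * std_normal_density y)"
      using std_normal_moments(1)[of 2] by (simp add: mult.assoc)
  qed
  then show ?thesis
    using std_normal_moments(1)[of 2] by (simp add: mult.assoc std_normal_moments)
qed

lemma smoothing_error_3:
  assumes g: "K-lipschitz_on UNIV g"
    and g1: "\<And>x. (g has_real_derivative g1 x) (at x)" and g2: "\<And>x. (g1 has_real_derivative g2 x) (at x)"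
    and g3: "\<And>x. (g2 has_real_derivative g3 x) (at x)" and L: "L-lipschitz_on UNIV g3"
  shows "\<bar>smoothing 0 s g x - g x - s\<^sup>2 / 2 * g2 x\<bar> \<le> L * s ^ 4 / 8"
proof -
  have "\<bar>smoothing 0 s g x - (g x + s\<^sup>2 / 2 * g2 x)\<bar> \<le> (\<integral>y. (L * s ^ 4 / 24 * y ^ 4) * std_normal_density y \<partial>lborel)"
  proof (rule smoothing_cubic_error[OF g, where ?a1.0 = "s * g1 x" and ?a3.0 = "s ^ 3 / 6 * g3 x"])
    show "\<bar>g (x + s * y) - (g x + s * g1 x * y + s\<^sup>2 / 2 * g2 x * y\<^sup>2 + s ^ 3 / 6 * g3 x * y ^ 3)\<bar> \<le> L * s ^ 4 / 24 * y ^ 4" for y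
      using taylor_lipschitz_3[OF g1 g2 g3 L, of x "s * y"] by (simp add: power_mult_distrib algebra_simps)
    show "integrable lborel (\<lambda>y. L * s ^ 4 / 24 * y ^ 4 * std_normal_density y)"
      using std_normal_moments(1)[of 4] by (simp add: mult.assoc)
  qed
  then show ?thesis
    using std_normal_moments(1)[of 4] by (simp add: mult.assoc std_normal_moments diff_diff_add)
qed

lemma smoothing_0_lipschitz:
  assumes g: "L-lipschitz_on UNIV g"
  shows "L-lipschitz_on UNIV (smoothing 0 s g)"
proof (rule lipschitz_realI)
  fix x z
  have eq: "smoothing 0 s g x - smoothing 0 s g z
      = (\<integral>y. g (x + s * y) * std_normal_density y - g (z + s * y) * std_normal_density y \<partial>lborel)"
    using integrable_lipschitz_std_normal[OF g] by (simp add: smoothing_0)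
  have "\<bar>smoothing 0 s g x - smoothing 0 s g z\<bar> \<le> (\<integral>y. L * \<bar>x - z\<bar> * std_normal_density y \<partial>lborel)"
    unfolding eq
  proof (rule integral_abs_bound_integral)
    fix y
    have "\<bar>g (x + s * y) * std_normal_density y - g (z + s * y) * std_normal_density y\<bar>
        = \<bar>g (x + s * y) - g (z + s * y)\<bar> * std_normal_density y"
      by (simp add: left_diff_distrib[symmetric] abs_mult normal_density_nonneg)
    also have "\<dots> \<le> L * \<bar>x - z\<bar> * std_normal_density y"
      using lipschitz_real_bound[OF g, of "x + s * y" "z + s * y"]
      by (intro mult_right_mono normal_density_nonneg) simp
    finally show "\<bar>g (x + s * y) * std_normal_density y - g (z + s * y) * std_normal_density y\<bar>
      \<le> L * \<bar>x - z\<bar> * std_normal_density y" .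
  qed (intro Bochner_Integration.integrable_diff integrable_lipschitz_std_normal[OF g] integrable_mult_right; simp)+
  then show "\<bar>smoothing 0 s g x - smoothing 0 s g z\<bar> \<le> L * \<bar>x - z\<bar>" by simp
qed (rule lipschitz_on_nonneg[OF g])

lemma smoothing_0_deriv:
  assumes g: "K-lipschitz_on UNIV g"
    and g1: "\<And>x. (g has_real_derivative g1 x) (at x)" and L: "L-lipschitz_on UNIV g1"
  shows "(smoothing 0 s g has_real_derivative smoothing 0 s g1 x) (at x)"
proof (rule has_derivative_of_quadratic_error[where d = 1 and K = "L / 2"])
  fix h
  let ?p = "\<lambda>y. g (x + h + s * y) * std_normal_density y - g (x + s * y) * std_normal_density y
       - h * (g1 (x + s * y) * std_normal_density y)"
  have eq: "smoothing 0 s g (x + h) - smoothing 0 s g x - h * smoothing 0 s g1 x = (\<integral>y. ?p y \<partial>lborel)"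
    using integrable_lipschitz_std_normal[OF g] integrable_lipschitz_std_normal[OF L]
    by (simp add: smoothing_0)
  have "\<bar>smoothing 0 s g (x + h) - smoothing 0 s g x - h * smoothing 0 s g1 x\<bar>
     \<le> (\<integral>y. L / 2 * h\<^sup>2 * std_normal_density y \<partial>lborel)" unfolding eq
  proof (rule integral_abs_bound_integral)
    fix y
    have "?p y = (g ((x + s * y) + h) - g (x + s * y) - h * g1 (x + s * y)) * std_normal_density y"
      by (simp add: algebra_simps)
    also have "\<bar>\<dots>\<bar> \<le> L / 2 * h\<^sup>2 * std_normal_density y"
      unfolding abs_mult abs_of_nonneg[OF normal_density_nonneg]
      using taylor_lipschitz_1[OF g1 L, of "x + s * y" h]
      by (intro mult_right_mono normal_density_nonneg) simp
    finally show "\<bar>?p y\<bar> \<le> L / 2 * h\<^sup>2 * std_normal_density y" .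
  qed (intro Bochner_Integration.integrable_diff integrable_lipschitz_std_normal[OF g]
        integrable_lipschitz_std_normal[OF L] integrable_mult_right; simp)+
  then show "\<bar>smoothing 0 s g (x + h) - smoothing 0 s g x - h * smoothing 0 s g1 x\<bar> \<le> L / 2 * h\<^sup>2" by simp
qed simp

text \<open>
The sum of independent \<open>N(0, s\<^sup>2)\<close> and \<open>N(0, t\<^sup>2)\<close> variables is \<open>N(0, s\<^sup>2 + t\<^sup>2)\<close>, realised on
the product of two copies of the standard normal law.
\<close>

lemma smoothing_0_semigroup:
  assumes f: "1-lipschitz_on UNIV f" and s: "0 < s" and t: "0 < t"
  shows "smoothing 0 s (smoothing 0 t f) x = smoothing 0 (sqrt (s\<^sup>2 + t\<^sup>2)) f x"
proof -
  note [measurable] = lipschitz_borel_measurable[OF f]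
  define D where "D = density lborel std_normal_density"
  interpret D: prob_space D unfolding D_def by (rule prob_space_normal_density) simp
  interpret P: pair_prob_space D D ..
  have [simp, measurable_cong]: "sets D = sets borel" by (simp add: D_def)
  have [simp]: "space D = UNIV" by (simp add: D_def)
  have intD: "integrable D h \<longleftrightarrow> integrable lborel (\<lambda>y. h y * std_normal_density y)"
    "integral\<^sup>L D h = (\<integral>y. h y * std_normal_density y \<partial>lborel)" if [measurable]: "h \<in> borel_measurable borel" for h :: "real \<Rightarrow> real"
    unfolding D_def using that by (simp_all add: integrable_density integral_density mult.commute normal_density_nonneg)
  have "distr (D \<Otimes>\<^sub>M D) borel fst = distr (D \<Otimes>\<^sub>M D) D fst" by (rule distr_cong) auto
  then have f1: "distr (D \<Otimes>\<^sub>M D) borel fst = D" by (simp add: D.distr_pair_fst)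
  have f2: "distr (D \<Otimes>\<^sub>M D) borel snd = D"
  proof (rule measure_eqI)
    fix A assume "A \<in> sets (distr (D \<Otimes>\<^sub>M D) borel snd)"
    then have A [measurable]: "A \<in> sets borel" by simp
    have "snd -` A \<inter> space (D \<Otimes>\<^sub>M D) = UNIV \<times> A" by (auto simp: space_pair_measure)
    then show "emeasure (distr (D \<Otimes>\<^sub>M D) borel snd) A = emeasure D A"
      using D.emeasure_pair_measure_Times[of UNIV D A] D.emeasure_space_1
      by (simp add: emeasure_distr)
  qed simp
  have lb: "distr (D \<Otimes>\<^sub>M D) lborel h = distr (D \<Otimes>\<^sub>M D) borel h" for h by (rule distr_cong) auto
  have dist1: "distributed (D \<Otimes>\<^sub>M D) lborel fst std_normal_density"
    unfolding distributed_def using f1 lb[of fst] by (simp add: D_def)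
  have dist2: "distributed (D \<Otimes>\<^sub>M D) lborel snd std_normal_density"
    unfolding distributed_def using f2 lb[of snd] by (simp add: D_def)
  have d1: "distributed (D \<Otimes>\<^sub>M D) lborel (\<lambda>z. 0 + s * fst z) (normal_density (0 + s * 0) (\<bar>s\<bar> * 1))"
    using s by (intro P.normal_density_affine dist1) auto
  have d2: "distributed (D \<Otimes>\<^sub>M D) lborel (\<lambda>z. 0 + t * snd z) (normal_density (0 + t * 0) (\<bar>t\<bar> * 1))"
    using t by (intro P.normal_density_affine dist2) auto
  have ind: "P.indep_var borel fst borel snd"
    unfolding P.indep_var_distribution_eq f1 f2 by (auto simp: distr_id2)
  have "P.indep_var borel ((\<lambda>y. 0 + s * y) \<circ> fst) borel ((\<lambda>y. 0 + t * y) \<circ> snd)"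
    by (rule P.indep_var_compose[OF ind]) auto
  then have ind2: "P.indep_var borel (\<lambda>z. 0 + s * fst z) borel (\<lambda>z. 0 + t * snd z)"
    by (simp add: comp_def)
  have sum: "distributed (D \<Otimes>\<^sub>M D) lborel (\<lambda>z. s * fst z + t * snd z) (normal_density 0 (sqrt (s\<^sup>2 + t\<^sup>2)))"
    using P.add_indep_normal[OF ind2 _ _ d1 d2] s t by simp
  define r where "r = sqrt (s\<^sup>2 + t\<^sup>2)"
  have r: "0 < r" using s t by (simp add: r_def sum_power2_gt_zero_iff)
  have n: "distributed (D \<Otimes>\<^sub>M D) lborel (\<lambda>z. (s * fst z + t * snd z - 0) / r) std_normal_density"
    using sum r P.normal_standard_normal_convert[OF r] unfolding r_def by simp
  have "(\<integral>y. std_normal_density y * f (x + r * y) \<partial>lborel)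
     = (\<integral>z. f (x + r * ((s * fst z + t * snd z - 0) / r)) \<partial>(D \<Otimes>\<^sub>M D))"
    by (rule distributed_integral[OF n]) (auto simp: normal_density_nonneg)
  then have "smoothing 0 r f x = (\<integral>z. f (x + s * fst z + t * snd z) \<partial>(D \<Otimes>\<^sub>M D))"
    using r by (simp add: smoothing_0 mult.commute[of _ "std_normal_density _"] add.assoc)
  also have "\<dots> = (\<integral>y. (\<integral>z. f (x + s * y + t * z) \<partial>D) \<partial>D)"
  proof -
    have "integrable (D \<Otimes>\<^sub>M D) (\<lambda>z. f (x + r * ((s * fst z + t * snd z - 0) / r)))"
      using integrable_lipschitz_std_normal[OF f, of x r]
      by (subst distributed_integrable[OF n, symmetric]) (auto simp: normal_density_nonneg mult.commute)
    then have "integrable (D \<Otimes>\<^sub>M D) (\<lambda>(y, z). f (x + s * y + t * z))"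
      using r by (simp add: case_prod_beta' add.assoc)
    from P.integral_fst'[OF this] show ?thesis by (simp add: case_prod_beta')
  qed
  also have "\<dots> = (\<integral>y. smoothing 0 t f (x + s * y) \<partial>D)"
    by (intro Bochner_Integration.integral_cong refl) (simp add: intD smoothing_0)
  also have "\<dots> = smoothing 0 s (smoothing 0 t f) x"
    using lipschitz_borel_measurable[OF smoothing_0_lipschitz[OF f, of t]]
    by (subst intD) (auto simp: smoothing_0[of s])
  finally show ?thesis by (simp add: r_def)
qed

text \<open>
Smoothing commutes with differentiation, so the case \<open>j = 0\<close> can be differentiated \<open>j\<close> times.
\<close>

lemma smoothing_semigroup:
  assumes f: "1-lipschitz_on UNIV f" and s: "0 < s" and t: "0 < t"
  shows "smoothing 0 s (smoothing j t f) x = smoothing j (sqrt (s\<^sup>2 + t\<^sup>2)) f x"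
proof (induction j arbitrary: x)
  case 0
  show ?case by (rule smoothing_0_semigroup[OF assms])
next
  case (Suc j)
  have r: "0 < sqrt (s\<^sup>2 + t\<^sup>2)" using s t by (simp add: sum_power2_gt_zero_iff)
  have eq: "smoothing 0 s (smoothing j t f) = smoothing j (sqrt (s\<^sup>2 + t\<^sup>2)) f"
    using Suc.IH by auto
  have "(smoothing 0 s (smoothing j t f) has_real_derivative smoothing 0 s (smoothing (Suc j) t f) x) (at x)"
    by (rule smoothing_0_deriv[OF smoothing_lipschitz[OF f t] smoothing_deriv[OF f t] smoothing_lipschitz[OF f t]])
  from this[unfolded eq] smoothing_deriv[OF f r, of j x] show ?case by (rule DERIV_unique)
qed

section \<open>Elementary sums and summation over blocks of increasing length\<close>

text \<open>
This is \<open>2 u \<le> ln ((1 + u) / (1 - u))\<close> at \<open>u = 1/(2m)\<close>, or the midpoint rule for the convex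
function \<open>1/x\<close> on \<open>[m - 1/2, m + 1/2]\<close>; the right-hand sides telescope to \<open>ln (1 + 2n)\<close>.
\<close>

lemma inverse_le_ln_ratio:
  assumes "1 \<le> (m::nat)"
  shows "1 / real m \<le> ln (1 + 2 * real m) - ln (2 * real m - 1)"
proof -
  define F where "F u = ln (1 + u) - ln (1 - u) - 2 * u" for u :: real
  define u where "u = 1 / (2 * real m)"
  have u: "0 \<le> u" "u < 1" using assms by (auto simp: u_def field_simps)
  have "F 0 \<le> F u"
  proof (rule DERIV_nonneg_imp_nondecreasing[OF u(1)])
    fix v assume v: "0 \<le> v" "v \<le> u"
    then have v1: "v < 1" using u by simp
    have "(F has_real_derivative (1 / (1 + v) + 1 / (1 - v) - 2)) (at v)"
      unfolding F_def using v v1 by (auto intro!: derivative_eq_intros)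
    moreover have "1 / (1 + v) + 1 / (1 - v) - 2 = 2 * v\<^sup>2 / ((1 + v) * (1 - v))"
    proof -
      have "1 + v \<noteq> 0" "1 - v \<noteq> 0" using v v1 by auto
      then show ?thesis by (simp add: divide_simps power2_eq_square) (simp add: algebra_simps)
    qed
    moreover have "0 \<le> 2 * v\<^sup>2 / ((1 + v) * (1 - v))" using v v1 by auto
    ultimately show "\<exists>y. (F has_real_derivative y) (at v) \<and> 0 \<le> y" by metis
  qed
  then have "2 * u \<le> ln ((1 + u) / (1 - u))"
    using u by (simp add: F_def ln_div)
  also have "(1 + u) / (1 - u) = (1 + 2 * real m) / (2 * real m - 1)"
    using assms by (simp add: u_def field_simps)
  also have "ln \<dots> = ln (1 + 2 * real m) - ln (2 * real m - 1)"
    using assms by (simp add: ln_div)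
  finally show ?thesis by (simp add: u_def)
qed

lemma harmonic_le_ln: "(\<Sum>m=1..n. 1 / real m) \<le> ln (1 + 2 * real n)"
proof (induction n)
  case (Suc n)
  then show ?case using inverse_le_ln_ratio[of "Suc n"] by simp
qed simp

text \<open>
The midpoint rule for the convex function \<open>x powr (-3/2)\<close> on \<open>[m - 1/2, m + 1/2]\<close>.
\<close>

lemma inverse_sqrt_cube_le:
  assumes "1 \<le> (m::nat)"
  shows "1 / (real m * sqrt (real m)) \<le> 2 / sqrt (real m - 1 / 2) - 2 / sqrt (real m + 1 / 2)"
proof -
  define a b where "a = sqrt (real m - 1 / 2)" and "b = sqrt (real m + 1 / 2)"
  have m: "1 \<le> real m" using assms by simp
  have pos: "0 < a" "0 < b" using m by (auto simp: a_def b_def)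
  have sq: "a\<^sup>2 = real m - 1 / 2" "b\<^sup>2 = real m + 1 / 2" using m by (auto simp: a_def b_def)
  have ab: "a * b \<le> real m"
    using sq zero_le_power2[of "a - b"] by (simp add: power2_diff)
  have "(a + b)\<^sup>2 \<le> (2 * sqrt (real m))\<^sup>2"
    using sq ab by (simp add: power2_sum power_mult_distrib)
  then have apb: "a + b \<le> 2 * sqrt (real m)"
    by (rule power2_le_imp_le) simp
  have "2 / a - 2 / b = 2 * (b\<^sup>2 - a\<^sup>2) / (a * b * (a + b))"
    using pos by (simp add: divide_simps power2_eq_square) (simp add: algebra_simps)
  also have "\<dots> = 2 / ((a * b) * (a + b))" by (simp add: sq)
  also have "\<dots> \<ge> 2 / (real m * (2 * sqrt (real m)))"
    using pos ab apb m by (intro divide_left_mono mult_mono mult_pos_pos) auto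
  finally show ?thesis by (simp add: a_def b_def)
qed

text \<open>
The first term is kept and the rest telescopes to at most \<open>2 / sqrt (3/2)\<close>; telescoping from
\<open>m = 1\<close> would give \<open>2 sqrt 2\<close>, too much for the constant \<open>13/6\<close> with the bounds on \<open>c\<^sub>1\<close> and \<open>c\<^sub>3\<close> above.
\<close>

lemma sum_inverse_sqrt_cube_le: "(\<Sum>m=1..n. 1 / (real m * sqrt (real m))) \<le> 2634 / 1000"
proof (cases "n = 0")
  case False
  then have "1 \<le> n" by simp
  then have "(\<Sum>m=1..n. 1 / (real m * sqrt (real m))) \<le> 1 + (2 / sqrt (3 / 2) - 2 / sqrt (real n + 1 / 2))"
  proof (induction n rule: dec_induct)
    case (step n)
    then show ?case using inverse_sqrt_cube_le[of "Suc n"] by (simp add: add.commute)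
  qed simp
  also have "\<dots> \<le> 1 + 2 / sqrt (3 / 2)" by simp
  also have "\<dots> \<le> 1 + 2 / (1224 / 1000)"
    by (intro add_left_mono divide_left_mono real_le_rsqrt) (auto simp: power2_eq_square)
  finally show ?thesis by simp
qed simp

fun triangular :: "nat \<Rightarrow> nat" where
  "triangular 0 = 0"
| "triangular (Suc p) = triangular p + Suc p"

lemma real_triangular: "real (triangular p) = real p * (real p + 1) / 2"
  by (induction p) (auto simp: field_simps)

lemma triangular_decomposition: "\<exists>P q. n = triangular P + q \<and> q \<le> P"
proof (induction n)
  case (Suc n)
  then obtain P q where pq: "n = triangular P + q" "q \<le> P" by blast
  show ?case
  proof (cases "q < P")
    case True
    then show ?thesis using pq by (intro exI[of _ P] exI[of _ "Suc q"]) auto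
  next
    case False
    then show ?thesis using pq by (intro exI[of _ "Suc P"] exI[of _ 0]) auto
  qed
qed (auto intro: exI[of _ 0])

text \<open>
Here \<open>V N\<close> is a partial sum and \<open>block\<close> the estimate for a single block of length \<open>q\<close> that starts
after position \<open>N\<close>. The \<open>p\<close>-th block occupies the positions after \<open>triangular (p - 1)\<close>, and the
last one may be cut off. A fixed \<open>j\<close> contributes to all blocks of length greater than \<open>j\<close>, with weight
at most \<open>1 / triangular (p - 1) = 2 (1/(p - 1) - 1/p)\<close>, so these weights telescope to at most \<open>2 / j\<close>.
In addition \<open>B j\<close> occurs as the boundary term of at most two blocks, a complete and a cut one.
\<close>

lemma triangular_blocks_bound:
  fixes V A B :: "nat \<Rightarrow> real"
  assumes block: "\<And>N q. 1 \<le> q \<Longrightarrow> q \<le> nat \<lfloor>sqrt (2 * real n)\<rfloor> \<Longrightarrow> N + q \<le> n \<Longrightarrow>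
      \<bar>V (N + q) - V N\<bar> \<le> e1 / sqrt (real (N + q)) * B q
        + (\<Sum>j=1..<q. e2 / real (N + j) * A j + e3 / (real (N + j) * sqrt (real (N + j))) * B j)"
    and V0: "V 0 = 0" and A: "\<And>j. 0 \<le> A j" and B: "\<And>j. 0 \<le> B j"
    and e: "0 \<le> e1" "0 \<le> e2" "0 \<le> e3"
  shows "\<bar>V n\<bar> \<le> (\<Sum>m=1..nat \<lfloor>sqrt (2 * real n)\<rfloor>. (2 * e2 * A m + (2 * sqrt 2 * e1 + 2 * e3) * B m) / real m)"
proof -
  define d where "d P = 1 / real P - 1 / real (Suc P)" for P
  have block': "\<bar>V (triangular P + q) - V (triangular P)\<bar>
      \<le> sqrt 2 * e1 / real q * B q + (\<Sum>j=1..<q. 2 * d P * (e2 * A j + e3 * B j))"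
    if q: "1 \<le> q" "q \<le> Suc P" and n: "triangular P + q \<le> n" for P q
  proof -
    \<comment> \<open>The inequality \<open>q\<^sup>2 \<le> 2 (triangular P + q)\<close> covers the complete block, \<open>q = P + 1\<close>, and the cut ones, \<open>q \<le> P\<close>.\<close>
    have "q * q \<le> q * Suc P" using q by (intro mult_le_mono2) auto
    also have "\<dots> \<le> Suc P * P + 2 * q" 
    proof (cases "q = Suc P")
      case False
      then have "q * Suc P \<le> P * Suc P" using q by (intro mult_right_mono) auto
      then show ?thesis by (simp add: mult.commute)
    qed simp
    finally have qq: "real (q * q) \<le> real (Suc P * P + 2 * q)" using of_nat_mono by blast
    have "real (q * q) \<le> 2 * real (triangular P + q)"
      using qq by (simp add: real_triangular field_simps)
    also have "\<dots> \<le> 2 * real n" using of_nat_mono[OF n, where 'a = real] by simp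
    finally have "real q \<le> sqrt (2 * real n)" by (intro real_le_rsqrt) (simp add: power2_eq_square)
    then have qn: "q \<le> nat \<lfloor>sqrt (2 * real n)\<rfloor>" by (rule le_nat_floor)
    have "\<bar>V (triangular P + q) - V (triangular P)\<bar> \<le> e1 / sqrt (real (triangular P + q)) * B q
        + (\<Sum>j=1..<q. e2 / real (triangular P + j) * A j
            + e3 / (real (triangular P + j) * sqrt (real (triangular P + j))) * B j)"
      by (rule block[OF q(1) qn n])
    also have "\<dots> \<le> sqrt 2 * e1 / real q * B q + (\<Sum>j=1..<q. 2 * d P * (e2 * A j + e3 * B j))"
    proof (intro add_mono sum_mono mult_right_mono B)
      have "(real q / sqrt 2)\<^sup>2 \<le> real (triangular P + q)"
        using qq by (simp add: real_triangular power_divide power2_eq_square field_simps)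
      then have "real q / sqrt 2 \<le> sqrt (real (triangular P + q))" by (rule real_le_rsqrt)
      moreover have "0 < real q / sqrt 2" using q by simp
      ultimately have "e1 / sqrt (real (triangular P + q)) \<le> e1 / (real q / sqrt 2)"
        using e by (intro frac_le) auto
      then show "e1 / sqrt (real (triangular P + q)) \<le> sqrt 2 * e1 / real q" by (simp add: mult.commute)
    next
      fix j assume j: "j \<in> {1..<q}"
      then have P: "1 \<le> P" using q by auto
      define N where "N = real (triangular P + j)"
      have N1: "1 \<le> N" using j by (simp add: N_def)
      have "real P * (real P + 1) / 2 \<le> N" by (simp add: N_def real_triangular)
      then have "1 / N \<le> 1 / (real P * (real P + 1) / 2)" using P by (intro frac_le) auto
      also have "\<dots> = 2 * d P" using P by (simp add: d_def field_simps)
      finally have N2: "1 / N \<le> 2 * d P" .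
      have "1 / (N * sqrt N) \<le> 1 / (N * 1)" using N1 by (intro divide_left_mono mult_left_mono) auto
      then have N3: "1 / (N * sqrt N) \<le> 2 * d P" using N2 by simp
      have "e2 * (1 / N) * A j + e3 * (1 / (N * sqrt N)) * B j \<le> e2 * (2 * d P) * A j + e3 * (2 * d P) * B j"
        using N2 N3 e A B by (intro add_mono mult_right_mono mult_left_mono) auto
      then show "e2 / real (triangular P + j) * A j
            + e3 / (real (triangular P + j) * sqrt (real (triangular P + j))) * B j
            \<le> 2 * d P * (e2 * A j + e3 * B j)"
        by (simp add: N_def algebra_simps)
    qed
    finally show ?thesis .
  qed
  \<comment> \<open>The weights \<open>1/j - 1/P\<close> record what the blocks up to length \<open>P\<close> have used of the total \<open>1/j\<close>.\<close>
  have full: "triangular P \<le> n \<Longrightarrow> \<bar>V (triangular P)\<bar>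
     \<le> (\<Sum>j=1..P. 2 * (1 / real j - 1 / real P) * (e2 * A j + e3 * B j) + sqrt 2 * e1 / real j * B j)" for P
  proof (induction P)
    case 0
    then show ?case by (simp add: V0)
  next
    case (Suc P)
    have "\<bar>V (triangular (Suc P))\<bar> \<le> \<bar>V (triangular P)\<bar> + \<bar>V (triangular P + Suc P) - V (triangular P)\<bar>"
      by simp
    also have "\<dots> \<le> (\<Sum>j=1..P. 2 * (1 / real j - 1 / real P) * (e2 * A j + e3 * B j) + sqrt 2 * e1 / real j * B j)
       + (sqrt 2 * e1 / real (Suc P) * B (Suc P) + (\<Sum>j=1..<Suc P. 2 * d P * (e2 * A j + e3 * B j)))"
      using Suc by (intro add_mono block') auto
    also have "{1..<Suc P} = {1..P}" by auto
    also have "(\<Sum>j=1..P. 2 * (1 / real j - 1 / real P) * (e2 * A j + e3 * B j) + sqrt 2 * e1 / real j * B j)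
       + (sqrt 2 * e1 / real (Suc P) * B (Suc P) + (\<Sum>j=1..P. 2 * d P * (e2 * A j + e3 * B j)))
       = (\<Sum>j=1..P. (2 * (1 / real j - 1 / real P) * (e2 * A j + e3 * B j) + sqrt 2 * e1 / real j * B j)
           + 2 * d P * (e2 * A j + e3 * B j)) + sqrt 2 * e1 / real (Suc P) * B (Suc P)"
      by (simp add: sum.distrib)
    also have "\<dots> = (\<Sum>j=1..Suc P. 2 * (1 / real j - 1 / real (Suc P)) * (e2 * A j + e3 * B j) + sqrt 2 * e1 / real j * B j)"
    proof -
      have "(2 * (1 / real j - 1 / real P) * (e2 * A j + e3 * B j) + sqrt 2 * e1 / real j * B j)
           + 2 * d P * (e2 * A j + e3 * B j)
         = 2 * (1 / real j - 1 / real (Suc P)) * (e2 * A j + e3 * B j) + sqrt 2 * e1 / real j * B j" for j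
        unfolding d_def by (simp only: algebra_simps)
      moreover have "{1..Suc P} = insert (Suc P) {1..P}" by auto
      ultimately show ?thesis by (simp only: sum.insert finite_atLeastAtMost) simp
    qed
    finally show ?case .
  qed
  obtain P q where Pq: "n = triangular P + q" "q \<le> P" using triangular_decomposition by blast
  have "\<bar>V (triangular P + q) - V (triangular P)\<bar>
     \<le> (\<Sum>j=1..P. sqrt 2 * e1 / real j * B j + 2 / real P * (e2 * A j + e3 * B j))"
  proof (cases "q = 0")
    case True
    then show ?thesis using A B e by (auto intro!: sum_nonneg add_nonneg_nonneg mult_nonneg_nonneg)
  next
    case False
    then have "\<bar>V (triangular P + q) - V (triangular P)\<bar>
      \<le> sqrt 2 * e1 / real q * B q + (\<Sum>j=1..<q. 2 * d P * (e2 * A j + e3 * B j))"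
      using Pq by (intro block') auto
    also have "\<dots> \<le> (\<Sum>j=1..P. sqrt 2 * e1 / real j * B j) + (\<Sum>j=1..P. 2 / real P * (e2 * A j + e3 * B j))"
    proof (intro add_mono)
      show "sqrt 2 * e1 / real q * B q \<le> (\<Sum>j=1..P. sqrt 2 * e1 / real j * B j)"
        using False Pq B e by (intro member_le_sum[of q "{1..P}" "\<lambda>j. sqrt 2 * e1 / real j * B j"]) auto
      have "(\<Sum>j=1..<q. 2 * d P * (e2 * A j + e3 * B j)) \<le> (\<Sum>j=1..<q. 2 / real P * (e2 * A j + e3 * B j))"
        using A B e by (intro sum_mono mult_right_mono add_nonneg_nonneg mult_nonneg_nonneg) (auto simp: d_def)
      also have "\<dots> \<le> (\<Sum>j=1..P. 2 / real P * (e2 * A j + e3 * B j))"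
        using Pq A B e by (intro sum_mono2) auto
      finally show "(\<Sum>j=1..<q. 2 * d P * (e2 * A j + e3 * B j)) \<le> (\<Sum>j=1..P. 2 / real P * (e2 * A j + e3 * B j))" .
    qed
    finally show ?thesis by (simp add: sum.distrib)
  qed
  then have "\<bar>V n\<bar> \<le> (\<Sum>j=1..P. 2 * (1 / real j - 1 / real P) * (e2 * A j + e3 * B j) + sqrt 2 * e1 / real j * B j)
     + (\<Sum>j=1..P. sqrt 2 * e1 / real j * B j + 2 / real P * (e2 * A j + e3 * B j))"
    using full[of P] Pq by simp
  also have "\<dots> = (\<Sum>j=1..P. (2 * e2 * A j + (2 * sqrt 2 * e1 + 2 * e3) * B j) / real j)"
    unfolding sum.distrib[symmetric] by (intro sum.cong refl) (simp add: algebra_simps add_divide_distrib)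
  also have "\<dots> \<le> (\<Sum>m=1..nat \<lfloor>sqrt (2 * real n)\<rfloor>. (2 * e2 * A m + (2 * sqrt 2 * e1 + 2 * e3) * B m) / real m)"
  proof (rule sum_mono2)
    have "2 * real n = real P * real P + real P + 2 * real q"
      by (simp add: Pq real_triangular algebra_simps)
    then have "(real P)\<^sup>2 \<le> 2 * real n" by (simp add: power2_eq_square)
    then have "real P \<le> sqrt (2 * real n)" by (rule real_le_rsqrt)
    then have "int P \<le> \<lfloor>sqrt (2 * real n)\<rfloor>" by (simp add: le_floor_iff)
    then show "{1..P} \<subseteq> {1..nat \<lfloor>sqrt (2 * real n)\<rfloor>}" by auto
  qed (use A B e in auto)
  finally show ?thesis .
qed

section \<open>The smoothed test functions\<close>

text \<open>
The \<open>j\<close>-th derivative of \<open>F\<^sub>m\<close>, the convolution of \<open>f\<close> with \<open>N(0, m\<sigma>\<^sup>2)\<close>, where \<open>m\<close> counts the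
Gaussian variables in place, the additional one included.
\<close>

definition lindeberg_fun :: "real \<Rightarrow> (real \<Rightarrow> real) \<Rightarrow> nat \<Rightarrow> nat \<Rightarrow> real \<Rightarrow> real" where
  "lindeberg_fun \<sigma> f j m = smoothing j (\<sigma> * sqrt (real m)) f"

context
  fixes \<sigma> :: real and f :: "real \<Rightarrow> real" and m :: nat
  assumes f: "1-lipschitz_on UNIV f" and s: "0 < \<sigma>" and m: "1 \<le> m"
begin

lemma lindeberg_fun_deriv:
  "(lindeberg_fun \<sigma> f j m has_real_derivative lindeberg_fun \<sigma> f (Suc j) m x) (at x)"
  unfolding lindeberg_fun_def using s m by (intro smoothing_deriv f) auto

lemma lindeberg_fun_lipschitz_general:
  "(hermite_norm j / (\<sigma> * sqrt (real m)) ^ j)-lipschitz_on UNIV (lindeberg_fun \<sigma> f j m)"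
  unfolding lindeberg_fun_def using s m by (intro smoothing_lipschitz f) auto

text \<open>
One more Gaussian variable of variance \<open>\<sigma>\<^sup>2\<close>, by the semigroup property.
\<close>

lemma lindeberg_fun_Suc: "lindeberg_fun \<sigma> f j (Suc m) x = smoothing 0 \<sigma> (lindeberg_fun \<sigma> f j m) x"
proof -
  have "\<sigma> * sqrt (real (Suc m)) = sqrt (\<sigma>\<^sup>2 + (\<sigma> * sqrt (real m))\<^sup>2)"
  proof -
    have "\<sigma>\<^sup>2 + (\<sigma> * sqrt (real m))\<^sup>2 = \<sigma>\<^sup>2 * real (Suc m)"
      by (simp add: power_mult_distrib algebra_simps)
    then show ?thesis using s by (simp add: real_sqrt_mult)
  qed
  then show ?thesis unfolding lindeberg_fun_def using s m
    by (subst smoothing_semigroup[OF f]) auto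
qed

lemma lindeberg_fun_lipschitz:
  "(hermite_norm 0)-lipschitz_on UNIV (lindeberg_fun \<sigma> f 0 m)"
  "(hermite_norm (Suc 0) / (\<sigma> * sqrt (real m)))-lipschitz_on UNIV (lindeberg_fun \<sigma> f (Suc 0) m)"
  "(hermite_norm 2 / (\<sigma>\<^sup>2 * real m))-lipschitz_on UNIV (lindeberg_fun \<sigma> f 2 m)"
  "(hermite_norm 3 / (\<sigma> ^ 3 * (real m * sqrt (real m))))-lipschitz_on UNIV (lindeberg_fun \<sigma> f 3 m)"
  using lindeberg_fun_lipschitz_general[of 0] lindeberg_fun_lipschitz_general[of "Suc 0"]
    lindeberg_fun_lipschitz_general[of 2] lindeberg_fun_lipschitz_general[of 3]
  by (simp_all add: power_mult_distrib power3_eq_cube[of "sqrt _"])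

lemma lindeberg_fun_bound:
  "\<bar>lindeberg_fun \<sigma> f (Suc j) m x\<bar> \<le> hermite_norm j / (\<sigma> * sqrt (real m)) ^ j"
proof -
  let ?L = "hermite_norm j / (\<sigma> * sqrt (real m)) ^ j"
  have "((\<lambda>h. (lindeberg_fun \<sigma> f j m (x + h) - lindeberg_fun \<sigma> f j m x) / h)
      \<longlongrightarrow> lindeberg_fun \<sigma> f (Suc j) m x) (at 0)"
    using lindeberg_fun_deriv[of j x] by (simp add: DERIV_def)
  then have "((\<lambda>h. \<bar>(lindeberg_fun \<sigma> f j m (x + h) - lindeberg_fun \<sigma> f j m x) / h\<bar>)
      \<longlongrightarrow> \<bar>lindeberg_fun \<sigma> f (Suc j) m x\<bar>) (at 0)" by (rule tendsto_rabs)
  moreover have "eventually (\<lambda>h. \<bar>(lindeberg_fun \<sigma> f j m (x + h) - lindeberg_fun \<sigma> f j m x) / h\<bar> \<le> ?L) (at 0)"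
    using eventually_neq_at_within[of 0 0 UNIV]
  proof eventually_elim
    case (elim h)
    then show ?case
      using lipschitz_real_bound[OF lindeberg_fun_lipschitz_general[of j], of "x + h" x]
      by (simp add: abs_divide pos_divide_le_eq)
  qed
  ultimately show ?thesis by (intro tendsto_upperbound) auto
qed

lemma lindeberg_fun_bound_1: "\<bar>lindeberg_fun \<sigma> f (Suc 0) m x\<bar> \<le> hermite_norm 0"
  using lindeberg_fun_bound[of 0 x] by simp

lemma lindeberg_fun_bound_2: "\<bar>lindeberg_fun \<sigma> f 2 m x\<bar> \<le> hermite_norm (Suc 0) / (\<sigma> * sqrt (real m))"
  using lindeberg_fun_bound[of "Suc 0" x] by (simp add: numeral_2_eq_2)

lemma lindeberg_fun_derivs:
  "(lindeberg_fun \<sigma> f 0 m has_real_derivative lindeberg_fun \<sigma> f (Suc 0) m x) (at x)"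
  "(lindeberg_fun \<sigma> f (Suc 0) m has_real_derivative lindeberg_fun \<sigma> f 2 m x) (at x)"
  "(lindeberg_fun \<sigma> f 2 m has_real_derivative lindeberg_fun \<sigma> f 3 m x) (at x)"
  using lindeberg_fun_deriv[of 0 x] lindeberg_fun_deriv[of "Suc 0" x] lindeberg_fun_deriv[of 2 x]
  by (simp_all add: numeral_2_eq_2 numeral_3_eq_3)

lemma lindeberg_fun_taylor:
  "\<bar>lindeberg_fun \<sigma> f 0 m (x + h) - lindeberg_fun \<sigma> f 0 m x - h * lindeberg_fun \<sigma> f (Suc 0) m x
     - h\<^sup>2 / 2 * lindeberg_fun \<sigma> f 2 m x\<bar> \<le> hermite_norm 2 / (6 * \<sigma>\<^sup>2 * real m) * \<bar>h\<bar> ^ 3"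
  "\<bar>lindeberg_fun \<sigma> f (Suc 0) m (x + h) - lindeberg_fun \<sigma> f (Suc 0) m x - h * lindeberg_fun \<sigma> f 2 m x\<bar>
     \<le> hermite_norm 2 / (2 * \<sigma>\<^sup>2 * real m) * h\<^sup>2"
  using taylor_lipschitz_2[OF lindeberg_fun_derivs(1,2) lindeberg_fun_lipschitz(3), of x h]
    taylor_lipschitz_1[OF lindeberg_fun_derivs(2) lindeberg_fun_lipschitz(3), of x h]
  by (simp_all add: mult_ac)

text \<open>
Discrete versions of the heat equation: passing from \<open>m\<close> to \<open>m + 1\<close> is a smoothing by \<open>N(0, \<sigma>\<^sup>2)\<close>,
whose effect is \<open>\<sigma>\<^sup>2/2\<close> times the second derivative up to an error of higher order. For \<open>F\<^sub>m'\<close> and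
\<open>F\<^sub>m''\<close> a bound for the size of this effect is enough.
\<close>

lemma lindeberg_fun_step:
  "\<bar>lindeberg_fun \<sigma> f 0 (Suc m) x - lindeberg_fun \<sigma> f 0 m x - \<sigma>\<^sup>2 / 2 * lindeberg_fun \<sigma> f 2 m x\<bar>
     \<le> hermite_norm 3 * \<sigma> / (8 * (real m * sqrt (real m)))"
  "\<bar>lindeberg_fun \<sigma> f (Suc 0) (Suc m) x - lindeberg_fun \<sigma> f (Suc 0) m x\<bar> \<le> hermite_norm 2 / (2 * real m)"
  "\<bar>lindeberg_fun \<sigma> f 2 (Suc m) x - lindeberg_fun \<sigma> f 2 m x\<bar>
     \<le> hermite_norm 3 / (2 * \<sigma> * (real m * sqrt (real m)))"
  using smoothing_error_3[OF lindeberg_fun_lipschitz(1) lindeberg_fun_derivs lindeberg_fun_lipschitz(4), of \<sigma> x]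
    smoothing_error_1[OF lindeberg_fun_lipschitz(2) lindeberg_fun_derivs(2) lindeberg_fun_lipschitz(3), of \<sigma> x]
    smoothing_error_1[OF lindeberg_fun_lipschitz(3) lindeberg_fun_derivs(3) lindeberg_fun_lipschitz(4), of \<sigma> x]
    s
  by (simp_all add: lindeberg_fun_Suc power2_eq_square power3_eq_cube power4_eq_xxxx mult_ac)

lemma lindeberg_fun_measurable [measurable]: "lindeberg_fun \<sigma> f j m \<in> borel_measurable borel"
  using lipschitz_borel_measurable[OF lindeberg_fun_lipschitz_general] .

end

text \<open>
The additional Gaussian variable costs at most \<open>\<sigma> E\<bar>Y\<bar> = \<sigma> c\<^sub>1\<close> on either side of the comparison.
\<close>

lemma lindeberg_fun_endpoints:
  assumes f: "1-lipschitz_on UNIV f" and s: "0 < \<sigma>"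
  shows "\<bar>lindeberg_fun \<sigma> f 0 1 x - f x\<bar> \<le> \<sigma> * hermite_norm (Suc 0)"
    and "1 \<le> n \<Longrightarrow> \<bar>lindeberg_fun \<sigma> f 0 (Suc n) x - smoothing 0 (\<sigma> * sqrt (real n)) f x\<bar> \<le> \<sigma> * hermite_norm (Suc 0)"
proof -
  show 1: "\<bar>lindeberg_fun \<sigma> f 0 1 x - f x\<bar> \<le> \<sigma> * hermite_norm (Suc 0)" for x
    using smoothing_error_0[OF f, of \<sigma> x] s by (simp add: lindeberg_fun_def)
  assume n: "1 \<le> n"
  define t where "t = \<sigma> * sqrt (real n)"
  have t: "0 < t" using n s by (simp add: t_def)
  have F: "1-lipschitz_on UNIV (lindeberg_fun \<sigma> f 0 1)"
    unfolding lindeberg_fun_def by (rule smoothing_0_lipschitz[OF f])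
  have "\<sigma> * sqrt (real (Suc n)) = sqrt (t\<^sup>2 + (\<sigma> * sqrt (real 1))\<^sup>2)"
  proof -
    have "t\<^sup>2 + (\<sigma> * sqrt (real 1))\<^sup>2 = \<sigma>\<^sup>2 * real (Suc n)"
      by (simp add: t_def power_mult_distrib algebra_simps)
    then show ?thesis using s by (simp add: real_sqrt_mult)
  qed
  then have eq: "lindeberg_fun \<sigma> f 0 (Suc n) x = smoothing 0 t (lindeberg_fun \<sigma> f 0 1) x"
    unfolding lindeberg_fun_def using smoothing_0_semigroup[OF f t, of "\<sigma> * sqrt (real 1)" x] s by simp
  let ?F = "\<lambda>y. lindeberg_fun \<sigma> f 0 1 (x + t * y) * std_normal_density y - f (x + t * y) * std_normal_density y"
  have eq2: "lindeberg_fun \<sigma> f 0 (Suc n) x - smoothing 0 t f x = (\<integral>y. ?F y \<partial>lborel)"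
    unfolding eq smoothing_0 using integrable_lipschitz_std_normal[OF F] integrable_lipschitz_std_normal[OF f] by simp
  have "\<bar>lindeberg_fun \<sigma> f 0 (Suc n) x - smoothing 0 t f x\<bar> \<le> (\<integral>y. \<sigma> * hermite_norm (Suc 0) * std_normal_density y \<partial>lborel)"
    unfolding eq2
  proof (rule integral_abs_bound_integral)
    fix y
    show "\<bar>?F y\<bar> \<le> \<sigma> * hermite_norm (Suc 0) * std_normal_density y"
      unfolding left_diff_distrib[symmetric] abs_mult abs_of_nonneg[OF normal_density_nonneg]
      by (intro mult_right_mono 1 normal_density_nonneg)
  qed (intro Bochner_Integration.integrable_diff integrable_lipschitz_std_normal[OF f]
        integrable_lipschitz_std_normal[OF F] integrable_mult_right; simp)+
  then show "\<bar>lindeberg_fun \<sigma> f 0 (Suc n) x - smoothing 0 (\<sigma> * sqrt (real n)) f x\<bar> \<le> \<sigma> * hermite_norm (Suc 0)"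
    by (simp add: t_def)
qed

section \<open>Strictly stationary sequences with an adapted filtration\<close>

locale stationary_sequence = prob_space M
  for M M0 :: "'a measure" and T :: "'a \<Rightarrow> 'a" and X0 :: "'a \<Rightarrow> real" +
  assumes mpt: "invertible_mpt M T"
    and subalg: "subalgebra M M0"
    and filtration: "sets M0 \<subseteq> sets (vimage_algebra (space M) T M0)"
    and X0_measurable: "X0 \<in> borel_measurable M0"
    and X0_cubed: "integrable M (\<lambda>\<omega>. \<bar>X0 \<omega>\<bar> ^ 3)"
    and centered: "(\<integral>\<omega>. X0 \<omega> \<partial>M) = 0"
begin

sublocale sigma_finite_subalgebra M M0
proof -
  interpret finite_measure_subalgebra M M0
    by unfold_locales (use subalg finite_measure_axioms in auto)
  show "sigma_finite_subalgebra M M0" by (rule sigma_finite_subalgebra_axioms)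
qed

abbreviation "iter \<equiv> int_iterate M T"

definition X :: "int \<Rightarrow> 'a \<Rightarrow> real" where "X i \<omega> = X0 (iter i \<omega>)"

definition S :: "nat \<Rightarrow> 'a \<Rightarrow> real" where "S n \<omega> = (\<Sum>k=1..n. X (int k) \<omega>)"

definition E0 :: "('a \<Rightarrow> real) \<Rightarrow> 'a \<Rightarrow> real" where "E0 = real_cond_exp M M0"

text \<open>
\<open>S\<^sub>j\<close> transported by the \<open>-j\<close>-th iterate, that is \<open>X\<^sub>0 + X\<^bsub>-1\<^esub> + ... + X\<^bsub>-(j-1)\<^esub>\<close>. It is measurable for
\<open>M\<^sub>0\<close>, which is why all conditioning can be done at time 0.
\<close>

definition past_sum :: "nat \<Rightarrow> 'a \<Rightarrow> real" where "past_sum j \<omega> = (\<Sum>i<j. X (- int i) \<omega>)"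

lemma space_M0: "space M0 = space M"
  using subalg by (simp add: subalgebra_def)

lemma T_facts:
  shows T_measurable [measurable]: "T \<in> M \<rightarrow>\<^sub>M M"
    and Tinv_measurable [measurable]: "inv_into (space M) T \<in> M \<rightarrow>\<^sub>M M"
    and T_Tinv: "\<omega> \<in> space M \<Longrightarrow> T (inv_into (space M) T \<omega>) = \<omega>"
    and Tinv_T: "\<omega> \<in> space M \<Longrightarrow> inv_into (space M) T (T \<omega>) = \<omega>"
    and distr_T: "distr M M T = M"
  using mpt unfolding invertible_mpt_def
  by (auto simp: bij_betw_inv_into_right bij_betw_inv_into_left)

lemma distr_Tinv: "distr M M (inv_into (space M) T) = M"
proof -
  have "distr M M (inv_into (space M) T) = distr (distr M M T) M (inv_into (space M) T)"
    by (simp add: distr_T)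
  also have "\<dots> = distr M M (inv_into (space M) T \<circ> T)"
    by (rule distr_distr) measurable
  also have "\<dots> = distr M M (\<lambda>\<omega>. \<omega>)"
    by (rule distr_cong) (auto simp: Tinv_T)
  finally show ?thesis by simp
qed

lemma distr_funpow:
  assumes [measurable]: "g \<in> M \<rightarrow>\<^sub>M M" and g: "distr M M g = M"
  shows "distr M M (g ^^ n) = M"
proof (induction n)
  case (Suc n)
  have [measurable]: "g ^^ n \<in> M \<rightarrow>\<^sub>M M" by (rule measurable_compose_n) measurable
  have "distr M M (g ^^ Suc n) = distr (distr M M (g ^^ n)) M g"
    by (simp add: distr_distr)
  then show ?case by (simp add: Suc g comp_def)
qed simp

lemma iter_measurable [measurable]: "iter i \<in> M \<rightarrow>\<^sub>M M"
  by (auto simp: int_iterate_def intro!: measurable_compose_n)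

lemma iter_space: "\<omega> \<in> space M \<Longrightarrow> iter i \<omega> \<in> space M"
  using iter_measurable by (rule measurable_space)

lemma distr_iter: "distr M M (iter i) = M"
  by (simp add: int_iterate_def distr_funpow distr_T distr_Tinv)

lemma iter_0 [simp]: "iter 0 \<omega> = \<omega>"
  by (simp add: int_iterate_def)

lemma iter_succ:
  assumes "\<omega> \<in> space M"
  shows "iter (i + 1) \<omega> = T (iter i \<omega>)"
proof (cases "0 \<le> i")
  case True
  then have "nat (i + 1) = Suc (nat i)" by simp
  then show ?thesis using True by (simp add: int_iterate_def)
next
  case False
  then have eq: "nat (- i) = Suc (nat (- (i + 1)))" by simp
  have sp: "(inv_into (space M) T ^^ nat (- (i + 1))) \<omega> \<in> space M"
    using measurable_space[OF measurable_compose_n[OF Tinv_measurable] assms] by simp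
  have "T (iter i \<omega>) = (inv_into (space M) T ^^ nat (- (i + 1))) \<omega>"
    using False T_Tinv[OF sp] by (simp only: int_iterate_def eq) simp
  also have "\<dots> = iter (i + 1) \<omega>"
    using False by (auto simp: int_iterate_def)
  finally show ?thesis by simp
qed

lemma iter_add:
  assumes w: "\<omega> \<in> space M"
  shows "iter i (iter j \<omega>) = iter (i + j) \<omega>"
proof (induction i rule: int_induct[where k = 0])
  case base
  then show ?case by simp
next
  case (step1 i)
  then show ?case using iter_succ[OF w, of "i + j"] iter_succ[OF iter_space[OF w], of i j]
    by (simp add: algebra_simps)
next
  case (step2 i)
  have "T (iter (i - 1) (iter j \<omega>)) = T (iter (i - 1 + j) \<omega>)"
    using step2 iter_succ[OF w, of "i - 1 + j"] iter_succ[OF iter_space[OF w], of "i - 1" j]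
    by (simp add: algebra_simps)
  then show ?case using Tinv_T iter_space w by metis
qed

lemma X_iter: "\<omega> \<in> space M \<Longrightarrow> X i (iter j \<omega>) = X (i + j) \<omega>"
  by (simp add: X_def iter_add)

lemma X_0: "X 0 = X0"
  by (auto simp: X_def)

lemma integral_iter:
  fixes h :: "'a \<Rightarrow> real"
  assumes [measurable]: "h \<in> borel_measurable M"
  shows "(\<integral>\<omega>. h (iter i \<omega>) \<partial>M) = (\<integral>\<omega>. h \<omega> \<partial>M)"
    and "integrable M (\<lambda>\<omega>. h (iter i \<omega>)) \<longleftrightarrow> integrable M h"
  using integral_distr[OF iter_measurable[of i] assms] integrable_distr_eq[OF iter_measurable[of i] assms]
  by (simp_all add: distr_iter)

text \<open>
The transport principle behind all later steps: an expectation may be computed after composing the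
integrand with any iterate of the measure preserving map.
\<close>

lemma integral_shift:
  fixes h g :: "'a \<Rightarrow> real"
  assumes "h \<in> borel_measurable M" "\<And>\<omega>. \<omega> \<in> space M \<Longrightarrow> h (iter i \<omega>) = g \<omega>"
  shows "(\<integral>\<omega>. h \<omega> \<partial>M) = (\<integral>\<omega>. g \<omega> \<partial>M)"
  using integral_iter(1)[OF assms(1), of i] assms(2) by (metis (no_types, lifting) Bochner_Integration.integral_cong)

lemma M0_borel_imp: "h \<in> borel_measurable M0 \<Longrightarrow> h \<in> borel_measurable M" for h :: "'a \<Rightarrow> real"
  by (rule measurable_from_subalg[OF subalg])

lemma X0_borel [measurable]: "X0 \<in> borel_measurable M"
  by (rule M0_borel_imp[OF X0_measurable])

lemma X_borel [measurable]: "X i \<in> borel_measurable M"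
  unfolding X_def[abs_def] by measurable

lemma S_borel [measurable]: "S n \<in> borel_measurable M"
  unfolding S_def[abs_def] by measurable

text \<open>
The inclusion of \<open>M\<^sub>0\<close> in its preimage under \<open>T\<close> says that the filtration is nondecreasing;
equivalently the inverse map is measurable from \<open>M\<^sub>0\<close> to itself, so the past is \<open>M\<^sub>0\<close>-measurable.
\<close>

lemma Tinv_M0: "inv_into (space M) T \<in> M0 \<rightarrow>\<^sub>M M0"
proof (rule measurableI)
  fix x assume "x \<in> space M0"
  then show "inv_into (space M) T x \<in> space M0"
    using measurable_space[OF Tinv_measurable] by (simp add: space_M0)
next
  fix A assume A: "A \<in> sets M0"
  then have "A \<in> sets (vimage_algebra (space M) T M0)" using filtration by auto
  moreover have "T \<in> space M \<rightarrow> space M0" using measurable_space[OF T_measurable] by (auto simp: space_M0)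
  ultimately obtain B where B: "B \<in> sets M0" "A = T -` B \<inter> space M"
    by (auto simp: sets_vimage_algebra2)
  have Bs: "B \<subseteq> space M" using sets.sets_into_space[OF B(1)] by (simp add: space_M0)
  have "inv_into (space M) T -` A \<inter> space M0 = B"
    unfolding B(2) using Bs measurable_space[OF Tinv_measurable] T_Tinv by (auto simp: space_M0)
  then show "inv_into (space M) T -` A \<inter> space M0 \<in> sets M0" using B(1) by simp
qed

lemma X_past_M0: "X (- int i) \<in> borel_measurable M0"
proof -
  have "iter (- int i) \<in> M0 \<rightarrow>\<^sub>M M0"
    by (cases "i = 0") (auto simp: int_iterate_def intro!: measurable_compose_n Tinv_M0)
  then show ?thesis unfolding X_def[abs_def]
    by (rule measurable_compose[OF _ X0_measurable])
qed

lemma past_sum_M0: "past_sum j \<in> borel_measurable M0"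
  unfolding past_sum_def[abs_def] by (intro borel_measurable_sum X_past_M0)

lemma past_sum_borel [measurable]: "past_sum j \<in> borel_measurable M"
  by (rule M0_borel_imp[OF past_sum_M0])

lemma S_iter: 
  assumes "\<omega> \<in> space M"
  shows "S n (iter (- int k) \<omega>) = (\<Sum>l=1..n. X (int l - int k) \<omega>)"
  unfolding S_def using assms by (intro sum.cong refl) (simp add: X_iter)

lemma S_iter_past:
  assumes "\<omega> \<in> space M"
  shows "S k (iter (- int k) \<omega>) = past_sum k \<omega>"
  unfolding S_iter[OF assms] past_sum_def
  by (rule sum.reindex_bij_witness[where i = "\<lambda>i. k - i" and j = "\<lambda>l. k - l"]) (auto simp: of_nat_diff)

lemma S_iter_past_Suc:
  assumes w: "\<omega> \<in> space M"
  shows "S k (iter (- int (Suc k)) \<omega>) = past_sum (Suc k) \<omega> - X0 \<omega>"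
proof -
  have "S (Suc k) (iter (- int (Suc k)) \<omega>) = S k (iter (- int (Suc k)) \<omega>) + X0 \<omega>"
    unfolding S_iter[OF w] by (simp add: X_0)
  then show ?thesis using S_iter_past[OF w, of "Suc k"] by simp
qed

lemma S_iter_future:
  assumes w: "\<omega> \<in> space M" and k: "k \<le> n"
  shows "S n (iter (- int k) \<omega>) - S k (iter (- int k) \<omega>) = S (n - k) \<omega>"
proof -
  have "{1..n} = {1..k} \<union> {k+1..n}" "{1..k} \<inter> {k+1..n} = {}" using k by auto
  then have "S n (iter (- int k) \<omega>) = S k (iter (- int k) \<omega>) + (\<Sum>l=k+1..n. X (int l - int k) \<omega>)"
    unfolding S_iter[OF w] by (simp add: sum.union_disjoint)
  moreover have "(\<Sum>l=k+1..n. X (int l - int k) \<omega>) = S (n - k) \<omega>"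
    unfolding S_def
    by (rule sum.reindex_bij_witness[where i = "\<lambda>l. l + k" and j = "\<lambda>l. l - k"]) (auto simp: of_nat_diff)
  ultimately show ?thesis by simp
qed

text \<open>
All products that occur have total degree at most 3, so third moments suffice.
\<close>

lemma integrable_powers:
  shows "integrable M (\<lambda>\<omega>. \<bar>X i \<omega>\<bar> ^ 3)" and "integrable M (X i)" and "integrable M (\<lambda>\<omega>. X i \<omega> * X j \<omega>)"
    and "integrable M (\<lambda>\<omega>. (X i \<omega>)\<^sup>2 * X j \<omega>)"
proof -
  show cube: "integrable M (\<lambda>\<omega>. \<bar>X i \<omega>\<bar> ^ 3)" for i
    unfolding X_def using X0_cubed by (subst integral_iter(2)[where h = "\<lambda>\<omega>. \<bar>X0 \<omega>\<bar> ^ 3"]) auto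
  have 1: "\<bar>a\<bar> \<le> 1 + \<bar>a\<bar> ^ 3" for a :: real
  proof (cases "\<bar>a\<bar> \<le> 1")
    case False
    then have "\<bar>a\<bar> ^ 1 \<le> \<bar>a\<bar> ^ 3" by (intro power_increasing) auto
    then show ?thesis by simp
  qed (simp add: add_increasing2)
  have 3: "\<bar>a\<^sup>2 * b\<bar> \<le> \<bar>a\<bar> ^ 3 + \<bar>b\<bar> ^ 3" for a b :: real
  proof (cases "\<bar>a\<bar> \<le> \<bar>b\<bar>")
    case True
    then have "\<bar>a\<bar>\<^sup>2 * \<bar>b\<bar> \<le> \<bar>b\<bar>\<^sup>2 * \<bar>b\<bar>" by (intro mult_right_mono power_mono) auto
    then have "\<bar>a\<^sup>2 * b\<bar> \<le> \<bar>b\<bar> ^ 3" by (simp add: abs_mult power2_eq_square power3_eq_cube)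
    then show ?thesis by (simp add: add_increasing)
  next
    case False
    then have "\<bar>a\<bar>\<^sup>2 * \<bar>b\<bar> \<le> \<bar>a\<bar>\<^sup>2 * \<bar>a\<bar>" by (intro mult_left_mono) auto
    then have "\<bar>a\<^sup>2 * b\<bar> \<le> \<bar>a\<bar> ^ 3" by (simp add: abs_mult power2_eq_square power3_eq_cube)
    then show ?thesis by (simp add: add_increasing2)
  qed
  have 2: "\<bar>a * b\<bar> \<le> 2 + (\<bar>a\<bar> ^ 3 + \<bar>b\<bar> ^ 3)" for a b :: real
  proof -
    have "\<bar>a * b\<bar> \<le> a\<^sup>2 * 1 + b\<^sup>2 * 1"
      using zero_le_power2[of "\<bar>a\<bar> - \<bar>b\<bar>"] mult_nonneg_nonneg[OF abs_ge_zero abs_ge_zero, of a b]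
      unfolding power2_diff abs_mult power2_abs by linarith
    also have "\<dots> \<le> (\<bar>a\<bar> ^ 3 + 1) + (\<bar>b\<bar> ^ 3 + 1)"
      using 3[of a 1] 3[of b 1] by simp
    also have "\<dots> = 2 + (\<bar>a\<bar> ^ 3 + \<bar>b\<bar> ^ 3)" by simp
    finally show ?thesis .
  qed
  show "integrable M (X i)"
    by (rule Bochner_Integration.integrable_bound[where f = "\<lambda>\<omega>. 1 + \<bar>X i \<omega>\<bar> ^ 3"])
       (use cube 1 in \<open>auto intro!: order_trans[OF 1]\<close>)
  show "integrable M (\<lambda>\<omega>. X i \<omega> * X j \<omega>)"
    by (rule Bochner_Integration.integrable_bound[where f = "\<lambda>\<omega>. 2 + (\<bar>X i \<omega>\<bar> ^ 3 + \<bar>X j \<omega>\<bar> ^ 3)"])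
       (use cube in \<open>auto intro!: order_trans[OF 2]\<close>)
  show "integrable M (\<lambda>\<omega>. (X i \<omega>)\<^sup>2 * X j \<omega>)"
    by (rule Bochner_Integration.integrable_bound[where f = "\<lambda>\<omega>. \<bar>X i \<omega>\<bar> ^ 3 + \<bar>X j \<omega>\<bar> ^ 3"])
       (use cube in \<open>auto intro!: order_trans[OF 3]\<close>)
qed

lemma integrable_X0_powers:
  shows "integrable M X0" and "integrable M (\<lambda>\<omega>. (X0 \<omega>)\<^sup>2)"
  using integrable_powers(2)[of 0] integrable_powers(3)[of 0 0] by (auto simp: X_0 power2_eq_square)

lemma integrable_S: "integrable M (S n)" 
  unfolding S_def[abs_def] by (intro Bochner_Integration.integrable_sum integrable_powers)

lemma integrable_X0_S: "integrable M (\<lambda>\<omega>. X0 \<omega> * S n \<omega>)" "integrable M (\<lambda>\<omega>. (X0 \<omega>)\<^sup>2 * S n \<omega>)"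
  unfolding S_def[abs_def] sum_distrib_left
  using integrable_powers(3)[of 0] integrable_powers(4)[of 0]
  by (auto simp: X_0 intro!: Bochner_Integration.integrable_sum)

lemma expectation_X: "(\<integral>\<omega>. X i \<omega> \<partial>M) = 0"
  unfolding X_def using integral_iter(1)[OF X0_borel, of i] centered by simp

lemma expectation_S: "(\<integral>\<omega>. S n \<omega> \<partial>M) = 0"
  unfolding S_def by (subst Bochner_Integration.integral_sum) (auto simp: expectation_X integrable_powers)

lemma E0_M0 [measurable]: "E0 h \<in> borel_measurable M0"
  unfolding E0_def by simp

lemma E0_borel [measurable]: "E0 h \<in> borel_measurable M"
  unfolding E0_def by simp

lemma E0_integral:
  assumes "integrable M (\<lambda>\<omega>. g \<omega> * h \<omega>)" "g \<in> borel_measurable M0" "h \<in> borel_measurable M"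
  shows "integrable M (\<lambda>\<omega>. g \<omega> * E0 h \<omega>)" "(\<integral>\<omega>. g \<omega> * h \<omega> \<partial>M) = (\<integral>\<omega>. g \<omega> * E0 h \<omega> \<partial>M)"
  unfolding E0_def using real_cond_exp_intg[OF assms] by simp_all

lemma integrable_lipschitz_comp:
  fixes g :: "real \<Rightarrow> real"
  assumes "L-lipschitz_on UNIV g" "integrable M h"
  shows "integrable M (\<lambda>\<omega>. g (h \<omega>))"
proof (rule Bochner_Integration.integrable_bound[where f = "\<lambda>\<omega>. \<bar>g 0\<bar> + L * \<bar>h \<omega>\<bar>"])
  note [measurable] = lipschitz_borel_measurable[OF assms(1)] 
  have [measurable]: "h \<in> borel_measurable M" using assms(2) by simp
  show "(\<lambda>\<omega>. g (h \<omega>)) \<in> borel_measurable M" by measurable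
  have "norm (g (h \<omega>)) \<le> norm (\<bar>g 0\<bar> + L * \<bar>h \<omega>\<bar>)" for \<omega>
    using lipschitz_real_bound[OF assms(1), of "h \<omega>" 0] by simp
  then show "AE \<omega> in M. norm (g (h \<omega>)) \<le> norm (\<bar>g 0\<bar> + L * \<bar>h \<omega>\<bar>)" by simp
qed (use assms in auto)

lemma integrable_bounded_mult:
  fixes g h :: "'a \<Rightarrow> real"
  assumes [measurable]: "g \<in> borel_measurable M" and "\<And>\<omega>. \<bar>g \<omega>\<bar> \<le> C" and h: "integrable M h"
  shows "integrable M (\<lambda>\<omega>. g \<omega> * h \<omega>)"
proof (rule Bochner_Integration.integrable_bound[where f = "\<lambda>\<omega>. C * h \<omega>"])
  have [measurable]: "h \<in> borel_measurable M" using h by simp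
  show "(\<lambda>\<omega>. g \<omega> * h \<omega>) \<in> borel_measurable M" by measurable
  have "norm (g \<omega> * h \<omega>) \<le> norm (C * h \<omega>)" for \<omega>
    using assms(2)[of \<omega>] by (simp add: abs_mult mult_right_mono)
  then show "AE \<omega> in M. norm (g \<omega> * h \<omega>) \<le> norm (C * h \<omega>)" by simp
qed (use h in auto)

lemma abs_expectation_le:
  assumes f: "integrable M f" and g: "integrable M g" and le: "\<And>\<omega>. \<bar>f \<omega>\<bar> \<le> (g \<omega> :: real)"
  shows "\<bar>\<integral>\<omega>. f \<omega> \<partial>M\<bar> \<le> (\<integral>\<omega>. g \<omega> \<partial>M)"
  by (rule order_trans[OF integral_abs_bound integral_mono]) (use assms in auto)

text \<open>
Conditioning on \<open>M\<^sub>0\<close> replaces \<open>h\<close> by its projection before absolute values are taken.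
\<close>

lemma expectation_mult_bound:
  assumes g: "g \<in> borel_measurable M0" and B: "\<And>\<omega>. \<bar>g \<omega>\<bar> \<le> B \<omega>"
    and gh: "integrable M (\<lambda>\<omega>. g \<omega> * h \<omega>)" and h: "h \<in> borel_measurable M"
    and int: "integrable M (\<lambda>\<omega>. B \<omega> * \<bar>E0 h \<omega>\<bar>)"
  shows "\<bar>\<integral>\<omega>. g \<omega> * h \<omega> \<partial>M\<bar> \<le> (\<integral>\<omega>. B \<omega> * \<bar>E0 h \<omega>\<bar> \<partial>M)"
  unfolding E0_integral(2)[OF gh g h]
proof (rule abs_expectation_le)
  show "\<bar>g \<omega> * E0 h \<omega>\<bar> \<le> B \<omega> * \<bar>E0 h \<omega>\<bar>" for \<omega>
    unfolding abs_mult by (rule mult_right_mono[OF B]) simp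
qed (fact int E0_integral(1)[OF gh g h])+

end

section \<open>One step of the replacement and the block estimate\<close>

context stationary_sequence
begin

lemma past_sum_Suc_shift:
  assumes w: "\<omega> \<in> space M"
  shows "past_sum (Suc k) (iter 1 \<omega>) - X0 (iter 1 \<omega>) = past_sum k \<omega>"
proof -
  have "past_sum (Suc k) (iter 1 \<omega>) = (\<Sum>i<Suc k. X (1 - int i) \<omega>)"
    unfolding past_sum_def using w by (intro sum.cong refl) (simp add: X_iter)
  also have "\<dots> = X 1 \<omega> + (\<Sum>i<k. X (1 - int (Suc i)) \<omega>)"
    by (subst sum.lessThan_Suc_shift) simp
  finally show ?thesis by (simp add: past_sum_def X_def)
qed

lemma S_Suc_shift:
  assumes w: "\<omega> \<in> space M"
  shows "X0 (iter 1 \<omega>) + S r (iter 1 \<omega>) = S (Suc r) \<omega>"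
proof -
  have "S r (iter 1 \<omega>) = (\<Sum>k=1..r. X (int (Suc k)) \<omega>)"
    unfolding S_def using w by (intro sum.cong refl) (simp add: X_iter add.commute)
  also have "\<dots> = (\<Sum>k=Suc 1..Suc r. X (int k) \<omega>)"
    by (rule sum.shift_bounds_cl_Suc_ivl[symmetric])
  finally show ?thesis
    by (simp add: S_def X_def sum.atLeast_Suc_atMost[of "Suc 0" "Suc r"] del: sum.cl_ivl_Suc)
qed

context
  fixes f :: "real \<Rightarrow> real" and \<sigma> :: real
  assumes f: "1-lipschitz_on UNIV f" and s: "0 < \<sigma>"
begin

abbreviation "D \<equiv> lindeberg_fun \<sigma> f"

lemma D_measurable [measurable]: "1 \<le> m \<Longrightarrow> D j m \<in> borel_measurable borel"
  by (rule lindeberg_fun_measurable[OF f s])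

text \<open>
The next five lemmas estimate the five parts into which the increment of the telescoped quantity is
split in \<open>lindeberg_step\<close>. Throughout, \<open>Q\<close> stands for the past \<open>S\<^sub>k\<close>, \<open>X0\<close> for the
variable \<open>X\<^bsub>k+1\<^esub>\<close> that is exchanged and \<open>S r\<close> for the future \<open>S\<^sub>n - S\<^bsub>k+1\<^esub>\<close>, all shifted by
\<open>-(k + 1)\<close>, so that \<open>m = r + 1\<close>.
\<close>

lemma lindeberg_taylor_term:
  assumes [measurable]: "Q \<in> borel_measurable M" and m: "1 \<le> m"
  defines "A \<equiv> \<lambda>\<omega>. D 0 m (Q \<omega> + X0 \<omega>) - D 0 m (Q \<omega>) - X0 \<omega> * D (Suc 0) m (Q \<omega>) - (X0 \<omega>)\<^sup>2 / 2 * D 2 m (Q \<omega>)"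
  shows "integrable M A" "\<bar>\<integral>\<omega>. A \<omega> \<partial>M\<bar> \<le> (\<integral>\<omega>. \<bar>X0 \<omega>\<bar> ^ 3 \<partial>M) / (6 * \<sigma>\<^sup>2 * real m)"
proof -
  have le: "\<bar>A \<omega>\<bar> \<le> \<bar>X0 \<omega>\<bar> ^ 3 / (6 * \<sigma>\<^sup>2 * real m)" for \<omega>
  proof -
    have "\<bar>A \<omega>\<bar> \<le> hermite_norm 2 / (6 * \<sigma>\<^sup>2 * real m) * \<bar>X0 \<omega>\<bar> ^ 3"
      unfolding A_def by (rule lindeberg_fun_taylor(1)[OF f s m])
    also have "\<dots> \<le> 1 / (6 * \<sigma>\<^sup>2 * real m) * \<bar>X0 \<omega>\<bar> ^ 3"
      by (intro mult_right_mono divide_right_mono hermite_norm_2_le) auto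
    finally show ?thesis by simp
  qed
  have [measurable]: "A \<in> borel_measurable M" unfolding A_def using m by measurable
  have int: "integrable M (\<lambda>\<omega>. \<bar>X0 \<omega>\<bar> ^ 3 / (6 * \<sigma>\<^sup>2 * real m))" using X0_cubed by simp
  show "integrable M A"
    by (rule Bochner_Integration.integrable_bound[OF int]) (use le in \<open>auto intro: order_trans[OF le]\<close>)
  from abs_expectation_le[OF this int le]
  show "\<bar>\<integral>\<omega>. A \<omega> \<partial>M\<bar> \<le> (\<integral>\<omega>. \<bar>X0 \<omega>\<bar> ^ 3 \<partial>M) / (6 * \<sigma>\<^sup>2 * real m)" by simp
qed

lemma lindeberg_gauss_term:
  assumes [measurable]: "Q \<in> borel_measurable M" and m: "1 \<le> m"
  defines "A \<equiv> \<lambda>\<omega>. D 0 m (Q \<omega>) - D 0 (Suc m) (Q \<omega>) + \<sigma>\<^sup>2 / 2 * D 2 m (Q \<omega>)"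
  shows "integrable M A" "\<bar>\<integral>\<omega>. A \<omega> \<partial>M\<bar> \<le> hermite_norm 3 * \<sigma> / (8 * (real m * sqrt (real m)))"
proof -
  let ?c = "hermite_norm 3 * \<sigma> / (8 * (real m * sqrt (real m)))"
  have le: "\<bar>A \<omega>\<bar> \<le> ?c" for \<omega>
    unfolding A_def using lindeberg_fun_step(1)[OF f s m, of "Q \<omega>"] by linarith
  have [measurable]: "A \<in> borel_measurable M" unfolding A_def using m by measurable
  show "integrable M A" by (rule integrable_const_bound[of _ ?c]) (use le in auto)
  from abs_expectation_le[OF this _ le] show "\<bar>\<integral>\<omega>. A \<omega> \<partial>M\<bar> \<le> ?c"
    by (simp add: prob_space)
qed

text \<open>
This part is transported by one further step, so that the whole future \<open>S\<^sub>n - S\<^sub>k\<close> is predicted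
from time \<open>k\<close>, which leads to \<open>E\<^sub>0(S\<^sub>m)\<close> rather than to \<open>E\<^sub>0(S\<^sub>r)\<close>.
\<close>

lemma lindeberg_drift_term:
  fixes k :: nat
  assumes m: "1 \<le> m" and r: "m = Suc r"
  defines "A \<equiv> \<lambda>\<omega>. (D (Suc 0) m (past_sum (Suc k) \<omega> - X0 \<omega>) - D (Suc 0) (Suc m) (past_sum (Suc k) \<omega> - X0 \<omega>)) * (X0 \<omega> + S r \<omega>)"
  shows "integrable M A" "\<bar>\<integral>\<omega>. A \<omega> \<partial>M\<bar> \<le> 1 / (2 * real m) * (\<integral>\<omega>. \<bar>E0 (S m) \<omega>\<bar> \<partial>M)"
proof -
  let ?g = "\<lambda>y. D (Suc 0) m y - D (Suc 0) (Suc m) y"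
  have le: "\<bar>?g y\<bar> \<le> 1 / (2 * real m)" for y
  proof -
    have "\<bar>?g y\<bar> \<le> hermite_norm 2 / (2 * real m)"
      using lindeberg_fun_step(2)[OF f s m, of y] by linarith
    also have "\<dots> \<le> 1 / (2 * real m)" by (intro divide_right_mono hermite_norm_2_le) auto
    finally show ?thesis .
  qed
  have [measurable]: "?g \<in> borel_measurable borel" using m by measurable
  show int: "integrable M A" unfolding A_def
    by (rule integrable_bounded_mult[where C = "1 / (2 * real m)"])
       (use le integrable_X0_powers integrable_S in auto)
  have "(\<integral>\<omega>. A \<omega> \<partial>M) = (\<integral>\<omega>. ?g (past_sum k \<omega>) * S m \<omega> \<partial>M)"
  proof (rule integral_shift[where i = 1])
    show "A \<in> borel_measurable M" using int by simp
    show "A (iter 1 \<omega>) = ?g (past_sum k \<omega>) * S m \<omega>" if "\<omega> \<in> space M" for \<omega>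
      unfolding A_def past_sum_Suc_shift[OF that] S_Suc_shift[OF that] r ..
  qed
  also have "\<bar>\<dots>\<bar> \<le> (\<integral>\<omega>. 1 / (2 * real m) * \<bar>E0 (S m) \<omega>\<bar> \<partial>M)"
  proof (rule expectation_mult_bound)
    show "(\<lambda>\<omega>. ?g (past_sum k \<omega>)) \<in> borel_measurable M0"
      by (rule measurable_compose[OF past_sum_M0]) measurable
    show "integrable M (\<lambda>\<omega>. ?g (past_sum k \<omega>) * S m \<omega>)"
      by (rule integrable_bounded_mult[where C = "1 / (2 * real m)"]) (use le integrable_S in auto)
    show "integrable M (\<lambda>\<omega>. 1 / (2 * real m) * \<bar>E0 (S m) \<omega>\<bar>)"
      unfolding E0_def by (intro integrable_mult_right integrable_abs real_cond_exp_int integrable_S)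
  qed (use le in auto)
  finally show "\<bar>\<integral>\<omega>. A \<omega> \<partial>M\<bar> \<le> 1 / (2 * real m) * (\<integral>\<omega>. \<bar>E0 (S m) \<omega>\<bar> \<partial>M)" by simp
qed

lemma lindeberg_second_taylor_term:
  fixes r :: nat
  assumes Q: "Q \<in> borel_measurable M0" and m: "1 \<le> m"
  defines "A \<equiv> \<lambda>\<omega>. (D (Suc 0) m (Q \<omega> + X0 \<omega>) - D (Suc 0) m (Q \<omega>) - X0 \<omega> * D 2 m (Q \<omega>)) * S r \<omega>"
  shows "integrable M A"
    "\<bar>\<integral>\<omega>. A \<omega> \<partial>M\<bar> \<le> 1 / (2 * \<sigma>\<^sup>2 * real m) * (\<integral>\<omega>. (X0 \<omega>)\<^sup>2 * \<bar>E0 (S r) \<omega>\<bar> \<partial>M)"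
proof -
  note X0_measurable [measurable] Q [measurable]
  have Q' [measurable]: "Q \<in> borel_measurable M" by (rule M0_borel_imp[OF Q])
  let ?g = "\<lambda>\<omega>. D (Suc 0) m (Q \<omega> + X0 \<omega>) - D (Suc 0) m (Q \<omega>) - X0 \<omega> * D 2 m (Q \<omega>)"
  have le: "\<bar>?g \<omega>\<bar> \<le> 1 / (2 * \<sigma>\<^sup>2 * real m) * (X0 \<omega>)\<^sup>2" for \<omega>
  proof -
    have "\<bar>?g \<omega>\<bar> \<le> hermite_norm 2 / (2 * \<sigma>\<^sup>2 * real m) * (X0 \<omega>)\<^sup>2"
      by (rule lindeberg_fun_taylor(2)[OF f s m])
    also have "\<dots> \<le> 1 / (2 * \<sigma>\<^sup>2 * real m) * (X0 \<omega>)\<^sup>2"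
      by (intro mult_right_mono divide_right_mono hermite_norm_2_le) auto
    finally show ?thesis .
  qed
  have g0: "?g \<in> borel_measurable M0" using m by measurable
  have [measurable]: "?g \<in> borel_measurable M" by (rule M0_borel_imp[OF g0])
  show int: "integrable M A" unfolding A_def
  proof (rule Bochner_Integration.integrable_bound[where f = "\<lambda>\<omega>. 1 / (2 * \<sigma>\<^sup>2 * real m) * ((X0 \<omega>)\<^sup>2 * S r \<omega>)"])
    show "integrable M (\<lambda>\<omega>. 1 / (2 * \<sigma>\<^sup>2 * real m) * ((X0 \<omega>)\<^sup>2 * S r \<omega>))"
      by (intro integrable_mult_right integrable_X0_S)
    have "norm (?g \<omega> * S r \<omega>) \<le> norm (1 / (2 * \<sigma>\<^sup>2 * real m) * ((X0 \<omega>)\<^sup>2 * S r \<omega>))" for \<omega>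
      using mult_right_mono[OF le[of \<omega>], of "\<bar>S r \<omega>\<bar>"] by (simp add: abs_mult)
    then show "AE \<omega> in M. norm (?g \<omega> * S r \<omega>) \<le> norm (1 / (2 * \<sigma>\<^sup>2 * real m) * ((X0 \<omega>)\<^sup>2 * S r \<omega>))" by simp
  qed measurable
  have eint: "integrable M (\<lambda>\<omega>. (X0 \<omega>)\<^sup>2 * \<bar>E0 (S r) \<omega>\<bar>)"
  proof -
    have "integrable M (\<lambda>\<omega>. (X0 \<omega>)\<^sup>2 * E0 (S r) \<omega>)"
      by (rule E0_integral(1)[OF integrable_X0_S(2)]) measurable
    from integrable_abs[OF this] show ?thesis by (simp add: abs_mult)
  qed
  have "\<bar>\<integral>\<omega>. ?g \<omega> * S r \<omega> \<partial>M\<bar> \<le> (\<integral>\<omega>. 1 / (2 * \<sigma>\<^sup>2 * real m) * (X0 \<omega>)\<^sup>2 * \<bar>E0 (S r) \<omega>\<bar> \<partial>M)"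
    by (rule expectation_mult_bound[OF g0 le int[unfolded A_def]])
       (use eint in \<open>auto simp: mult.assoc\<close>)
  then show "\<bar>\<integral>\<omega>. A \<omega> \<partial>M\<bar> \<le> 1 / (2 * \<sigma>\<^sup>2 * real m) * (\<integral>\<omega>. (X0 \<omega>)\<^sup>2 * \<bar>E0 (S r) \<omega>\<bar> \<partial>M)"
    unfolding A_def by (simp only: mult.assoc integral_mult_right_zero)
qed

text \<open>
Conditioning replaces \<open>X\<^sub>0 S\<^sub>r\<close> by \<open>X\<^sub>0 E\<^sub>0(S\<^sub>r)\<close>, the part up to time \<open>r\<close> of the limit \<open>G\<close>; the
difference is the tail \<open>R\<close>, which is controlled by the bound \<open>c\<^sub>1 / (\<sigma> sqrt m)\<close> on \<open>F\<^sub>m''\<close>.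
\<close>

lemma lindeberg_quadratic_term:
  assumes Q: "Q \<in> borel_measurable M0" and m: "1 \<le> m"
    and G: "integrable M G" and R: "integrable M R"
    and GR: "AE \<omega> in M. R \<omega> = G \<omega> - X0 \<omega> * E0 (S r) \<omega>"
    and Z: "\<And>\<omega>. Z \<omega> = (X0 \<omega>)\<^sup>2 - \<sigma>\<^sup>2 + 2 * G \<omega>"
  defines "A \<equiv> \<lambda>\<omega>. D 2 m (Q \<omega>) * ((X0 \<omega>)\<^sup>2 / 2 - \<sigma>\<^sup>2 / 2 + X0 \<omega> * S r \<omega>)"
  shows "integrable M A"
    "(\<integral>\<omega>. A \<omega> \<partial>M) \<le> (\<integral>\<omega>. D 2 m (Q \<omega>) * Z \<omega> \<partial>M) / 2 + 1 / (\<sigma> * sqrt (real m)) * (\<integral>\<omega>. \<bar>R \<omega>\<bar> \<partial>M)"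
proof -
  note X0_measurable [measurable] Q [measurable]
  have Q' [measurable]: "Q \<in> borel_measurable M" by (rule M0_borel_imp[OF Q])
  have [measurable]: "R \<in> borel_measurable M" "G \<in> borel_measurable M" using G R by auto
  let ?h = "\<lambda>\<omega>. D 2 m (Q \<omega>)"
  have le: "\<bar>?h \<omega>\<bar> \<le> 1 / (\<sigma> * sqrt (real m))" for \<omega>
  proof -
    have "\<bar>?h \<omega>\<bar> \<le> hermite_norm (Suc 0) / (\<sigma> * sqrt (real m))"
      by (rule lindeberg_fun_bound_2[OF f s m])
    also have "\<dots> \<le> 1 / (\<sigma> * sqrt (real m))"
      using hermite_norm_1_le s by (intro divide_right_mono) auto
    finally show ?thesis .
  qed
  have hm [measurable]: "?h \<in> borel_measurable M" using m by measurable
  note bnd = integrable_bounded_mult[OF hm le]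
  have sq: "integrable M (\<lambda>\<omega>. (X0 \<omega>)\<^sup>2 / 2 - \<sigma>\<^sup>2 / 2)" using integrable_X0_powers by simp
  have XE: "integrable M (\<lambda>\<omega>. X0 \<omega> * E0 (S r) \<omega>)"
    by (rule E0_integral(1)[OF integrable_X0_S(1)]) measurable
  show "integrable M A" unfolding A_def by (rule bnd) (use sq integrable_X0_S in auto)
  have Zi: "integrable M Z" unfolding Z[abs_def] using integrable_X0_powers G by auto
  have "(\<integral>\<omega>. A \<omega> \<partial>M) = (\<integral>\<omega>. ?h \<omega> * ((X0 \<omega>)\<^sup>2 / 2 - \<sigma>\<^sup>2 / 2) \<partial>M) + (\<integral>\<omega>. (?h \<omega> * X0 \<omega>) * S r \<omega> \<partial>M)"
  proof -
    have "integrable M (\<lambda>\<omega>. (?h \<omega> * X0 \<omega>) * S r \<omega>)"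
      using bnd[OF integrable_X0_S(1)[of r]] by (simp add: mult.assoc)
    from Bochner_Integration.integral_add[OF bnd[OF sq] this]
    show ?thesis by (simp add: A_def distrib_left mult.assoc)
  qed
  also have "(\<integral>\<omega>. (?h \<omega> * X0 \<omega>) * S r \<omega> \<partial>M) = (\<integral>\<omega>. (?h \<omega> * X0 \<omega>) * E0 (S r) \<omega> \<partial>M)"
    by (rule E0_integral(2)) (use bnd[OF integrable_X0_S(1)[of r]] m in \<open>auto simp: mult.assoc\<close>)
  also have "\<dots> = (\<integral>\<omega>. ?h \<omega> * G \<omega> - ?h \<omega> * R \<omega> \<partial>M)"
  proof (rule integral_cong_AE)
    show "AE \<omega> in M. (?h \<omega> * X0 \<omega>) * E0 (S r) \<omega> = ?h \<omega> * G \<omega> - ?h \<omega> * R \<omega>"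
      using GR by eventually_elim (simp add: right_diff_distrib mult.assoc)
  qed (use m in measurable)
  also have "\<dots> = (\<integral>\<omega>. ?h \<omega> * G \<omega> \<partial>M) - (\<integral>\<omega>. ?h \<omega> * R \<omega> \<partial>M)"
    by (intro Bochner_Integration.integral_diff bnd G R)
  also have "(\<integral>\<omega>. ?h \<omega> * ((X0 \<omega>)\<^sup>2 / 2 - \<sigma>\<^sup>2 / 2) \<partial>M) + \<dots>
      = (\<integral>\<omega>. ?h \<omega> * Z \<omega> \<partial>M) / 2 - (\<integral>\<omega>. ?h \<omega> * R \<omega> \<partial>M)"
  proof -
    have "(\<integral>\<omega>. ?h \<omega> * Z \<omega> \<partial>M) / 2 = (\<integral>\<omega>. ?h \<omega> * ((X0 \<omega>)\<^sup>2 / 2 - \<sigma>\<^sup>2 / 2) + ?h \<omega> * G \<omega> \<partial>M)"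
      unfolding integral_divide_zero[symmetric] by (intro Bochner_Integration.integral_cong refl) (simp add: Z field_simps)
    then show ?thesis using bnd[OF sq] bnd[OF G] by simp
  qed
  finally have eq: "(\<integral>\<omega>. A \<omega> \<partial>M) = (\<integral>\<omega>. ?h \<omega> * Z \<omega> \<partial>M) / 2 - (\<integral>\<omega>. ?h \<omega> * R \<omega> \<partial>M)" .
  have "- (\<integral>\<omega>. ?h \<omega> * R \<omega> \<partial>M) \<le> 1 / (\<sigma> * sqrt (real m)) * (\<integral>\<omega>. \<bar>R \<omega>\<bar> \<partial>M)"
  proof -
    have "\<bar>\<integral>\<omega>. ?h \<omega> * R \<omega> \<partial>M\<bar> \<le> (\<integral>\<omega>. 1 / (\<sigma> * sqrt (real m)) * \<bar>R \<omega>\<bar> \<partial>M)"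
    proof (rule abs_expectation_le[OF bnd[OF R]])
      show "\<bar>?h \<omega> * R \<omega>\<bar> \<le> 1 / (\<sigma> * sqrt (real m)) * \<bar>R \<omega>\<bar>" for \<omega>
        unfolding abs_mult by (rule mult_right_mono[OF le]) simp
    qed (use R in auto)
    then show ?thesis by simp
  qed
  then show "(\<integral>\<omega>. A \<omega> \<partial>M) \<le> (\<integral>\<omega>. ?h \<omega> * Z \<omega> \<partial>M) / 2 + 1 / (\<sigma> * sqrt (real m)) * (\<integral>\<omega>. \<bar>R \<omega>\<bar> \<partial>M)"
    unfolding eq by simp
qed

text \<open>
The increment of the telescoped quantity. The identity behind it adds and subtracts
\<open>F\<^sub>m(Q) + X\<^sub>0 F\<^sub>m'(Q) + X\<^sub>0\<^sup>2/2 F\<^sub>m''(Q)\<close> in the function, \<open>F\<^sub>m'(Q) + X\<^sub>0 F\<^sub>m''(Q)\<close> in the derivative, and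
\<open>\<sigma>\<^sup>2/2 F\<^sub>m''(Q)\<close>.
\<close>

lemma lindeberg_step:
  fixes k :: nat
  assumes m: "m = Suc r"
    and G: "integrable M G" and R: "integrable M R"
    and GR: "AE \<omega> in M. R \<omega> = G \<omega> - X0 \<omega> * E0 (S r) \<omega>"
    and Z: "\<And>\<omega>. Z \<omega> = (X0 \<omega>)\<^sup>2 - \<sigma>\<^sup>2 + 2 * G \<omega>"
  defines "Q \<equiv> \<lambda>\<omega>. past_sum (Suc k) \<omega> - X0 \<omega>"
  shows "(\<integral>\<omega>. (D 0 m (past_sum (Suc k) \<omega>) + D (Suc 0) m (past_sum (Suc k) \<omega>) * S r \<omega>)
        - (D 0 (Suc m) (Q \<omega>) + D (Suc 0) (Suc m) (Q \<omega>) * (X0 \<omega> + S r \<omega>)) \<partial>M)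
    \<le> (\<integral>\<omega>. D 2 m (Q \<omega>) * Z \<omega> \<partial>M) / 2
      + 1 / (\<sigma> * sqrt (real m)) * (\<integral>\<omega>. \<bar>R \<omega>\<bar> \<partial>M)
      + (\<integral>\<omega>. \<bar>X0 \<omega>\<bar> ^ 3 \<partial>M) / (6 * \<sigma>\<^sup>2 * real m)
      + hermite_norm 3 * \<sigma> / (8 * (real m * sqrt (real m)))
      + 1 / (2 * real m) * (\<integral>\<omega>. \<bar>E0 (S m) \<omega>\<bar> \<partial>M)
      + 1 / (2 * \<sigma>\<^sup>2 * real m) * (\<integral>\<omega>. (X0 \<omega>)\<^sup>2 * \<bar>E0 (S r) \<omega>\<bar> \<partial>M)"
proof -
  have m1: "1 \<le> m" using m by simp
  have Q0: "Q \<in> borel_measurable M0" unfolding Q_def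
    by (intro borel_measurable_diff past_sum_M0 X0_measurable)
  have Q1: "Q \<in> borel_measurable M" by (rule M0_borel_imp[OF Q0])
  note ta = lindeberg_taylor_term[OF Q1 m1]
  note tb = lindeberg_gauss_term[OF Q1 m1]
  have Qk: "past_sum (Suc k) \<omega> - X0 \<omega> = Q \<omega>" for \<omega> by (simp add: Q_def)
  note tc = lindeberg_drift_term[OF m1 m, of k, unfolded Qk]
  note td = lindeberg_second_taylor_term[OF Q0 m1, of r]
  note te = lindeberg_quadratic_term[OF Q0 m1 G R GR Z]
  let ?a = "\<lambda>\<omega>. D 0 m (Q \<omega> + X0 \<omega>) - D 0 m (Q \<omega>) - X0 \<omega> * D (Suc 0) m (Q \<omega>) - (X0 \<omega>)\<^sup>2 / 2 * D 2 m (Q \<omega>)"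
  let ?b = "\<lambda>\<omega>. D 0 m (Q \<omega>) - D 0 (Suc m) (Q \<omega>) + \<sigma>\<^sup>2 / 2 * D 2 m (Q \<omega>)"
  let ?c = "\<lambda>\<omega>. (D (Suc 0) m (Q \<omega>) - D (Suc 0) (Suc m) (Q \<omega>)) * (X0 \<omega> + S r \<omega>)"
  let ?d = "\<lambda>\<omega>. (D (Suc 0) m (Q \<omega> + X0 \<omega>) - D (Suc 0) m (Q \<omega>) - X0 \<omega> * D 2 m (Q \<omega>)) * S r \<omega>"
  let ?e = "\<lambda>\<omega>. D 2 m (Q \<omega>) * ((X0 \<omega>)\<^sup>2 / 2 - \<sigma>\<^sup>2 / 2 + X0 \<omega> * S r \<omega>)"
  have PQ: "past_sum (Suc k) \<omega> = Q \<omega> + X0 \<omega>" for \<omega> by (simp add: Q_def)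
  have "(\<integral>\<omega>. (D 0 m (past_sum (Suc k) \<omega>) + D (Suc 0) m (past_sum (Suc k) \<omega>) * S r \<omega>)
        - (D 0 (Suc m) (Q \<omega>) + D (Suc 0) (Suc m) (Q \<omega>) * (X0 \<omega> + S r \<omega>)) \<partial>M)
     = (\<integral>\<omega>. ?a \<omega> + (?b \<omega> + (?c \<omega> + (?d \<omega> + ?e \<omega>))) \<partial>M)"
    unfolding PQ by (intro Bochner_Integration.integral_cong refl) (simp add: algebra_simps)
  also have "\<dots> = (\<integral>\<omega>. ?a \<omega> \<partial>M) + ((\<integral>\<omega>. ?b \<omega> \<partial>M) + ((\<integral>\<omega>. ?c \<omega> \<partial>M) + ((\<integral>\<omega>. ?d \<omega> \<partial>M) + (\<integral>\<omega>. ?e \<omega> \<partial>M))))"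
  proof -
    note de = Bochner_Integration.integral_add[OF td(1) te(1)] Bochner_Integration.integrable_add[OF td(1) te(1)]
    note cde = Bochner_Integration.integral_add[OF tc(1) de(2)] Bochner_Integration.integrable_add[OF tc(1) de(2)]
    note bcde = Bochner_Integration.integral_add[OF tb(1) cde(2)] Bochner_Integration.integrable_add[OF tb(1) cde(2)]
    note abcde = Bochner_Integration.integral_add[OF ta(1) bcde(2)]
    show ?thesis unfolding abcde bcde(1) cde(1) de(1) ..
  qed
  finally show ?thesis using ta(2) tb(2) tc(2) td(2) te(2) by linarith
qed

text \<open>
The index \<open>m\<close> runs through \<open>N + 1, ..., N + q\<close>, so time runs backwards from \<open>b = n - N\<close>. Let \<open>C\<^sub>j\<close> be
the sum of the last \<open>j\<close> terms \<open>Z\<close> of the block and \<open>h\<^sub>j\<close> the factor \<open>F''\<close> that multiplies the \<open>j\<close>-th of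
them, counted from the end. Summation by parts gives
\<open>\<Sum>j h\<^sub>j (C\<^sub>j - C\<^bsub>j-1\<^esub>) = h\<^sub>q C\<^sub>q + \<Sum>j<q (h\<^sub>j - h\<^bsub>j+1\<^esub>) C\<^sub>j\<close>. Each factor of \<open>C\<^sub>j\<close> is known at time
\<open>b - j\<close>, just before the first term of \<open>C\<^sub>j\<close>, so that \<open>C\<^sub>j\<close> may be replaced by a shift of \<open>W\<^sub>j\<close>; and
\<open>h\<^sub>j - h\<^bsub>j+1\<^esub>\<close> differs by one step in space and one in the variance.
\<close>

lemma lindeberg_block:
  fixes Z :: "'a \<Rightarrow> real" and n :: nat
  assumes Z: "integrable M Z"
  defines "Zs \<equiv> \<lambda>m \<omega>. \<Sum>l=1..m. Z (iter (int l) \<omega>)"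
  defines "v \<equiv> \<lambda>m. \<integral>\<omega>. D 2 m (past_sum (Suc (n - m)) \<omega> - X0 \<omega>) * Z \<omega> \<partial>M"
  assumes q: "1 \<le> q" "N + q \<le> n"
    and int: "\<And>j. 1 \<le> j \<Longrightarrow> j < q \<Longrightarrow> integrable M (\<lambda>\<omega>. X0 \<omega> * E0 (Zs j) \<omega>)"
  shows "\<bar>\<Sum>j=1..q. v (N + j)\<bar> \<le> hermite_norm (Suc 0) / \<sigma> / sqrt (real (N + q)) * (\<integral>\<omega>. \<bar>E0 (Zs q) \<omega>\<bar> \<partial>M)
     + (\<Sum>j=1..<q. hermite_norm 2 / \<sigma>\<^sup>2 / real (N + j) * (\<integral>\<omega>. \<bar>X0 \<omega> * E0 (Zs j) \<omega>\<bar> \<partial>M)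
         + hermite_norm 3 / (2 * \<sigma>) / (real (N + j) * sqrt (real (N + j))) * (\<integral>\<omega>. \<bar>E0 (Zs j) \<omega>\<bar> \<partial>M))"
proof -
  note X0_measurable [measurable]
  have [measurable]: "Z \<in> borel_measurable M" using Z by simp
  have Zi: "integrable M (\<lambda>\<omega>. Z (iter i \<omega>))" for i using Z by (subst integral_iter(2)) auto
  have Zs: "integrable M (Zs j)" for j unfolding Zs_def by (intro Bochner_Integration.integrable_sum Zi)
  then have [measurable]: "Zs j \<in> borel_measurable M" for j by simp
  have Zsi: "integrable M (\<lambda>\<omega>. Zs j (iter i \<omega>))" for i j using Zs by (subst integral_iter(2)) auto
  define b where "b = n - N"
  have qb: "q \<le> b" using q by (simp add: b_def)
  define h where "h j \<omega> = D 2 (N + j) (S (b - j) \<omega>)" for j \<omega>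
  define C where "C j \<omega> = Zs j (iter (int b - int j) \<omega>)" for j \<omega>
  define w where "w i j = (\<integral>\<omega>. h i \<omega> * C j \<omega> \<partial>M)" for i j
  have bd: "\<bar>D 2 m y\<bar> \<le> hermite_norm (Suc 0) / (\<sigma> * sqrt (real m))" if "1 \<le> m" for m y
    by (rule lindeberg_fun_bound_2[OF f s that])
  have hC: "integrable M (\<lambda>\<omega>. h i \<omega> * C j \<omega>)" if "1 \<le> i" for i j
    unfolding h_def C_def using that
    by (intro integrable_bounded_mult[OF _ bd Zsi]) auto
  have Zrec: "Zs (Suc j) (iter (i - 1) \<omega>) = Z (iter i \<omega>) + Zs j (iter i \<omega>)" if w: "\<omega> \<in> space M" for i j \<omega>
  proof -
    have "Zs (Suc j) (iter (i - 1) \<omega>) = Z (iter (1 + (i - 1)) \<omega>) + (\<Sum>l=Suc 1..Suc j. Z (iter (int l + (i - 1)) \<omega>))"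
      unfolding Zs_def using w by (simp add: iter_add sum.atLeast_Suc_atMost[of "Suc 0" "Suc j"] del: sum.cl_ivl_Suc)
    also have "(\<Sum>l=Suc 1..Suc j. Z (iter (int l + (i - 1)) \<omega>)) = (\<Sum>l=1..j. Z (iter (int (Suc l) + (i - 1)) \<omega>))"
      by (rule sum.shift_bounds_cl_Suc_ivl)
    also have "\<dots> = Zs j (iter i \<omega>)" unfolding Zs_def using w by (intro sum.cong refl) (simp add: iter_add algebra_simps)
    finally show ?thesis by simp
  qed
  have v: "v (N + Suc j) = w (Suc j) (Suc j) - w (Suc j) j" if j: "Suc j \<le> b" for j
  proof -
    let ?k = "b - Suc j"
    have k: "n - (N + Suc j) = ?k" by (simp add: b_def)
    have m1: "1 \<le> N + Suc j" by simp
    have "w (Suc j) (Suc j) - w (Suc j) j = (\<integral>\<omega>. h (Suc j) \<omega> * C (Suc j) \<omega> - h (Suc j) \<omega> * C j \<omega> \<partial>M)"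
      unfolding w_def by (rule Bochner_Integration.integral_diff[symmetric]) (auto intro!: hC)
    also have "\<dots> = (\<integral>\<omega>. D 2 (N + Suc j) (S ?k \<omega>) * Z (iter (int (Suc ?k)) \<omega>) \<partial>M)"
    proof (intro Bochner_Integration.integral_cong refl)
      fix \<omega> assume w: "\<omega> \<in> space M"
      have "C (Suc j) \<omega> - C j \<omega> = Z (iter (int (Suc ?k)) \<omega>)"
        using Zrec[OF w, of j "int b - int j"] j by (simp add: C_def of_nat_diff algebra_simps)
      then show "h (Suc j) \<omega> * C (Suc j) \<omega> - h (Suc j) \<omega> * C j \<omega>
          = D 2 (N + Suc j) (S ?k \<omega>) * Z (iter (int (Suc ?k)) \<omega>)"
        by (simp add: h_def flip: right_diff_distrib)
    qed
    also have "\<dots> = (\<integral>\<omega>. D 2 (N + Suc j) (past_sum (Suc ?k) \<omega> - X0 \<omega>) * Z \<omega> \<partial>M)"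
    proof (rule integral_shift[where i = "- int (Suc ?k)"])
      show "(\<lambda>\<omega>. D 2 (N + Suc j) (S ?k \<omega>) * Z (iter (int (Suc ?k)) \<omega>)) \<in> borel_measurable M"
        using m1 by measurable
    qed (simp add: S_iter_past_Suc iter_add del: of_nat_Suc)
    finally show ?thesis unfolding v_def k by simp
  qed
  \<comment> \<open>\<open>w i j\<close> is the expectation of \<open>h\<^sub>i C\<^sub>j\<close>, so this is summation by parts.\<close>
  have abel: "1 \<le> p \<Longrightarrow> p \<le> b \<Longrightarrow> (\<Sum>j=1..p. v (N + j)) = w p p + (\<Sum>j=1..<p. w j j - w (Suc j) j)" for p
  proof (induction p rule: dec_induct)
    case base
    have "w 1 0 = 0" by (simp add: w_def C_def Zs_def)
    then show ?case using v[of 0] base by simp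
  next
    case (step p)
    then show ?case using v[of p] by (simp add: sum.atLeastLessThan_Suc)
  qed
  have last: "\<bar>w q q\<bar> \<le> hermite_norm (Suc 0) / \<sigma> / sqrt (real (N + q)) * (\<integral>\<omega>. \<bar>E0 (Zs q) \<omega>\<bar> \<partial>M)"
  proof -
    have q1: "1 \<le> N + q" using q by simp
    have "w q q = (\<integral>\<omega>. D 2 (N + q) (past_sum (b - q) \<omega>) * Zs q \<omega> \<partial>M)"
      unfolding w_def
    proof (rule integral_shift[where i = "- int (b - q)"])
      show "(\<lambda>\<omega>. h q \<omega> * C q \<omega>) \<in> borel_measurable M" using hC[OF q(1)] by simp
      fix \<omega> assume w: "\<omega> \<in> space M"
      have "C q (iter (- int (b - q)) \<omega>) = Zs q \<omega>"
        using qb w by (simp add: C_def iter_add of_nat_diff)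
      then show "h q (iter (- int (b - q)) \<omega>) * C q (iter (- int (b - q)) \<omega>) = D 2 (N + q) (past_sum (b - q) \<omega>) * Zs q \<omega>"
        unfolding h_def S_iter_past[OF w] by simp
    qed
    also have "\<bar>\<dots>\<bar> \<le> (\<integral>\<omega>. hermite_norm (Suc 0) / (\<sigma> * sqrt (real (N + q))) * \<bar>E0 (Zs q) \<omega>\<bar> \<partial>M)"
    proof (rule expectation_mult_bound)
      show "(\<lambda>\<omega>. D 2 (N + q) (past_sum (b - q) \<omega>)) \<in> borel_measurable M0"
        by (rule measurable_compose[OF past_sum_M0 D_measurable[OF q1]])
      show "integrable M (\<lambda>\<omega>. D 2 (N + q) (past_sum (b - q) \<omega>) * Zs q \<omega>)"
        using q1 by (intro integrable_bounded_mult[OF _ bd[OF q1] Zs]) measurable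
      show "integrable M (\<lambda>\<omega>. hermite_norm (Suc 0) / (\<sigma> * sqrt (real (N + q))) * \<bar>E0 (Zs q) \<omega>\<bar>)"
        unfolding E0_def by (intro integrable_mult_right integrable_abs real_cond_exp_int Zs)
    qed (use bd[OF q1] in auto)
    finally show ?thesis by simp
  qed
  have mid: "\<bar>w j j - w (Suc j) j\<bar> \<le> hermite_norm 2 / \<sigma>\<^sup>2 / real (N + j) * (\<integral>\<omega>. \<bar>X0 \<omega> * E0 (Zs j) \<omega>\<bar> \<partial>M)
         + hermite_norm 3 / (2 * \<sigma>) / (real (N + j) * sqrt (real (N + j))) * (\<integral>\<omega>. \<bar>E0 (Zs j) \<omega>\<bar> \<partial>M)"
    if j: "1 \<le> j" "j < q" for j
  proof -
    let ?m = "N + j" and ?k = "b - Suc j"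
    have m1: "1 \<le> ?m" "1 \<le> Suc ?m" using j by auto
    let ?g = "\<lambda>\<omega>. D 2 ?m (past_sum (Suc ?k) \<omega>) - D 2 (Suc ?m) (past_sum (Suc ?k) \<omega> - X0 \<omega>)"
    let ?c = "hermite_norm 2 / \<sigma>\<^sup>2 / real ?m" and ?c' = "hermite_norm 3 / (2 * \<sigma>) / (real ?m * sqrt (real ?m))"
    have bj: "b - j = Suc ?k" using j qb by auto
    have le: "\<bar>?g \<omega>\<bar> \<le> ?c * \<bar>X0 \<omega>\<bar> + ?c'" for \<omega>
    proof -
      let ?y = "past_sum (Suc ?k) \<omega> - X0 \<omega>"
      have "\<bar>D 2 ?m (past_sum (Suc ?k) \<omega>) - D 2 ?m ?y\<bar> \<le> ?c * \<bar>X0 \<omega>\<bar>"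
        using lipschitz_real_bound[OF lindeberg_fun_lipschitz(3)[OF f s m1(1)], of "past_sum (Suc ?k) \<omega>" ?y] by simp
      moreover have "\<bar>D 2 (Suc ?m) ?y - D 2 ?m ?y\<bar> \<le> ?c'"
        using lindeberg_fun_step(3)[OF f s m1(1), of ?y] by simp
      ultimately show ?thesis by linarith
    qed
    have w: "w j j - w (Suc j) j = (\<integral>\<omega>. (h j \<omega> - h (Suc j) \<omega>) * C j \<omega> \<partial>M)"
      unfolding w_def left_diff_distrib using j by (intro Bochner_Integration.integral_diff[symmetric] hC) auto
    have shift: "(\<integral>\<omega>. (h j \<omega> - h (Suc j) \<omega>) * C j \<omega> \<partial>M) = (\<integral>\<omega>. ?g \<omega> * Zs j \<omega> \<partial>M)"
    proof (rule integral_shift[where i = "- int (b - j)"])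
      have "integrable M (\<lambda>\<omega>. (h j \<omega> - h (Suc j) \<omega>) * C j \<omega>)"
        unfolding left_diff_distrib using j by (intro Bochner_Integration.integrable_diff hC) auto
      then show "(\<lambda>\<omega>. (h j \<omega> - h (Suc j) \<omega>) * C j \<omega>) \<in> borel_measurable M" by simp
      fix \<omega> assume w: "\<omega> \<in> space M"
      have "C j (iter (- int (b - j)) \<omega>) = Zs j \<omega>"
        using j qb w by (simp add: C_def iter_add of_nat_diff)
      moreover have "h j (iter (- int (b - j)) \<omega>) = D 2 ?m (past_sum (Suc ?k) \<omega>)"
        unfolding h_def bj S_iter_past[OF w] ..
      moreover have "h (Suc j) (iter (- int (b - j)) \<omega>) = D 2 (Suc ?m) (past_sum (Suc ?k) \<omega> - X0 \<omega>)"
        unfolding h_def bj S_iter_past_Suc[OF w] by simp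
      ultimately show "(h j (iter (- int (b - j)) \<omega>) - h (Suc j) (iter (- int (b - j)) \<omega>)) * C j (iter (- int (b - j)) \<omega>)
          = ?g \<omega> * Zs j \<omega>" by simp
    qed
    have "\<bar>w j j - w (Suc j) j\<bar> \<le> (\<integral>\<omega>. (?c * \<bar>X0 \<omega>\<bar> + ?c') * \<bar>E0 (Zs j) \<omega>\<bar> \<partial>M)"
      unfolding w shift
    proof (rule expectation_mult_bound[OF _ le])
      have [measurable]: "D 2 ?m \<in> borel_measurable borel" "D 2 (Suc ?m) \<in> borel_measurable borel"
        by (rule D_measurable m1)+
      have [measurable]: "past_sum (Suc ?k) \<in> borel_measurable M0" by (rule past_sum_M0)
      show g0: "?g \<in> borel_measurable M0" by measurable
      have "\<bar>?g \<omega>\<bar> \<le> hermite_norm (Suc 0) / (\<sigma> * sqrt (real ?m)) + hermite_norm (Suc 0) / (\<sigma> * sqrt (real (Suc ?m)))" for \<omega>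
        using bd[OF m1(1), of "past_sum (Suc ?k) \<omega>"] bd[OF m1(2), of "past_sum (Suc ?k) \<omega> - X0 \<omega>"] by linarith
      then show "integrable M (\<lambda>\<omega>. ?g \<omega> * Zs j \<omega>)"
        by (intro integrable_bounded_mult[OF M0_borel_imp[OF g0] _ Zs])
      have "integrable M (\<lambda>\<omega>. ?c * \<bar>X0 \<omega> * E0 (Zs j) \<omega>\<bar> + ?c' * \<bar>E0 (Zs j) \<omega>\<bar>)"
        using int[OF j] real_cond_exp_int(1)[OF Zs[of j]] unfolding E0_def by auto
      then show "integrable M (\<lambda>\<omega>. (?c * \<bar>X0 \<omega>\<bar> + ?c') * \<bar>E0 (Zs j) \<omega>\<bar>)"
        by (simp add: abs_mult distrib_right mult.assoc)
    qed measurable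
    also have "\<dots> = (\<integral>\<omega>. ?c * \<bar>X0 \<omega> * E0 (Zs j) \<omega>\<bar> + ?c' * \<bar>E0 (Zs j) \<omega>\<bar> \<partial>M)"
      by (intro Bochner_Integration.integral_cong refl) (simp only: abs_mult distrib_right mult.assoc)
    also have "\<dots> = ?c * (\<integral>\<omega>. \<bar>X0 \<omega> * E0 (Zs j) \<omega>\<bar> \<partial>M) + ?c' * (\<integral>\<omega>. \<bar>E0 (Zs j) \<omega>\<bar> \<partial>M)"
      using int[OF j] real_cond_exp_int(1)[OF Zs[of j]] unfolding E0_def by simp
    finally show ?thesis .
  qed
  have "\<bar>\<Sum>j=1..q. v (N + j)\<bar> \<le> \<bar>w q q\<bar> + (\<Sum>j=1..<q. \<bar>w j j - w (Suc j) j\<bar>)"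
    unfolding abel[OF q(1) qb] by (intro order_trans[OF abs_triangle_ineq] add_left_mono sum_abs)
  also have "\<dots> \<le> hermite_norm (Suc 0) / \<sigma> / sqrt (real (N + q)) * (\<integral>\<omega>. \<bar>E0 (Zs q) \<omega>\<bar> \<partial>M)
     + (\<Sum>j=1..<q. hermite_norm 2 / \<sigma>\<^sup>2 / real (N + j) * (\<integral>\<omega>. \<bar>X0 \<omega> * E0 (Zs j) \<omega>\<bar> \<partial>M)
         + hermite_norm 3 / (2 * \<sigma>) / (real (N + j) * sqrt (real (N + j))) * (\<integral>\<omega>. \<bar>E0 (Zs j) \<omega>\<bar> \<partial>M))"
    by (intro add_mono last sum_mono mid) auto
  finally show ?thesis .
qed

end

end

section \<open>Limits in the mean, the long-run variance and the telescoping sum\<close>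

lemma L1_norm_integrable:
  assumes "integrable M h"
  shows "L1_norm M h = ereal (\<integral>\<omega>. \<bar>h \<omega>\<bar> \<partial>M)"
proof -
  have "(\<integral>\<^sup>+\<omega>. ennreal \<bar>h \<omega>\<bar> \<partial>M) = ennreal (\<integral>\<omega>. \<bar>h \<omega>\<bar> \<partial>M)"
    using assms by (intro nn_integral_eq_integral) auto
  moreover have "0 \<le> (\<integral>\<omega>. \<bar>h \<omega>\<bar> \<partial>M)" by (rule integral_nonneg_AE) simp
  ultimately show ?thesis by (simp add: L1_norm_def enn2ereal_ennreal)
qed

lemma L1_norm_not_integrable:
  assumes "h \<in> borel_measurable M" "\<not> integrable M h"
  shows "L1_norm M h = \<infinity>"
proof -
  have "(\<integral>\<^sup>+\<omega>. ennreal \<bar>h \<omega>\<bar> \<partial>M) = \<infinity>"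
    using assms by (simp add: integrable_iff_bounded less_top[symmetric])
  then show ?thesis by (simp add: L1_norm_def)
qed

lemma L1_tendsto_iff:
  "L1_tendsto M f g \<longleftrightarrow> (\<forall>n. integrable M (f n)) \<and> integrable M g
     \<and> (\<lambda>n. \<integral>\<omega>. \<bar>f n \<omega> - g \<omega>\<bar> \<partial>M) \<longlonglongrightarrow> 0"
proof (cases "(\<forall>n. integrable M (f n)) \<and> integrable M g")
  case True
  then have "L1_norm M (\<lambda>\<omega>. f n \<omega> - g \<omega>) = ereal (\<integral>\<omega>. \<bar>f n \<omega> - g \<omega>\<bar> \<partial>M)" for n
    by (intro L1_norm_integrable) auto
  then show ?thesis using True by (simp add: L1_tendsto_def zero_ereal_def)
qed (auto simp: L1_tendsto_def)

text \<open>
This makes the results independent of the representative chosen for a limit.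
\<close>

lemma L1_tendsto_unique:
  assumes "L1_tendsto M f g" "L1_tendsto M f h"
  shows "AE \<omega> in M. g \<omega> = h \<omega>"
proof -
  have g: "\<And>n. integrable M (f n)" "integrable M g" "(\<lambda>n. \<integral>\<omega>. \<bar>f n \<omega> - g \<omega>\<bar> \<partial>M) \<longlonglongrightarrow> 0"
    and h: "integrable M h" "(\<lambda>n. \<integral>\<omega>. \<bar>f n \<omega> - h \<omega>\<bar> \<partial>M) \<longlonglongrightarrow> 0"
    using assms by (auto simp: L1_tendsto_iff)
  have le: "(\<integral>\<omega>. \<bar>g \<omega> - h \<omega>\<bar> \<partial>M) \<le> (\<integral>\<omega>. \<bar>f n \<omega> - g \<omega>\<bar> \<partial>M) + (\<integral>\<omega>. \<bar>f n \<omega> - h \<omega>\<bar> \<partial>M)" for n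
  proof -
    have "(\<integral>\<omega>. \<bar>g \<omega> - h \<omega>\<bar> \<partial>M) \<le> (\<integral>\<omega>. \<bar>f n \<omega> - g \<omega>\<bar> + \<bar>f n \<omega> - h \<omega>\<bar> \<partial>M)"
      using g h by (intro integral_mono) auto
    then show ?thesis using g h by simp
  qed
  have "(\<integral>\<omega>. \<bar>g \<omega> - h \<omega>\<bar> \<partial>M) \<le> 0 + 0"
    by (rule LIMSEQ_le_const[OF tendsto_add[OF g(3) h(2)]]) (use le in auto)
  moreover have "0 \<le> (\<integral>\<omega>. \<bar>g \<omega> - h \<omega>\<bar> \<partial>M)" by (rule integral_nonneg_AE) simp
  ultimately have "(\<integral>\<omega>. \<bar>g \<omega> - h \<omega>\<bar> \<partial>M) = 0" by simp
  moreover have "integrable M (\<lambda>\<omega>. \<bar>g \<omega> - h \<omega>\<bar>)" using g h by auto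
  ultimately have "AE \<omega> in M. \<bar>g \<omega> - h \<omega>\<bar> = 0"
    by (subst integral_nonneg_eq_0_iff_AE[symmetric]) auto
  then show ?thesis by eventually_elim simp
qed

lemma L1_lim_tendsto:
  assumes "L1_convergent M f"
  shows "L1_tendsto M f (L1_lim M f)"
  using assms unfolding L1_convergent_def L1_lim_def by (rule someI_ex)

context stationary_sequence
begin

lemma E0_S: "AE \<omega> in M. E0 (S n) \<omega> = (\<Sum>k=1..n. E0 (X (int k)) \<omega>)"
  unfolding E0_def S_def[abs_def] by (rule real_cond_exp_sum) (rule integrable_powers)

lemma integrable_E0_S_products:
  shows "integrable M (\<lambda>\<omega>. X0 \<omega> * E0 (S n) \<omega>)" "integrable M (\<lambda>\<omega>. (X0 \<omega>)\<^sup>2 * E0 (S n) \<omega>)"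
    "integrable M (E0 (S n))" "integrable M (\<lambda>\<omega>. X0 \<omega> * E0 (X i) \<omega>)"
proof -
  note X0_measurable [measurable]
  show "integrable M (\<lambda>\<omega>. X0 \<omega> * E0 (S n) \<omega>)" by (rule E0_integral(1)[OF integrable_X0_S(1)]) measurable
  show "integrable M (\<lambda>\<omega>. (X0 \<omega>)\<^sup>2 * E0 (S n) \<omega>)" by (rule E0_integral(1)[OF integrable_X0_S(2)]) measurable
  show "integrable M (E0 (S n))" unfolding E0_def by (intro real_cond_exp_int integrable_S)
  show "integrable M (\<lambda>\<omega>. X0 \<omega> * E0 (X i) \<omega>)"
    by (rule E0_integral(1)) (use integrable_powers(3)[of 0 i] in \<open>auto simp: X_0\<close>)
qed

lemma covariance_shift: "(\<integral>\<omega>. X i \<omega> * X j \<omega> \<partial>M) = (\<integral>\<omega>. X0 \<omega> * X (j - i) \<omega> \<partial>M)"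
  by (rule integral_shift[where i = "- i"]) (auto simp: X_iter X_0)

lemma variance_S_Suc:
  "(\<integral>\<omega>. (S (Suc n) \<omega>)\<^sup>2 \<partial>M) = (\<integral>\<omega>. (S n \<omega>)\<^sup>2 \<partial>M)
     + ((\<integral>\<omega>. (X0 \<omega>)\<^sup>2 \<partial>M) + 2 * (\<Sum>k=1..n. \<integral>\<omega>. X0 \<omega> * X (int k) \<omega> \<partial>M))"
proof -
  let ?x = "X (int (Suc n))"
  have i1: "integrable M (\<lambda>\<omega>. (S n \<omega>)\<^sup>2)"
    unfolding S_def power2_eq_square sum_product by (intro Bochner_Integration.integrable_sum integrable_powers)
  have i2: "integrable M (\<lambda>\<omega>. S n \<omega> * ?x \<omega>)"
    unfolding S_def sum_distrib_right by (intro Bochner_Integration.integrable_sum integrable_powers)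
  have i3: "integrable M (\<lambda>\<omega>. ?x \<omega> * ?x \<omega>)" by (rule integrable_powers)
  have "(\<integral>\<omega>. (S (Suc n) \<omega>)\<^sup>2 \<partial>M) = (\<integral>\<omega>. (S n \<omega>)\<^sup>2 + (2 * (S n \<omega> * ?x \<omega>) + ?x \<omega> * ?x \<omega>) \<partial>M)"
    by (intro Bochner_Integration.integral_cong refl) (simp add: S_def power2_eq_square algebra_simps)
  also have "\<dots> = (\<integral>\<omega>. (S n \<omega>)\<^sup>2 \<partial>M) + (2 * (\<integral>\<omega>. S n \<omega> * ?x \<omega> \<partial>M) + (\<integral>\<omega>. ?x \<omega> * ?x \<omega> \<partial>M))"
    using i1 i2 i3 by simp
  also have "(\<integral>\<omega>. ?x \<omega> * ?x \<omega> \<partial>M) = (\<integral>\<omega>. (X0 \<omega>)\<^sup>2 \<partial>M)"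
    unfolding covariance_shift by (simp add: X_0 power2_eq_square)
  also have "(\<integral>\<omega>. S n \<omega> * ?x \<omega> \<partial>M) = (\<Sum>k=1..n. \<integral>\<omega>. X (int k) \<omega> * ?x \<omega> \<partial>M)"
    unfolding S_def sum_distrib_right by (intro Bochner_Integration.integral_sum integrable_powers)
  also have "\<dots> = (\<Sum>k=1..n. \<integral>\<omega>. X0 \<omega> * X (int k) \<omega> \<partial>M)"
    unfolding covariance_shift
    by (rule sum.reindex_bij_witness[where i = "\<lambda>k. Suc n - k" and j = "\<lambda>k. Suc n - k"]) (auto simp: of_nat_diff)
  finally show ?thesis by simp
qed

text \<open>
The limit exists because \<open>E(X\<^sub>0 S\<^sub>n) = E(X\<^sub>0 E\<^sub>0(S\<^sub>n))\<close>. It is nonnegative since the \<open>n\<close>-th partial sum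
is the increment of the variance from \<open>S\<^sub>n\<close> to \<open>S\<^bsub>n+1\<^esub>\<close>: a negative limit would drive the variances to
minus infinity.
\<close>

lemma long_run_variance:
  assumes G: "L1_tendsto M (\<lambda>n \<omega>. X0 \<omega> * E0 (S n) \<omega>) G"
  defines "v \<equiv> (\<integral>\<omega>. (X0 \<omega>)\<^sup>2 \<partial>M) + 2 * (\<integral>\<omega>. G \<omega> \<partial>M)"
  defines "a \<equiv> \<lambda>K. (\<integral>\<omega>. (X0 \<omega>)\<^sup>2 \<partial>M) + 2 * (\<Sum>k=1..K. \<integral>\<omega>. X0 \<omega> * X (int k) \<omega> \<partial>M)"
  shows "a \<longlonglongrightarrow> v" "0 \<le> v"
proof -
  have cov: "(\<Sum>k=1..K. \<integral>\<omega>. X0 \<omega> * X (int k) \<omega> \<partial>M) = (\<integral>\<omega>. X0 \<omega> * E0 (S K) \<omega> \<partial>M)" for K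
  proof -
    have "(\<integral>\<omega>. X0 \<omega> * S K \<omega> \<partial>M) = (\<Sum>k=1..K. \<integral>\<omega>. X0 \<omega> * X (int k) \<omega> \<partial>M)"
      unfolding S_def sum_distrib_left
      by (intro Bochner_Integration.integral_sum) (use integrable_powers(3)[of 0] in \<open>simp add: X_0\<close>)
    moreover have "(\<integral>\<omega>. X0 \<omega> * S K \<omega> \<partial>M) = (\<integral>\<omega>. X0 \<omega> * E0 (S K) \<omega> \<partial>M)"
      by (rule E0_integral(2)) (auto intro: X0_measurable integrable_X0_S)
    ultimately show ?thesis by simp
  qed
  have Gi: "integrable M G" and G0: "(\<lambda>n. \<integral>\<omega>. \<bar>X0 \<omega> * E0 (S n) \<omega> - G \<omega>\<bar> \<partial>M) \<longlonglongrightarrow> 0"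
    using G by (auto simp: L1_tendsto_iff)
  have "(\<lambda>n. (\<integral>\<omega>. X0 \<omega> * E0 (S n) \<omega> \<partial>M) - (\<integral>\<omega>. G \<omega> \<partial>M)) \<longlonglongrightarrow> 0"
  proof (rule Lim_null_comparison[OF _ G0], intro always_eventually allI)
    fix n
    have "(\<integral>\<omega>. X0 \<omega> * E0 (S n) \<omega> \<partial>M) - (\<integral>\<omega>. G \<omega> \<partial>M) = (\<integral>\<omega>. X0 \<omega> * E0 (S n) \<omega> - G \<omega> \<partial>M)"
      using Gi integrable_E0_S_products by simp
    then show "norm ((\<integral>\<omega>. X0 \<omega> * E0 (S n) \<omega> \<partial>M) - (\<integral>\<omega>. G \<omega> \<partial>M)) \<le> (\<integral>\<omega>. \<bar>X0 \<omega> * E0 (S n) \<omega> - G \<omega>\<bar> \<partial>M)"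
      using integral_abs_bound[of M "\<lambda>\<omega>. X0 \<omega> * E0 (S n) \<omega> - G \<omega>"] by simp
  qed
  then have lim: "(\<lambda>n. \<integral>\<omega>. X0 \<omega> * E0 (S n) \<omega> \<partial>M) \<longlonglongrightarrow> (\<integral>\<omega>. G \<omega> \<partial>M)"
    by (rule LIM_zero_cancel)
  show lima: "a \<longlonglongrightarrow> v" unfolding a_def v_def cov by (intro tendsto_intros lim)
  show "0 \<le> v"
  proof (rule ccontr)
    assume "\<not> 0 \<le> v"
    then have v: "v < v / 2" "v / 2 < 0" by auto
    from order_tendstoD(2)[OF lima v(1)] obtain n0 where n0: "\<And>n. n0 \<le> n \<Longrightarrow> a n < v / 2"
      by (auto simp: eventually_sequentially)
    define s where "s n = (\<integral>\<omega>. (S n \<omega>)\<^sup>2 \<partial>M)" for n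
    have ss: "s (Suc n) = s n + a n" for n unfolding s_def a_def by (rule variance_S_Suc)
    have le: "s (n0 + k) \<le> s n0 + real k * (v / 2)" for k
    proof (induction k)
      case (Suc k)
      have "real (Suc k) * (v / 2) = real k * (v / 2) + v / 2" by (simp add: distrib_right add.commute)
      with Suc ss[of "n0 + k"] n0[of "n0 + k"] show ?case unfolding add_Suc_right by linarith
    qed simp
    obtain k where "s n0 < real k * (- (v / 2))"
      using reals_Archimedean3[of "- (v / 2)"] v by auto
    then have "s (n0 + k) < 0" using le[of k] by (simp add: algebra_simps)
    moreover have "0 \<le> s (n0 + k)" unfolding s_def by (rule integral_nonneg_AE) simp
    ultimately show False by simp
  qed
qed

text \<open>
The partial sums of the tail are \<open>X\<^sub>0 E\<^sub>0(S\<^sub>K) - X\<^sub>0 E\<^sub>0(S\<^sub>r)\<close> almost everywhere.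
\<close>

lemma projective_tail:
  assumes G: "L1_tendsto M (\<lambda>n \<omega>. X0 \<omega> * E0 (S n) \<omega>) G"
  shows "L1_tendsto M (\<lambda>K \<omega>. \<Sum>l=Suc r..K. X0 \<omega> * E0 (X (int l)) \<omega>) (\<lambda>\<omega>. G \<omega> - X0 \<omega> * E0 (S r) \<omega>)"
  unfolding L1_tendsto_iff
proof (intro conjI allI)
  have Gi: "integrable M G" and G0: "(\<lambda>n. \<integral>\<omega>. \<bar>X0 \<omega> * E0 (S n) \<omega> - G \<omega>\<bar> \<partial>M) \<longlonglongrightarrow> 0"
    using G by (auto simp: L1_tendsto_iff)
  show i1: "integrable M (\<lambda>\<omega>. \<Sum>l=Suc r..K. X0 \<omega> * E0 (X (int l)) \<omega>)" for K
    by (intro Bochner_Integration.integrable_sum integrable_E0_S_products)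
  show i2: "integrable M (\<lambda>\<omega>. G \<omega> - X0 \<omega> * E0 (S r) \<omega>)"
    by (intro Bochner_Integration.integrable_diff Gi integrable_E0_S_products)
  have "eventually (\<lambda>K. (\<integral>\<omega>. \<bar>X0 \<omega> * E0 (S K) \<omega> - G \<omega>\<bar> \<partial>M)
     = (\<integral>\<omega>. \<bar>(\<Sum>l=Suc r..K. X0 \<omega> * E0 (X (int l)) \<omega>) - (G \<omega> - X0 \<omega> * E0 (S r) \<omega>)\<bar> \<partial>M)) sequentially"
    using eventually_ge_at_top[of r]
  proof eventually_elim
    case (elim K)
    have un: "{1..K} = {1..r} \<union> {Suc r..K}" "{1..r} \<inter> {Suc r..K} = {}" using elim by auto
    have "AE \<omega> in M. X0 \<omega> * E0 (S K) \<omega> - G \<omega>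
       = (\<Sum>l=Suc r..K. X0 \<omega> * E0 (X (int l)) \<omega>) - (G \<omega> - X0 \<omega> * E0 (S r) \<omega>)"
      using E0_S[of K] E0_S[of r]
    proof eventually_elim
      case (elim \<omega>)
      have "(\<Sum>k=1..K. E0 (X (int k)) \<omega>) = (\<Sum>k=1..r. E0 (X (int k)) \<omega>) + (\<Sum>k=Suc r..K. E0 (X (int k)) \<omega>)"
        unfolding un(1) by (rule sum.union_disjoint) (use un(2) in auto)
      then show ?case using elim by (simp add: sum_distrib_left[symmetric] distrib_left)
    qed
    then show ?case
      using Gi by (intro integral_cong_AE) (auto elim!: eventually_mono)
  qed
  from Lim_transform_eventually[OF G0 this]
  show "(\<lambda>K. \<integral>\<omega>. \<bar>(\<Sum>l=Suc r..K. X0 \<omega> * E0 (X (int l)) \<omega>) - (G \<omega> - X0 \<omega> * E0 (S r) \<omega>)\<bar> \<partial>M) \<longlonglongrightarrow> 0" .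
qed

context
  fixes f :: "real \<Rightarrow> real" and \<sigma> :: real
  assumes f: "1-lipschitz_on UNIV f" and s: "0 < \<sigma>"
begin

text \<open>
In \<open>\<tau> k\<close> the first \<open>k\<close> terms are those of the sequence and the others are Gaussian. The correction
\<open>F' (S\<^sub>n - S\<^sub>k)\<close> vanishes at \<open>k = n\<close> and has mean zero at \<open>k = 0\<close>, because the sequence is centered.
\<close>

lemma lindeberg_telescope:
  assumes n: "1 \<le> n"
    and step: "\<And>m r. m = Suc r \<Longrightarrow> m \<le> n \<Longrightarrow>
      (\<integral>\<omega>. (D f \<sigma> 0 m (past_sum (Suc (n - m)) \<omega>) + D f \<sigma> (Suc 0) m (past_sum (Suc (n - m)) \<omega>) * S r \<omega>)
        - (D f \<sigma> 0 (Suc m) (past_sum (Suc (n - m)) \<omega> - X0 \<omega>)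
           + D f \<sigma> (Suc 0) (Suc m) (past_sum (Suc (n - m)) \<omega> - X0 \<omega>) * (X0 \<omega> + S r \<omega>)) \<partial>M) \<le> b m"
  shows "(\<integral>\<omega>. f (S n \<omega>) \<partial>M) - smoothing 0 (\<sigma> * sqrt (real n)) f 0
     \<le> 2 * \<sigma> * hermite_norm (Suc 0) + (\<Sum>m=1..n. b m)"
proof -
  define \<tau> where "\<tau> k \<omega> = D f \<sigma> 0 (Suc n - k) (S k \<omega>) + D f \<sigma> (Suc 0) (Suc n - k) (S k \<omega>) * (S n \<omega> - S k \<omega>)" for k \<omega>
  have int0: "integrable M (\<lambda>\<omega>. D f \<sigma> 0 (Suc n - k) (S k \<omega>))" if "k \<le> n" for k
    using that by (intro integrable_lipschitz_comp[OF lindeberg_fun_lipschitz(1)[OF f s]] integrable_S) auto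
  have int1: "integrable M (\<lambda>\<omega>. D f \<sigma> (Suc 0) (Suc n - k) (S k \<omega>) * (S n \<omega> - S k \<omega>))" if "k \<le> n" for k
  proof -
    have m: "1 \<le> Suc n - k" using that by simp
    have [measurable]: "D f \<sigma> (Suc 0) (Suc n - k) \<in> borel_measurable borel" by (rule lindeberg_fun_measurable[OF f s m])
    show ?thesis
      by (rule integrable_bounded_mult[OF _ lindeberg_fun_bound_1[OF f s m]]) (auto intro: integrable_S)
  qed
  have int: "integrable M (\<tau> k)" if "k \<le> n" for k
    unfolding \<tau>_def using int0[OF that] int1[OF that] by auto
  have diff: "(\<integral>\<omega>. \<tau> (Suc k) \<omega> \<partial>M) - (\<integral>\<omega>. \<tau> k \<omega> \<partial>M) \<le> b (n - k)" if k: "k < n" for k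
  proof -
    let ?m = "n - k" and ?r = "n - Suc k"
    have m: "?m = Suc ?r" "?m \<le> n" "n - ?m = k" "Suc n - Suc k = ?m" "Suc n - k = Suc ?m" using k by auto
    have "(\<integral>\<omega>. \<tau> (Suc k) \<omega> \<partial>M) - (\<integral>\<omega>. \<tau> k \<omega> \<partial>M) = (\<integral>\<omega>. \<tau> (Suc k) \<omega> - \<tau> k \<omega> \<partial>M)"
      using k by (intro Bochner_Integration.integral_diff[symmetric] int) auto
    also have "\<dots> = (\<integral>\<omega>. (D f \<sigma> 0 ?m (past_sum (Suc (n - ?m)) \<omega>) + D f \<sigma> (Suc 0) ?m (past_sum (Suc (n - ?m)) \<omega>) * S ?r \<omega>)
        - (D f \<sigma> 0 (Suc ?m) (past_sum (Suc (n - ?m)) \<omega> - X0 \<omega>)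
           + D f \<sigma> (Suc 0) (Suc ?m) (past_sum (Suc (n - ?m)) \<omega> - X0 \<omega>) * (X0 \<omega> + S ?r \<omega>)) \<partial>M)"
    proof (rule integral_shift[where i = "- int (Suc k)"])
      have "integrable M (\<lambda>\<omega>. \<tau> (Suc k) \<omega> - \<tau> k \<omega>)"
        using k by (intro Bochner_Integration.integrable_diff int) auto
      then show "(\<lambda>\<omega>. \<tau> (Suc k) \<omega> - \<tau> k \<omega>) \<in> borel_measurable M" by simp
      fix \<omega> assume w: "\<omega> \<in> space M"
      let ?w = "iter (- int (Suc k)) \<omega>"
      have e1: "S (Suc k) ?w = past_sum (Suc k) \<omega>" by (rule S_iter_past[OF w])
      have e2: "S k ?w = past_sum (Suc k) \<omega> - X0 \<omega>" by (rule S_iter_past_Suc[OF w])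
      have e3: "S n ?w - past_sum (Suc k) \<omega> = S ?r \<omega>" using S_iter_future[OF w, of "Suc k" n] k e1 by simp
      then have e4: "S n ?w - (past_sum (Suc k) \<omega> - X0 \<omega>) = X0 \<omega> + S ?r \<omega>" by simp
      show "\<tau> (Suc k) ?w - \<tau> k ?w = (D f \<sigma> 0 ?m (past_sum (Suc (n - ?m)) \<omega>) + D f \<sigma> (Suc 0) ?m (past_sum (Suc (n - ?m)) \<omega>) * S ?r \<omega>)
        - (D f \<sigma> 0 (Suc ?m) (past_sum (Suc (n - ?m)) \<omega> - X0 \<omega>)
           + D f \<sigma> (Suc 0) (Suc ?m) (past_sum (Suc (n - ?m)) \<omega> - X0 \<omega>) * (X0 \<omega> + S ?r \<omega>))"
        unfolding \<tau>_def m(3,4,5) e1 e2 e3 e4 ..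
    qed
    also have "\<dots> \<le> b ?m" by (rule step[OF m(1,2)])
    finally show ?thesis .
  qed
  have "(\<integral>\<omega>. \<tau> n \<omega> \<partial>M) - (\<integral>\<omega>. \<tau> 0 \<omega> \<partial>M) = (\<Sum>k<n. (\<integral>\<omega>. \<tau> (Suc k) \<omega> \<partial>M) - (\<integral>\<omega>. \<tau> k \<omega> \<partial>M))"
    by (rule sum_lessThan_telescope[symmetric])
  also have "\<dots> \<le> (\<Sum>k<n. b (n - k))" by (intro sum_mono diff) auto
  also have "\<dots> = (\<Sum>m=1..n. b m)"
    by (rule sum.reindex_bij_witness[where i = "\<lambda>m. n - m" and j = "\<lambda>k. n - k"]) auto
  finally have tel: "(\<integral>\<omega>. \<tau> n \<omega> \<partial>M) - (\<integral>\<omega>. \<tau> 0 \<omega> \<partial>M) \<le> (\<Sum>m=1..n. b m)" .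
  have S0: "S 0 \<omega> = 0" for \<omega> by (simp add: S_def)
  have t0: "(\<integral>\<omega>. \<tau> 0 \<omega> \<partial>M) = D f \<sigma> 0 (Suc n) 0"
    using integrable_S[of n] by (simp add: \<tau>_def S0 expectation_S prob_space)
  have tn: "(\<integral>\<omega>. \<tau> n \<omega> \<partial>M) = (\<integral>\<omega>. D f \<sigma> 0 1 (S n \<omega>) \<partial>M)" by (simp add: \<tau>_def)
  have fi: "integrable M (\<lambda>\<omega>. f (S n \<omega>))" by (rule integrable_lipschitz_comp[OF f integrable_S])
  have Di: "integrable M (\<lambda>\<omega>. D f \<sigma> 0 1 (S n \<omega>))" using int0[of n] by simp
  have "(\<integral>\<omega>. f (S n \<omega>) \<partial>M) - (\<integral>\<omega>. D f \<sigma> 0 1 (S n \<omega>) \<partial>M) = (\<integral>\<omega>. f (S n \<omega>) - D f \<sigma> 0 1 (S n \<omega>) \<partial>M)"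
    using fi Di by simp
  moreover have "\<bar>\<integral>\<omega>. f (S n \<omega>) - D f \<sigma> 0 1 (S n \<omega>) \<partial>M\<bar> \<le> (\<integral>\<omega>. \<sigma> * hermite_norm (Suc 0) \<partial>M)"
    by (rule abs_expectation_le) (use fi Di lindeberg_fun_endpoints(1)[OF f s] in \<open>auto simp: abs_minus_commute\<close>)
  moreover have "\<bar>D f \<sigma> 0 (Suc n) 0 - smoothing 0 (\<sigma> * sqrt (real n)) f 0\<bar> \<le> \<sigma> * hermite_norm (Suc 0)"
    by (rule lindeberg_fun_endpoints(2)[OF f s n])
  ultimately show ?thesis using tel unfolding t0 tn by (simp add: prob_space)
qed

end

end

section \<open>The bound for the Wasserstein distance\<close>

context stationary_sequence
begin

text \<open>
Summation of the steps, for a fixed test function and with all norms finite. The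
\<open>X\<^sub>0\<^sup>2 E\<^sub>0(S\<^bsub>m-1\<^esub>)\<close> terms are moved by one index to match those in \<open>E\<^sub>0(S\<^sub>m)\<close>, which only increases
their weights.
\<close>

lemma mean_clt_bound:
  fixes f :: "real \<Rightarrow> real" and \<sigma> :: real and Z :: "'a \<Rightarrow> real" and R :: "nat \<Rightarrow> 'a \<Rightarrow> real"
  assumes f: "1-lipschitz_on UNIV f" and s: "0 < \<sigma>" and n: "1 \<le> n"
    and G: "integrable M G"
    and R: "\<And>r. integrable M (R (Suc r))"
    and GR: "\<And>r. AE \<omega> in M. R (Suc r) \<omega> = G \<omega> - X0 \<omega> * E0 (S r) \<omega>"
    and Z: "\<And>\<omega>. Z \<omega> = (X0 \<omega>)\<^sup>2 - \<sigma>\<^sup>2 + 2 * G \<omega>"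
    and W: "\<And>m. W m = E0 (\<lambda>\<omega>. \<Sum>l=1..m. Z (iter (int l) \<omega>))"
    and int: "\<And>j. 1 \<le> j \<Longrightarrow> j \<le> nat \<lfloor>sqrt (2 * real n)\<rfloor> \<Longrightarrow> integrable M (\<lambda>\<omega>. X0 \<omega> * W j \<omega>)"
  shows "(\<integral>\<omega>. f (S n \<omega>) \<partial>M) - smoothing 0 (\<sigma> * sqrt (real n)) f 0
    \<le> 13 * \<sigma> / 6 + (\<integral>\<omega>. \<bar>X0 \<omega>\<bar> ^ 3 \<partial>M) / \<sigma>\<^sup>2 / 6 * ln (1 + 2 * real n)
      + (\<Sum>m=1..nat \<lfloor>sqrt (2 * real n)\<rfloor>. ((\<integral>\<omega>. \<bar>X0 \<omega> * W m \<omega>\<bar> \<partial>M) + 2 * \<sigma> * (\<integral>\<omega>. \<bar>W m \<omega>\<bar> \<partial>M)) / (real m * \<sigma>\<^sup>2))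
      + ((\<Sum>m=1..n. 1 / (\<sigma> * sqrt (real m)) * (\<integral>\<omega>. \<bar>R m \<omega>\<bar> \<partial>M))
        + (\<Sum>m=1..n. 1 / (2 * real m) * (\<integral>\<omega>. \<bar>(1 + (X0 \<omega>)\<^sup>2 / \<sigma>\<^sup>2) * E0 (S m) \<omega>\<bar> \<partial>M)))"
proof -
  define L where "L = (\<integral>\<omega>. \<bar>X0 \<omega>\<bar> ^ 3 \<partial>M)"
  define v where "v m = (\<integral>\<omega>. D f \<sigma> 2 m (past_sum (Suc (n - m)) \<omega> - X0 \<omega>) * Z \<omega> \<partial>M)" for m
  define rho where "rho m = (\<integral>\<omega>. \<bar>R m \<omega>\<bar> \<partial>M)" for m
  define e where "e m = (\<integral>\<omega>. \<bar>E0 (S m) \<omega>\<bar> \<partial>M)" for m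
  define g where "g m = (\<integral>\<omega>. (X0 \<omega>)\<^sup>2 * \<bar>E0 (S m) \<omega>\<bar> \<partial>M)" for m
  define A where "A m = (\<integral>\<omega>. \<bar>X0 \<omega> * W m \<omega>\<bar> \<partial>M)" for m
  define B where "B m = (\<integral>\<omega>. \<bar>W m \<omega>\<bar> \<partial>M)" for m
  define b where "b m = v m / 2 + 1 / (\<sigma> * sqrt (real m)) * rho m + L / (6 * \<sigma>\<^sup>2 * real m)
      + hermite_norm 3 * \<sigma> / (8 * (real m * sqrt (real m))) + 1 / (2 * real m) * e m
      + 1 / (2 * \<sigma>\<^sup>2 * real m) * g (m - 1)" for m
  have nonneg: "0 \<le> L" "0 \<le> A m" "0 \<le> B m" "0 \<le> g m" "0 \<le> e m" for m
    unfolding L_def A_def B_def g_def e_def by (rule integral_nonneg_AE; simp)+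
  have Zi: "integrable M Z" unfolding Z[abs_def] using integrable_X0_powers G by auto
  have main: "(\<integral>\<omega>. f (S n \<omega>) \<partial>M) - smoothing 0 (\<sigma> * sqrt (real n)) f 0
     \<le> 2 * \<sigma> * hermite_norm (Suc 0) + (\<Sum>m=1..n. b m)"
  proof (rule lindeberg_telescope[OF f s n])
    fix m r assume m: "m = Suc r" "m \<le> n"
    have "integrable M (R m)" "AE \<omega> in M. R m \<omega> = G \<omega> - X0 \<omega> * E0 (S r) \<omega>"
      using R GR m by auto
    from lindeberg_step[OF f s m(1) G this Z, of "n - m"] m(1)
    show "(\<integral>\<omega>. (D f \<sigma> 0 m (past_sum (Suc (n - m)) \<omega>) + D f \<sigma> (Suc 0) m (past_sum (Suc (n - m)) \<omega>) * S r \<omega>)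
        - (D f \<sigma> 0 (Suc m) (past_sum (Suc (n - m)) \<omega> - X0 \<omega>)
           + D f \<sigma> (Suc 0) (Suc m) (past_sum (Suc (n - m)) \<omega> - X0 \<omega>) * (X0 \<omega> + S r \<omega>)) \<partial>M) \<le> b m"
      unfolding b_def v_def rho_def L_def e_def g_def by simp
  qed
  have c1: "0 \<le> hermite_norm (Suc 0)" "hermite_norm (Suc 0) \<le> 817 / 1000"
    and c2: "0 \<le> hermite_norm 2" "hermite_norm 2 \<le> 1"
    and c3: "0 \<le> hermite_norm 3" "hermite_norm 3 \<le> 1559 / 1000"
    using hermite_norm_nonneg hermite_norm_1_le hermite_norm_2_le hermite_norm_3_le by auto
  have sv: "(\<Sum>m=1..n. v m) / 2 \<le> (\<Sum>m=1..nat \<lfloor>sqrt (2 * real n)\<rfloor>. (A m + 2 * \<sigma> * B m) / (real m * \<sigma>\<^sup>2))"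
  proof -
    let ?V = "\<lambda>N. \<Sum>j=1..N. v j"
    let ?e1 = "hermite_norm (Suc 0) / \<sigma>" and ?e2 = "hermite_norm 2 / \<sigma>\<^sup>2" and ?e3 = "hermite_norm 3 / (2 * \<sigma>)"
    have "\<bar>?V n\<bar> \<le> (\<Sum>m=1..nat \<lfloor>sqrt (2 * real n)\<rfloor>. (2 * ?e2 * A m + (2 * sqrt 2 * ?e1 + 2 * ?e3) * B m) / real m)"
    proof (rule triangular_blocks_bound)
      fix N q assume q: "1 \<le> q" "q \<le> nat \<lfloor>sqrt (2 * real n)\<rfloor>" "N + q \<le> n"
      have "?V (N + q) = ?V N + (\<Sum>j=N+1..N+q. v j)" by (rule sum.ub_add_nat) simp
      also have "(\<Sum>j=N+1..N+q. v j) = (\<Sum>j=1..q. v (N + j))"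
        using sum.shift_bounds_cl_nat_ivl[of v 1 N q] by (simp add: add.commute)
      finally have V: "?V (N + q) - ?V N = (\<Sum>j=1..q. v (N + j))" by simp
      have ij: "integrable M (\<lambda>\<omega>. X0 \<omega> * E0 (\<lambda>\<omega>. \<Sum>l=1..j. Z (iter (int l) \<omega>)) \<omega>)" if "1 \<le> j" "j < q" for j
        using int[of j] that q(2) unfolding W by simp
      show "\<bar>?V (N + q) - ?V N\<bar> \<le> ?e1 / sqrt (real (N + q)) * B q
        + (\<Sum>j=1..<q. ?e2 / real (N + j) * A j + ?e3 / (real (N + j) * sqrt (real (N + j))) * B j)"
        unfolding V unfolding v_def A_def B_def W by (rule lindeberg_block[OF f s Zi q(1,3) ij])
    qed (use c1 c2 c3 s nonneg in auto)
    also have "\<dots> \<le> (\<Sum>m=1..nat \<lfloor>sqrt (2 * real n)\<rfloor>. 2 * ((A m + 2 * \<sigma> * B m) / (real m * \<sigma>\<^sup>2)))"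
    proof (rule sum_mono)
      fix m assume "m \<in> {1..nat \<lfloor>sqrt (2 * real n)\<rfloor>}"
      have "sqrt 2 * hermite_norm (Suc 0) \<le> 1415 / 1000 * (817 / 1000)"
        using c1 by (intro mult_mono real_le_lsqrt) (auto simp: power2_eq_square)
      then have c: "2 * sqrt 2 * hermite_norm (Suc 0) + hermite_norm 3 \<le> 4" using c3 by simp
      have "2 * ?e2 * A m + (2 * sqrt 2 * ?e1 + 2 * ?e3) * B m
          = 2 * hermite_norm 2 * A m / \<sigma>\<^sup>2 + (2 * sqrt 2 * hermite_norm (Suc 0) + hermite_norm 3) * B m / \<sigma>"
        using s by (simp add: field_simps)
      also have "\<dots> \<le> 2 * 1 * A m / \<sigma>\<^sup>2 + 4 * B m / \<sigma>"
        using c c2 s nonneg by (intro add_mono divide_right_mono mult_right_mono mult_left_mono) auto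
      also have "\<dots> = 2 * ((A m + 2 * \<sigma> * B m) / \<sigma>\<^sup>2)"
        using s by (simp add: field_simps power2_eq_square)
      finally have "(2 * ?e2 * A m + (2 * sqrt 2 * ?e1 + 2 * ?e3) * B m) / real m
          \<le> 2 * ((A m + 2 * \<sigma> * B m) / \<sigma>\<^sup>2) / real m" by (rule divide_right_mono) simp
      then show "(2 * ?e2 * A m + (2 * sqrt 2 * ?e1 + 2 * ?e3) * B m) / real m
          \<le> 2 * ((A m + 2 * \<sigma> * B m) / (real m * \<sigma>\<^sup>2))" by (simp add: mult.commute)
    qed
    finally show ?thesis unfolding sum_distrib_left[symmetric] by simp
  qed
  have sL: "(\<Sum>m=1..n. L / (6 * \<sigma>\<^sup>2 * real m)) \<le> L / \<sigma>\<^sup>2 / 6 * ln (1 + 2 * real n)"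
  proof -
    have "(\<Sum>m=1..n. L / (6 * \<sigma>\<^sup>2 * real m)) = L / \<sigma>\<^sup>2 / 6 * (\<Sum>m=1..n. 1 / real m)"
      unfolding sum_distrib_left by (intro sum.cong refl) (simp add: field_simps)
    also have "\<dots> \<le> L / \<sigma>\<^sup>2 / 6 * ln (1 + 2 * real n)"
      using nonneg by (intro mult_left_mono harmonic_le_ln) auto
    finally show ?thesis .
  qed
  have sg: "2 * \<sigma> * hermite_norm (Suc 0) + (\<Sum>m=1..n. hermite_norm 3 * \<sigma> / (8 * (real m * sqrt (real m)))) \<le> 13 * \<sigma> / 6"
  proof -
    have "(\<Sum>m=1..n. hermite_norm 3 * \<sigma> / (8 * (real m * sqrt (real m))))
        = \<sigma> / 8 * (hermite_norm 3 * (\<Sum>m=1..n. 1 / (real m * sqrt (real m))))"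
      unfolding sum_distrib_left by (intro sum.cong refl) simp
    also have "\<dots> \<le> \<sigma> / 8 * (1559 / 1000 * (2634 / 1000))"
      using s c3 by (intro mult_left_mono mult_mono sum_inverse_sqrt_cube_le) (auto intro!: sum_nonneg)
    finally have "(\<Sum>m=1..n. hermite_norm 3 * \<sigma> / (8 * (real m * sqrt (real m)))) \<le> \<sigma> / 8 * (1559 / 1000 * (2634 / 1000))" .
    moreover have "2 * \<sigma> * hermite_norm (Suc 0) \<le> 2 * \<sigma> * (817 / 1000)"
      using s c1 by (intro mult_left_mono) auto
    ultimately show ?thesis using s by linarith
  qed
  have se: "(\<Sum>m=1..n. 1 / (2 * real m) * e m) + (\<Sum>m=1..n. 1 / (2 * \<sigma>\<^sup>2 * real m) * g (m - 1))
     \<le> (\<Sum>m=1..n. 1 / (2 * real m) * (\<integral>\<omega>. \<bar>(1 + (X0 \<omega>)\<^sup>2 / \<sigma>\<^sup>2) * E0 (S m) \<omega>\<bar> \<partial>M))"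
  proof -
    \<comment> \<open>The empty sum \<open>S\<^sub>0\<close> is predicted by 0, so the term \<open>m = 1\<close> drops out.\<close>
    have g0: "g 0 = 0"
    proof -
      have "AE \<omega> in M. (X0 \<omega>)\<^sup>2 * \<bar>E0 (S 0) \<omega>\<bar> = 0"
        using E0_S[of 0] by eventually_elim simp
      then show ?thesis unfolding g_def using integral_cong_AE[of "\<lambda>\<omega>. (X0 \<omega>)\<^sup>2 * \<bar>E0 (S 0) \<omega>\<bar>" M "\<lambda>\<omega>. 0"] by simp
    qed
    have "(\<Sum>m=1..n. 1 / (2 * \<sigma>\<^sup>2 * real m) * g (m - 1)) = (\<Sum>r=0..n-1. 1 / (2 * \<sigma>\<^sup>2 * real (Suc r)) * g r)"
      using n by (intro sum.reindex_bij_witness[where i = Suc and j = "\<lambda>m. m - 1"]) auto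
    also have "\<dots> = (\<Sum>r=1..n-1. 1 / (2 * \<sigma>\<^sup>2 * real (Suc r)) * g r)"
      by (rule sum.mono_neutral_right) (auto simp: g0 not_less_eq_eq)
    also have "\<dots> \<le> (\<Sum>r=1..n-1. 1 / (2 * \<sigma>\<^sup>2 * real r) * g r)"
      using nonneg s by (intro sum_mono mult_right_mono divide_left_mono mult_left_mono mult_pos_pos) auto
    also have "\<dots> \<le> (\<Sum>r=1..n. 1 / (2 * \<sigma>\<^sup>2 * real r) * g r)"
      using nonneg by (intro sum_mono2) auto
    finally have "(\<Sum>m=1..n. 1 / (2 * real m) * e m) + (\<Sum>m=1..n. 1 / (2 * \<sigma>\<^sup>2 * real m) * g (m - 1))
      \<le> (\<Sum>m=1..n. 1 / (2 * real m) * e m + 1 / (2 * \<sigma>\<^sup>2 * real m) * g m)" by (simp add: sum.distrib)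
    also have "\<dots> = (\<Sum>m=1..n. 1 / (2 * real m) * (\<integral>\<omega>. \<bar>(1 + (X0 \<omega>)\<^sup>2 / \<sigma>\<^sup>2) * E0 (S m) \<omega>\<bar> \<partial>M))"
    proof (intro sum.cong refl)
      fix m
      have i: "integrable M (\<lambda>\<omega>. (X0 \<omega>)\<^sup>2 * \<bar>E0 (S m) \<omega>\<bar>)"
        using integrable_abs[OF integrable_E0_S_products(2)[of m]] by (simp add: abs_mult)
      have "(\<integral>\<omega>. \<bar>(1 + (X0 \<omega>)\<^sup>2 / \<sigma>\<^sup>2) * E0 (S m) \<omega>\<bar> \<partial>M)
          = (\<integral>\<omega>. \<bar>E0 (S m) \<omega>\<bar> + (X0 \<omega>)\<^sup>2 * \<bar>E0 (S m) \<omega>\<bar> / \<sigma>\<^sup>2 \<partial>M)"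
      proof (intro Bochner_Integration.integral_cong refl)
        fix \<omega>
        have "\<bar>1 + (X0 \<omega>)\<^sup>2 / \<sigma>\<^sup>2\<bar> = 1 + (X0 \<omega>)\<^sup>2 / \<sigma>\<^sup>2" by (rule abs_of_nonneg) simp
        then show "\<bar>(1 + (X0 \<omega>)\<^sup>2 / \<sigma>\<^sup>2) * E0 (S m) \<omega>\<bar> = \<bar>E0 (S m) \<omega>\<bar> + (X0 \<omega>)\<^sup>2 * \<bar>E0 (S m) \<omega>\<bar> / \<sigma>\<^sup>2"
          unfolding abs_mult by (simp add: distrib_right)
      qed
      also have "\<dots> = e m + g m / \<sigma>\<^sup>2"
        using i integrable_E0_S_products(3)[of m] by (simp add: e_def g_def)
      finally show "1 / (2 * real m) * e m + 1 / (2 * \<sigma>\<^sup>2 * real m) * g m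
        = 1 / (2 * real m) * (\<integral>\<omega>. \<bar>(1 + (X0 \<omega>)\<^sup>2 / \<sigma>\<^sup>2) * E0 (S m) \<omega>\<bar> \<partial>M)"
        by (simp add: distrib_left mult.commute)
    qed
    finally show ?thesis .
  qed
  have "(\<Sum>m=1..n. b m) = (\<Sum>m=1..n. v m) / 2 + (\<Sum>m=1..n. 1 / (\<sigma> * sqrt (real m)) * rho m)
      + (\<Sum>m=1..n. L / (6 * \<sigma>\<^sup>2 * real m)) + (\<Sum>m=1..n. hermite_norm 3 * \<sigma> / (8 * (real m * sqrt (real m))))
      + (\<Sum>m=1..n. 1 / (2 * real m) * e m) + (\<Sum>m=1..n. 1 / (2 * \<sigma>\<^sup>2 * real m) * g (m - 1))"
    unfolding b_def sum.distrib sum_divide_distrib ..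
  with main sv sL sg se show ?thesis unfolding L_def[symmetric] A_def[symmetric] B_def[symmetric] rho_def[symmetric]
    by linarith
qed

lemma smoothing_at_0_distributed:
  assumes Y: "distributed N lborel Y std_normal_density" and f: "1-lipschitz_on UNIV f"
  shows "(\<integral>y. f (c * Y y) \<partial>N) = smoothing 0 c f 0"
proof -
  note [measurable] = lipschitz_borel_measurable[OF f]
  have "(\<integral>y. std_normal_density y * f (c * y) \<partial>lborel) = (\<integral>y. f (c * Y y) \<partial>N)"
    by (rule distributed_integral[OF Y]) (auto simp: normal_density_nonneg)
  then show ?thesis by (simp add: smoothing_0 mult.commute)
qed

text \<open>
Only the products \<open>X\<^sub>0 W\<^sub>m\<close> may fail to be integrable, and then the right-hand side is infinite.
\<close>

lemma mean_clt_bound_d1: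
  fixes \<sigma> :: real and Z :: "'a \<Rightarrow> real" and R W :: "nat \<Rightarrow> 'a \<Rightarrow> real" and N :: "'b measure"
  assumes Y: "distributed N lborel Y std_normal_density"
    and s: "0 < \<sigma>" and n: "1 \<le> n"
    and G: "L1_tendsto M (\<lambda>n \<omega>. X0 \<omega> * E0 (S n) \<omega>) G"
    and R: "\<And>m. 1 \<le> m \<Longrightarrow> L1_tendsto M (\<lambda>K \<omega>. \<Sum>l=m..K. X0 \<omega> * E0 (X (int l)) \<omega>) (R m)"
    and Z: "\<And>\<omega>. Z \<omega> = X0 \<omega> ^ 2 - \<sigma> ^ 2 + 2 * G \<omega>"
    and W: "\<And>m. W m = E0 (\<lambda>\<omega>. \<Sum>l=1..m. Z (iter (int l) \<omega>))"
  shows "d1 M (S n) N (\<lambda>y. \<sigma> * sqrt (real n) * Y y)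
    \<le> ereal (13 * \<sigma> / 6) + ereal ((\<integral>\<omega>. \<bar>X0 \<omega>\<bar> ^ 3 \<partial>M) / \<sigma> ^ 2 / 6 * ln (1 + 2 * real n))
      + (\<Sum>m=1..nat \<lfloor>sqrt (2 * real n)\<rfloor>.
          (L1_norm M (\<lambda>\<omega>. X0 \<omega> * W m \<omega>) + ereal (2 * \<sigma>) * L1_norm M (W m)) / ereal (real m * \<sigma> ^ 2))
      + ((\<Sum>m=1..n. ereal (1 / (\<sigma> * sqrt (real m))) * L1_norm M (R m))
        + (\<Sum>m=1..n. ereal (1 / (2 * real m)) * L1_norm M (\<lambda>\<omega>. (1 + X0 \<omega> ^ 2 / \<sigma> ^ 2) * E0 (S m) \<omega>)))"
    (is "_ \<le> ?c + ?l + ?w + (?r + ?e)")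
proof -
  let ?q = "nat \<lfloor>sqrt (2 * real n)\<rfloor>"
  have Gi: "integrable M G" using G by (simp add: L1_tendsto_iff)
  have Ri: "integrable M (R m)" if "1 \<le> m" for m using R[OF that] by (simp add: L1_tendsto_iff)
  have GR: "AE \<omega> in M. R (Suc r) \<omega> = G \<omega> - X0 \<omega> * E0 (S r) \<omega>" for r
    by (rule L1_tendsto_unique[OF R projective_tail[OF G]]) simp
  have Zi: "integrable M Z" unfolding Z[abs_def] using integrable_X0_powers Gi by auto
  have [measurable]: "Z \<in> borel_measurable M" using Zi by simp
  have "integrable M (\<lambda>\<omega>. Z (iter i \<omega>))" for i using Zi by (subst integral_iter(2)) auto
  then have Wi: "integrable M (W m)" for m
    unfolding W E0_def by (intro real_cond_exp_int Bochner_Integration.integrable_sum)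
  have Ei: "integrable M (\<lambda>\<omega>. (1 + X0 \<omega> ^ 2 / \<sigma> ^ 2) * E0 (S m) \<omega>)" for m
    using integrable_E0_S_products(2,3)[of m] by (simp add: distrib_right)
  have r: "?r = ereal (\<Sum>m=1..n. 1 / (\<sigma> * sqrt (real m)) * (\<integral>\<omega>. \<bar>R m \<omega>\<bar> \<partial>M))"
    unfolding sum_ereal[symmetric] by (intro sum.cong refl) (simp add: L1_norm_integrable[OF Ri])
  have e: "?e = ereal (\<Sum>m=1..n. 1 / (2 * real m) * (\<integral>\<omega>. \<bar>(1 + (X0 \<omega>)\<^sup>2 / \<sigma>\<^sup>2) * E0 (S m) \<omega>\<bar> \<partial>M))"
    unfolding sum_ereal[symmetric] by (intro sum.cong refl) (simp add: L1_norm_integrable[OF Ei])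
  show ?thesis
  proof (cases "\<forall>m\<in>{1..?q}. integrable M (\<lambda>\<omega>. X0 \<omega> * W m \<omega>)")
    case True
    have w: "?w = ereal (\<Sum>m=1..?q. ((\<integral>\<omega>. \<bar>X0 \<omega> * W m \<omega>\<bar> \<partial>M) + 2 * \<sigma> * (\<integral>\<omega>. \<bar>W m \<omega>\<bar> \<partial>M)) / (real m * \<sigma>\<^sup>2))"
      unfolding sum_ereal[symmetric] using True s
      by (intro sum.cong refl) (simp add: L1_norm_integrable Wi)
    show ?thesis
      unfolding d1_def r e w plus_ereal.simps
    proof (rule SUP_least)
      fix f :: "real \<Rightarrow> real" assume "f \<in> {f. 1-lipschitz_on UNIV f}"
      then have f: "1-lipschitz_on UNIV f" by simp
      show "ereal ((\<integral>\<omega>. f (S n \<omega>) \<partial>M) - (\<integral>y. f (\<sigma> * sqrt (real n) * Y y) \<partial>N))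
        \<le> ereal (13 * \<sigma> / 6 + (\<integral>\<omega>. \<bar>X0 \<omega>\<bar> ^ 3 \<partial>M) / \<sigma>\<^sup>2 / 6 * ln (1 + 2 * real n)
          + (\<Sum>m=1..?q. ((\<integral>\<omega>. \<bar>X0 \<omega> * W m \<omega>\<bar> \<partial>M) + 2 * \<sigma> * (\<integral>\<omega>. \<bar>W m \<omega>\<bar> \<partial>M)) / (real m * \<sigma>\<^sup>2))
          + ((\<Sum>m=1..n. 1 / (\<sigma> * sqrt (real m)) * (\<integral>\<omega>. \<bar>R m \<omega>\<bar> \<partial>M))
            + (\<Sum>m=1..n. 1 / (2 * real m) * (\<integral>\<omega>. \<bar>(1 + (X0 \<omega>)\<^sup>2 / \<sigma>\<^sup>2) * E0 (S m) \<omega>\<bar> \<partial>M))))"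
        unfolding ereal_less_eq smoothing_at_0_distributed[OF Y f]
        by (rule mean_clt_bound[OF f s n Gi _ GR Z W]) (use Ri True in auto)
    qed
  next
    case False
    then obtain m where m: "m \<in> {1..?q}" and ni: "\<not> integrable M (\<lambda>\<omega>. X0 \<omega> * W m \<omega>)" by blast
    have "L1_norm M (\<lambda>\<omega>. X0 \<omega> * W m \<omega>) = \<infinity>"
      by (rule L1_norm_not_integrable) (use ni Wi[of m] in auto)
    then have "(L1_norm M (\<lambda>\<omega>. X0 \<omega> * W m \<omega>) + ereal (2 * \<sigma>) * L1_norm M (W m)) / ereal (real m * \<sigma> ^ 2) = \<infinity>"
      using s m by (simp add: L1_norm_integrable[OF Wi])
    then have "?w = \<infinity>" unfolding sum_Pinfty using m by blast
    then show ?thesis by (simp add: r e)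
  qed
qed

end

theorem theorem2p2:
  fixes M M0 :: "'a measure" and T :: "'a \<Rightarrow> 'a" and X0 :: "'a \<Rightarrow> real"
    and X :: "int \<Rightarrow> 'a \<Rightarrow> real" and S :: "nat \<Rightarrow> 'a \<Rightarrow> real"
    and E0 :: "('a \<Rightarrow> real) \<Rightarrow> 'a \<Rightarrow> real"
    and N :: "'b measure" and Y :: "'b \<Rightarrow> real"
  assumes "prob_space M"
    and "invertible_mpt M T"
    and "subalgebra M M0"
    and "sets M0 \<subseteq> sets (vimage_algebra (space M) T M0)"
    and "X0 \<in> borel_measurable M0"
    and "integrable M (\<lambda>\<omega>. \<bar>X0 \<omega>\<bar> ^ 3)"
    and "(\<integral>\<omega>. X0 \<omega> \<partial>M) = 0"
    and X_def: "\<And>i. X i = (\<lambda>\<omega>. X0 (int_iterate M T i \<omega>))"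
    and S_def: "\<And>n. S n = (\<lambda>\<omega>. \<Sum>k=1..n. X (int k) \<omega>)"
    and E0_def: "E0 = real_cond_exp M M0"
    and "\<And>k :: int. AE \<omega> in M.
           real_cond_exp M (invariant_algebra M T) (\<lambda>\<omega>. X0 \<omega> * X k \<omega>) \<omega>
             = (\<integral>\<omega>. X0 \<omega> * X k \<omega> \<partial>M)"
    and "L1_convergent M (\<lambda>n \<omega>. X0 \<omega> * E0 (S n) \<omega>)"
    and "prob_space N"
    and "distributed N lborel Y std_normal_density"
  shows "\<exists>v\<ge>0.
    (\<lambda>K. (\<integral>\<omega>. X0 \<omega> ^ 2 \<partial>M) + 2 * (\<Sum>k=1..K. \<integral>\<omega>. X0 \<omega> * X (int k) \<omega> \<partial>M)) \<longlonglongrightarrow> v \<and>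
    (\<forall>m\<ge>1. L1_convergent M (\<lambda>K \<omega>. \<Sum>l=m..K. X0 \<omega> * E0 (X (int l)) \<omega>)) \<and>
    (\<forall>\<sigma>>0. \<sigma> ^ 2 = v \<longrightarrow>
      (let Z0 = (\<lambda>\<omega>. X0 \<omega> ^ 2 - \<sigma> ^ 2 + 2 * L1_lim M (\<lambda>n \<omega>. X0 \<omega> * E0 (S n) \<omega>) \<omega>);
           Z = (\<lambda>(l::nat) \<omega>. Z0 (int_iterate M T (int l) \<omega>));
           W = (\<lambda>m::nat. E0 (\<lambda>\<omega>. \<Sum>l=1..m. Z l \<omega>));
           \<Lambda> = (\<integral>\<omega>. \<bar>X0 \<omega>\<bar> ^ 3 \<partial>M) / \<sigma> ^ 2;
           R = (\<lambda>m::nat. L1_lim M (\<lambda>K \<omega>. \<Sum>l=m..K. X0 \<omega> * E0 (X (int l)) \<omega>));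
           D' = (\<lambda>n::nat.
               (\<Sum>m=1..n. ereal (1 / (\<sigma> * sqrt (real m))) * L1_norm M (R m))
             + (\<Sum>m=1..n. ereal (1 / (2 * real m)) *
                  L1_norm M (\<lambda>\<omega>. (1 + X0 \<omega> ^ 2 / \<sigma> ^ 2) * E0 (S m) \<omega>)))
       in \<forall>n\<ge>1.
         d1 M (S n) N (\<lambda>y. \<sigma> * sqrt (real n) * Y y)
         \<le> ereal (13 * \<sigma> / 6) + ereal (\<Lambda> / 6 * ln (1 + 2 * real n))
           + (\<Sum>m=1..nat \<lfloor>sqrt (2 * real n)\<rfloor>.
                (L1_norm M (\<lambda>\<omega>. X0 \<omega> * W m \<omega>) + ereal (2 * \<sigma>) * L1_norm M (W m))
                / ereal (real m * \<sigma> ^ 2))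
           + D' n))"
proof -
  interpret stationary_sequence M M0 T X0
    using assms(1-7) by (simp add: stationary_sequence_def stationary_sequence_axioms_def)
  interpret N: prob_space N by fact
  have XX: "X = local.X" by (intro ext) (simp add: assms(8) local.X_def)
  have SS: "S = local.S" by (intro ext) (simp add: assms(9) local.S_def XX)
  have EE: "E0 = local.E0" by (simp add: assms(10) local.E0_def)
  define G where "G = L1_lim M (\<lambda>n \<omega>. X0 \<omega> * local.E0 (local.S n) \<omega>)"
  have G: "L1_tendsto M (\<lambda>n \<omega>. X0 \<omega> * local.E0 (local.S n) \<omega>) G"
    using assms(12) unfolding G_def SS EE by (rule L1_lim_tendsto)
  have R: "L1_convergent M (\<lambda>K \<omega>. \<Sum>l=m..K. X0 \<omega> * local.E0 (local.X (int l)) \<omega>)" if "1 \<le> m" for m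
    using projective_tail[OF G, of "m - 1"] that by (auto simp: L1_convergent_def)
  show ?thesis
    unfolding XX SS EE Let_def G_def[symmetric]
  proof (intro exI conjI allI impI)
    show "(\<lambda>K. (\<integral>\<omega>. X0 \<omega> ^ 2 \<partial>M) + 2 * (\<Sum>k=1..K. \<integral>\<omega>. X0 \<omega> * local.X (int k) \<omega> \<partial>M))
      \<longlonglongrightarrow> (\<integral>\<omega>. X0 \<omega> ^ 2 \<partial>M) + 2 * (\<integral>\<omega>. G \<omega> \<partial>M)"
      by (rule long_run_variance(1)[OF G])
    show "0 \<le> (\<integral>\<omega>. X0 \<omega> ^ 2 \<partial>M) + 2 * (\<integral>\<omega>. G \<omega> \<partial>M)"
      by (rule long_run_variance(2)[OF G])
  qed (fact R | rule mean_clt_bound_d1[OF assms(14) _ _ G L1_lim_tendsto[OF R] refl refl]; assumption)+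
qed

end
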